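(* Let $d\geq 3$ and let $(M,g)$ be the Kasner spacetime $M=(0,\infty)\times\mathbb{R}^d$, $g=-dt^2+\sum_{i=1}^d t^{2p_i}\,dx_i^2$, with $\sum_i p_i=1$, $\sum_i p_i^2=1$ and at least one $p_i<0$, time-oriented by $\partial_t$. Then $(M,g)$ is past $C^0$-inextendible, i.e. there is no $C^0$-extension $\iota:M\hookrightarrow\tilde M$ with $\partial^-\iota(M)\neq\emptyset$.
   Context: A $C^0$-extension is a smooth isometric embedding $\iota:M\hookrightarrow\tilde M$ into a Lorentzian manifold $(\tilde M,\tilde g)$ of the same dimension with continuous metric $\tilde g$, such that $\partial\iota(M)\neq\emptyset$. A timelike curve is a piecewise smooth curve whose tangent vectors (where defined) are timelike and whose one-sided derivatives at break points lie in the same component of the timelike cone; it is past directed timelike (PDTL) if its tangents lie in the past cone. The past boundary $\partial^-\iota(M)$ is the set of $p\in\partial\iota(M)$ for which there is a smooth timelike curve $\gamma:[0,1]\to\tilde M$ with $\gamma([0,1))\subseteq\iota(M)$, $\iota^{-1}\circ\gamma|_{[0,1)}$ PDTL in $M$, and $\gamma(1)=p$. *)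

theory Defs
  imports "HOL-Analysis.Analysis"
begin

inductive_set iter_derivs :: "'a::real_normed_vector set \<Rightarrow> ('a \<Rightarrow> 'b::real_normed_vector) \<Rightarrow> ('a \<Rightarrow> 'b) set"
  for S :: "'a set" and f :: "'a \<Rightarrow> 'b" where
  base: "f \<in> iter_derivs S f"
| step: "g \<in> iter_derivs S f \<Longrightarrow> (\<lambda>x. frechet_derivative g (at x within S) v) \<in> iter_derivs S f"

definition Cinf_on :: "'a::real_normed_vector set \<Rightarrow> ('a \<Rightarrow> 'b::real_normed_vector) \<Rightarrow> bool" where
  "Cinf_on S f \<longleftrightarrow> (\<forall>g\<in>iter_derivs S f. g differentiable_on S)"

type_synonym 'n spt = "real \<times> (real ^ 'n)"

definition minkowski :: "'n::finite spt \<Rightarrow> 'n spt \<Rightarrow> real" where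
  "minkowski v w = - fst v * fst w + snd v \<bullet> snd w"

definition lorentzian_form :: "('n::finite spt \<Rightarrow> 'n spt \<Rightarrow> real) \<Rightarrow> bool" where
  "lorentzian_form B \<longleftrightarrow> (\<exists>L::'n spt \<Rightarrow> 'n spt. linear L \<and> bij L \<and> (\<forall>v w. B (L v) (L w) = minkowski v w))"

definition chart :: "'m::topological_space set \<Rightarrow> ('m \<Rightarrow> 'n::finite spt) \<Rightarrow> bool" where
  "chart U \<phi> \<longleftrightarrow> open U \<and> inj_on \<phi> U \<and> continuous_on U \<phi> \<and> open (\<phi> ` U)
      \<and> continuous_on (\<phi> ` U) (inv_into U \<phi>)"

definition transition :: "('m set \<times> ('m \<Rightarrow> 'n spt)) \<Rightarrow> ('m set \<times> ('m \<Rightarrow> 'n spt)) \<Rightarrow> 'n spt \<Rightarrow> 'n spt" where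
  "transition c c' = snd c' \<circ> inv_into (fst c) (snd c)"

definition smooth_atlas :: "('m::topological_space set \<times> ('m \<Rightarrow> 'n::finite spt)) set \<Rightarrow> bool" where
  "smooth_atlas A \<longleftrightarrow> (\<forall>c\<in>A. chart (fst c) (snd c)) \<and> \<Union>(fst ` A) = UNIV
     \<and> (\<forall>c\<in>A. \<forall>c'\<in>A. Cinf_on (snd c ` (fst c \<inter> fst c')) (transition c c'))"

text \<open>A continuous Lorentzian metric, given by its local coordinate expressions
  G c y v w (chart c, point y = chart coordinates, tangent vectors v w in coordinates),
  continuous in y and transforming as a (0,2)-tensor under chart changes.\<close>
definition C0_lorentz_metric ::
  "('m::topological_space set \<times> ('m \<Rightarrow> 'n::finite spt)) set
   \<Rightarrow> ('m set \<times> ('m \<Rightarrow> 'n spt) \<Rightarrow> 'n spt \<Rightarrow> 'n spt \<Rightarrow> 'n spt \<Rightarrow> real) \<Rightarrow> bool" where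
  "C0_lorentz_metric A G \<longleftrightarrow>
     (\<forall>c\<in>A. (\<forall>y\<in>snd c ` fst c. lorentzian_form (G c y))
        \<and> (\<forall>v w. continuous_on (snd c ` fst c) (\<lambda>y. G c y v w)))
   \<and> (\<forall>c\<in>A. \<forall>c'\<in>A. \<forall>y\<in>snd c ` (fst c \<inter> fst c'). \<forall>v w.
        G c y v w = G c' (transition c c' y)
                      (frechet_derivative (transition c c') (at y) v)
                      (frechet_derivative (transition c c') (at y) w))"

definition lorentzian_C0_manifold ::
  "('m::{t2_space,second_countable_topology} set \<times> ('m \<Rightarrow> 'n::finite spt)) set
   \<Rightarrow> ('m set \<times> ('m \<Rightarrow> 'n spt) \<Rightarrow> 'n spt \<Rightarrow> 'n spt \<Rightarrow> 'n spt \<Rightarrow> real) \<Rightarrow> bool" where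
  "lorentzian_C0_manifold A G \<longleftrightarrow> smooth_atlas A \<and> C0_lorentz_metric A G"

definition kasner_M :: "'n::finite spt set" where
  "kasner_M = {x. fst x > 0}"

definition kasner_g :: "real ^ 'n::finite \<Rightarrow> 'n spt \<Rightarrow> 'n spt \<Rightarrow> 'n spt \<Rightarrow> real" where
  "kasner_g p x v w = - fst v * fst w + (\<Sum>i\<in>UNIV. fst x powr (2 * p $ i) * (snd v $ i) * (snd w $ i))"

text \<open>Past directed timelike vector (time orientation by d/dt: past directed iff g(v, d/dt) > 0).\<close>
definition kasner_pdtl_vec :: "real ^ 'n::finite \<Rightarrow> 'n spt \<Rightarrow> 'n spt \<Rightarrow> bool" where
  "kasner_pdtl_vec p x v \<longleftrightarrow> kasner_g p x v v < 0 \<and> kasner_g p x v (1, 0) > 0"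

text \<open>Piecewise smooth past directed timelike curve c : I -> M (I a real interval):
  c is continuous, and there are finitely many break points such that on every compact
  subinterval free of break points in its interior c is smooth with PDTL tangents (including
  one-sided tangents at the end points). Since the past cone is one component, the one-sided
  derivatives at break points automatically lie in the same component.\<close>
definition kasner_pdtl_curve :: "real ^ 'n::finite \<Rightarrow> real set \<Rightarrow> (real \<Rightarrow> 'n spt) \<Rightarrow> bool" where
  "kasner_pdtl_curve p I c \<longleftrightarrow> c ` I \<subseteq> kasner_M \<and> continuous_on I c \<and>
     (\<exists>K. finite K \<and> (\<forall>a b. a < b \<and> {a..b} \<subseteq> I \<and> {a<..<b} \<inter> K = {} \<longrightarrow>
         Cinf_on {a..b} c \<and>
         (\<forall>s\<in>{a..b}. kasner_pdtl_vec p (c s) (frechet_derivative c (at s within {a..b}) 1))))"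

definition smooth_isometric_embedding ::
  "real ^ 'n::finite
   \<Rightarrow> ('m::{t2_space,second_countable_topology} set \<times> ('m \<Rightarrow> 'n spt)) set
   \<Rightarrow> ('m set \<times> ('m \<Rightarrow> 'n spt) \<Rightarrow> 'n spt \<Rightarrow> 'n spt \<Rightarrow> 'n spt \<Rightarrow> real)
   \<Rightarrow> ('n spt \<Rightarrow> 'm) \<Rightarrow> bool" where
  "smooth_isometric_embedding p A G \<iota> \<longleftrightarrow>
     inj_on \<iota> kasner_M \<and> continuous_on kasner_M \<iota>
   \<and> continuous_on (\<iota> ` kasner_M) (inv_into kasner_M \<iota>)
   \<and> (\<forall>c\<in>A. Cinf_on (kasner_M \<inter> \<iota> -` fst c) (snd c \<circ> \<iota>))
   \<and> (\<forall>c\<in>A. \<forall>x\<in>kasner_M \<inter> \<iota> -` fst c. \<forall>v w.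
        G c (snd c (\<iota> x)) (frechet_derivative (snd c \<circ> \<iota>) (at x) v)
                          (frechet_derivative (snd c \<circ> \<iota>) (at x) w)
        = kasner_g p x v w)"

definition kasner_C0_extension ::
  "real ^ 'n::finite
   \<Rightarrow> ('m::{t2_space,second_countable_topology} set \<times> ('m \<Rightarrow> 'n spt)) set
   \<Rightarrow> ('m set \<times> ('m \<Rightarrow> 'n spt) \<Rightarrow> 'n spt \<Rightarrow> 'n spt \<Rightarrow> 'n spt \<Rightarrow> real)
   \<Rightarrow> ('n spt \<Rightarrow> 'm) \<Rightarrow> bool" where
  "kasner_C0_extension p A G \<iota> \<longleftrightarrow> lorentzian_C0_manifold A G
     \<and> smooth_isometric_embedding p A G \<iota> \<and> frontier (\<iota> ` kasner_M) \<noteq> {}"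

definition smooth_curve01 ::
  "('m::topological_space set \<times> ('m \<Rightarrow> 'n::finite spt)) set \<Rightarrow> (real \<Rightarrow> 'm) \<Rightarrow> bool" where
  "smooth_curve01 A \<gamma> \<longleftrightarrow> continuous_on {0..1} \<gamma>
     \<and> (\<forall>c\<in>A. Cinf_on ({0..1} \<inter> \<gamma> -` fst c) (snd c \<circ> \<gamma>))"

definition timelike_curve01 ::
  "('m::topological_space set \<times> ('m \<Rightarrow> 'n::finite spt)) set
   \<Rightarrow> ('m set \<times> ('m \<Rightarrow> 'n spt) \<Rightarrow> 'n spt \<Rightarrow> 'n spt \<Rightarrow> 'n spt \<Rightarrow> real)
   \<Rightarrow> (real \<Rightarrow> 'm) \<Rightarrow> bool" where
  "timelike_curve01 A G \<gamma> \<longleftrightarrow> smooth_curve01 A \<gamma> \<and>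
     (\<forall>c\<in>A. \<forall>t\<in>{0..1} \<inter> \<gamma> -` fst c.
        (let u = frechet_derivative (snd c \<circ> \<gamma>) (at t within ({0..1} \<inter> \<gamma> -` fst c)) 1
         in G c (snd c (\<gamma> t)) u u < 0))"

definition past_boundary ::
  "real ^ 'n::finite
   \<Rightarrow> ('m::{t2_space,second_countable_topology} set \<times> ('m \<Rightarrow> 'n spt)) set
   \<Rightarrow> ('m set \<times> ('m \<Rightarrow> 'n spt) \<Rightarrow> 'n spt \<Rightarrow> 'n spt \<Rightarrow> 'n spt \<Rightarrow> real)
   \<Rightarrow> ('n spt \<Rightarrow> 'm) \<Rightarrow> 'm set" where
  "past_boundary p A G \<iota> = {q \<in> frontier (\<iota> ` kasner_M). \<exists>\<gamma>.
      timelike_curve01 A G \<gamma> \<and> \<gamma> ` {0..<1} \<subseteq> \<iota> ` kasner_M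
      \<and> kasner_pdtl_curve p {0..<1} (inv_into kasner_M \<iota> \<circ> \<gamma>) \<and> \<gamma> 1 = q}"

end

theory Submission
  imports Defs
begin

text \<open>
  Suppose a timelike curve \<open>\<gamma>\<close> runs into a past boundary point, and look at a chart there, in which
  all light cones are close to those of the boundary point. Towards \<open>t = 0\<close> the comoving coordinates
  along \<open>\<gamma>\<close> converge, say to \<open>x0\<close>. Timelike curves of the Kasner spacetime between two points of
  \<open>\<gamma>\<close> are homotopic to \<open>\<gamma>\<close> through timelike curves (interpolate linearly at equal times), so they
  cannot leave the chart. Hence the chart contains a point on the boundary of the horizon of
  \<open>x0\<close> in a direction \<open>j\<close> with \<open>p\<^sub>j < 0\<close>.

  Parallel timelike chart lines above the boundary all run into \<open>t = 0\<close>, and the slices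
  \<open>t = \<tau>\<close> are graphs over the transversal directions, of uniformly bounded diameter. As
  \<open>\<tau>\<^bsup>p\<^sub>j\<^esup>\<close> tends to infinity, all these lines end at the same \<open>j\<close>-th coordinate, that of
  \<open>x0\<close>. This is impossible for the line through the point on the boundary of the horizon, because a
  timelike curve ends strictly inside it.
\<close>

section \<open>Kasner kinematics and cones\<close>

text \<open>Since the extended metric is merely continuous, the proof can use neither its curvature
  nor its geodesics and compares light cones only. A chart does not show which of its points belong
  to Kasner spacetime, so claims that a segment or curve stays there are open and closed arguments
  in a parameter. Closedness rests on the Hausdorff property, combined with bounds that keep the
  Kasner time away from \<open>0\<close> and the comoving coordinates bounded. These coordinates
  converge along the curve because every exponent is below \<open>1\<close>, which makes
  \<open>t powr (- p $ i)\<close> integrable at \<open>0\<close>. The point on the boundary of the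
  horizon is reached only as a limit: the extremal return curve is null, whereas the deformation
  argument needs timelike curves. The contradiction needs a gap that does not shrink as the slices
  approach the singularity; a fixed intermediate time on the line secures it.\<close>

definition kasner_scale :: "real ^ 'n::finite \<Rightarrow> real \<Rightarrow> real ^ 'n \<Rightarrow> real ^ 'n" where
  "kasner_scale p t w = (\<chi> i. t powr (p $ i) * w $ i)"

text \<open>For \<open>q < 1\<close> this is the integral of \<open>s powr (- q)\<close> over
  \<open>0 < s < t\<close>: the comoving distance that light covers between the singularity and time
  \<open>t\<close> in a direction with exponent \<open>q\<close>.\<close>

definition horizon :: "real \<Rightarrow> real \<Rightarrow> real" where
  "horizon q t = t powr (1 - q) / (1 - q)"

lemma linear_kasner_scale: "linear (kasner_scale p t)"
  by (auto simp: linear_iff kasner_scale_def vec_eq_iff algebra_simps)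

text \<open>\<open>kasner_scale\<close> yields the components in the orthonormal frame of a slice of
  constant time, in which the metric takes its Minkowski form.\<close>

lemma kasner_g_eq:
  assumes "fst x > 0"
  shows "kasner_g p x v v = (norm (kasner_scale p (fst x) (snd v)))\<^sup>2 - (fst v)\<^sup>2"
proof -
  have "fst x powr (2 * p $ i) = (fst x powr (p $ i))\<^sup>2" for i
    by (simp add: power2_eq_square powr_add [symmetric])
  then show ?thesis
    unfolding kasner_g_def power2_norm_eq_inner
    by (simp add: inner_vec_def kasner_scale_def power2_eq_square algebra_simps)
qed

lemma kasner_timelike_iff:
  assumes "fst x > 0"
  shows "kasner_g p x v v < 0 \<longleftrightarrow> norm (kasner_scale p (fst x) (snd v)) < \<bar>fst v\<bar>"
proof -
  have "kasner_g p x v v < 0 \<longleftrightarrow> (norm (kasner_scale p (fst x) (snd v)))\<^sup>2 < \<bar>fst v\<bar>\<^sup>2"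
    unfolding kasner_g_eq[OF assms] by simp
  also have "\<dots> \<longleftrightarrow> norm (kasner_scale p (fst x) (snd v)) < \<bar>fst v\<bar>"
    using abs_ge_zero norm_ge_zero power2_less_imp_less power_strict_mono zero_less_numeral by metis
  finally show ?thesis .
qed

text \<open>For a negative exponent the factor tends to \<open>0\<close> with \<open>t\<close>:
  slice vectors of bounded length have vanishing \<open>i\<close>-th coordinate near the
  singularity. The final contradiction rests on this.\<close>

lemma kasner_scale_component:
  assumes "t > 0"
  shows "\<bar>w $ i\<bar> \<le> t powr (- (p $ i)) * norm (kasner_scale p t w)"
proof -
  have "t powr (p $ i) * \<bar>w $ i\<bar> = \<bar>kasner_scale p t w $ i\<bar>"
    by (simp add: kasner_scale_def abs_mult)
  also have "\<dots> \<le> norm (kasner_scale p t w)"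
    by (rule component_le_norm_cart)
  finally show ?thesis
    using assms by (simp add: powr_minus field_simps)
qed

text \<open>This normalization allows motion in direction \<open>j\<close> at a prescribed fraction
  of the speed of light.\<close>

lemma kasner_scale_axis:
  assumes "t > 0"
  shows "norm (kasner_scale p t (axis j (t powr (- (p $ j)) * a))) = \<bar>a\<bar>"
proof -
  have "kasner_scale p t (axis j (t powr (- (p $ j)) * a)) = axis j a"
    using assms by (auto simp: kasner_scale_def axis_def vec_eq_iff powr_minus)
  also have "\<dots> = a *\<^sub>R axis j 1" by (simp add: axis_def vec_eq_iff)
  finally show ?thesis by simp
qed

lemma kasner_timelike_component:
  assumes "fst x > 0" "kasner_g p x v v < 0"
  shows "\<bar>snd v $ i\<bar> < fst x powr (- (p $ i)) * \<bar>fst v\<bar>"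
proof -
  have "fst x powr (- (p $ i)) * norm (kasner_scale p (fst x) (snd v))
      < fst x powr (- (p $ i)) * \<bar>fst v\<bar>"
    using assms kasner_timelike_iff[OF assms(1)] by simp
  then show ?thesis
    using kasner_scale_component[OF assms(1), of "snd v" i p] by linarith
qed

lemma kasner_timelike_fst:
  assumes "fst x > 0" "kasner_g p x v v < 0"
  shows "fst v \<noteq> 0"
  using kasner_timelike_iff[OF assms(1), of p v] assms(2) by auto

lemma horizon_has_derivative:
  assumes "t > 0" "q < 1"
  shows "(horizon q has_real_derivative t powr (- q)) (at t)"
proof -
  have "((\<lambda>t. t powr (1 - q) / (1 - q)) has_real_derivative ((1 - q) * t powr (1 - q - 1)) / (1 - q)) (at t)"
    using assms by (auto intro!: derivative_eq_intros)
  moreover have "horizon q = (\<lambda>t. t powr (1 - q) / (1 - q))"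
    by (simp add: horizon_def fun_eq_iff)
  ultimately show ?thesis using assms by simp
qed

lemma horizon_mono:
  assumes "0 < s" "s \<le> t" "q < 1"
  shows "horizon q s \<le> horizon q t"
  using assms by (simp add: horizon_def divide_right_mono powr_mono2)

lemma horizon_strict_mono:
  assumes "0 < s" "s < t" "q < 1"
  shows "horizon q s < horizon q t"
  using assms by (simp add: horizon_def divide_strict_right_mono powr_less_mono2)

lemma horizon_pos: "0 < t \<Longrightarrow> q < 1 \<Longrightarrow> 0 < horizon q t"
  by (simp add: horizon_def)

lemma tendsto_horizon_0:
  assumes "q < 1" "(f \<longlongrightarrow> 0) A" "\<forall>\<^sub>F x in A. 0 \<le> f x"
  shows "((\<lambda>x. horizon q (f x)) \<longlongrightarrow> 0) A"
proof -
  have "((\<lambda>x. f x powr (1 - q)) \<longlongrightarrow> 0 powr (1-q)) A"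
    using assms by (intro tendsto_powr2) auto
  then show ?thesis
    unfolding horizon_def using tendsto_divide[of _ 0 A "\<lambda>_. 1 - q" "1-q"] assms by simp
qed

text \<open>Cauchy's mean value theorem compares the comoving displacement with the horizon
  without knowing the time orientation of the curve.\<close>

lemma kasner_timelike_curve:
  fixes c c' :: "real \<Rightarrow> 'n::finite spt"
  assumes ab: "a < b" and cont: "continuous_on {a..b} c"
    and M: "\<And>s. s \<in> {a..b} \<Longrightarrow> fst (c s) > 0"
    and der: "\<And>s. s \<in> {a<..<b} \<Longrightarrow> (c has_vector_derivative c' s) (at s)"
    and tl: "\<And>s. s \<in> {a<..<b} \<Longrightarrow> kasner_g p (c s) (c' s) (c' s) < 0"
  shows "fst (c a) \<noteq> fst (c b)"
    and "p $ i < 1 \<Longrightarrow> \<bar>snd (c b) $ i - snd (c a) $ i\<bar>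
           < \<bar>horizon (p $ i) (fst (c b)) - horizon (p $ i) (fst (c a))\<bar>"
proof -
  have dT: "((\<lambda>s. fst (c s)) has_real_derivative fst (c' s)) (at s)" if "s \<in> {a<..<b}" for s
    using bounded_linear.has_vector_derivative[OF bounded_linear_fst der[OF that]]
    by (simp add: has_real_derivative_iff_has_vector_derivative)
  have dX: "((\<lambda>s. snd (c s) $ i) has_real_derivative snd (c' s) $ i) (at s)" if "s \<in> {a<..<b}" for s i
    using bounded_linear.has_vector_derivative[OF bounded_linear_compose
        [OF bounded_linear_vec_nth bounded_linear_snd] der[OF that]]
    by (simp add: has_real_derivative_iff_has_vector_derivative)
  have contT: "continuous_on {a..b} (\<lambda>s. fst (c s))"
    and contX: "continuous_on {a..b} (\<lambda>s. snd (c s) $ i)" for i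
    using cont by (auto intro!: continuous_intros)
  obtain z where z: "z \<in> {a<..<b}" "fst (c b) - fst (c a) = (b - a) * fst (c' z)"
    using MVT[OF ab contT] dT
    by (metis DERIV_unique greaterThanLessThan_iff real_differentiable_def)
  then show ne: "fst (c a) \<noteq> fst (c b)"
    using kasner_timelike_fst[OF M tl[OF z(1)]] ab by force
  show "\<bar>snd (c b) $ i - snd (c a) $ i\<bar>
      < \<bar>horizon (p $ i) (fst (c b)) - horizon (p $ i) (fst (c a))\<bar>" if p: "p $ i < 1"
  proof -
    let ?h = "\<lambda>s. horizon (p $ i) (fst (c s))"
    have contH: "continuous_on {a..b} ?h"
      unfolding horizon_def using contT M p by (auto intro!: continuous_intros) (metis less_irrefl M atLeastAtMost_iff)+
    have dH: "(?h has_real_derivative fst (c s) powr (- (p $ i)) * fst (c' s)) (at s)" if "s \<in> {a<..<b}" for s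
      using DERIV_chain2[OF horizon_has_derivative[OF M p] dT[OF that]] that by auto
    \<comment> \<open>This combination has equal values at \<open>a\<close> and \<open>b\<close>;
      Rolle's theorem for it is Cauchy's mean value theorem for the coordinate and the
      horizon.\<close>
    let ?k = "\<lambda>s. (snd (c b) $ i - snd (c a) $ i) * ?h s - (?h b - ?h a) * snd (c s) $ i"
    let ?k' = "\<lambda>s. (snd (c b) $ i - snd (c a) $ i) * (fst (c s) powr (- (p $ i)) * fst (c' s))
            - (?h b - ?h a) * (snd (c' s) $ i)"
    have "\<exists>z>a. z < b \<and> (\<lambda>u. ?k' z * u) = (\<lambda>v. 0)"
    proof (rule Rolle_deriv[OF ab, of ?k])
      show "?k a = ?k b" by (simp add: algebra_simps)
      show "continuous_on {a..b} ?k"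
        by (intro continuous_on_diff continuous_on_mult continuous_on_const contH contX)
      show "(?k has_derivative (\<lambda>u. ?k' s * u)) (at s)" if "a < s" "s < b" for s
        using that dX[of s i] dH[of s] unfolding has_field_derivative_def[symmetric]
        by (auto intro!: derivative_eq_intros)
    qed
    then obtain z where z: "z \<in> {a<..<b}" and "(\<lambda>u. ?k' z * u) = (\<lambda>v. 0)" by auto
    then have eq: "(snd (c b) $ i - snd (c a) $ i) * (fst (c z) powr (- (p $ i)) * fst (c' z))
          = (?h b - ?h a) * (snd (c' z) $ i)"
      by (auto dest: fun_cong[of _ _ 1])
    \<comment> \<open>Distinct end times give distinct horizon values, which keeps the estimate
      strict.\<close>
    have hne: "?h b \<noteq> ?h a"
      using horizon_strict_mono[OF M _ p, of a "fst (c b)"] horizon_strict_mono[OF M _ p, of b "fst (c a)"] ne ab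
      by (cases "fst (c a)" "fst (c b)" rule: linorder_cases) auto
    have M': "fst (c z) > 0" using M z by auto
    have "\<bar>snd (c b) $ i - snd (c a) $ i\<bar> * (fst (c z) powr (- (p $ i)) * \<bar>fst (c' z)\<bar>)
        = \<bar>?h b - ?h a\<bar> * \<bar>snd (c' z) $ i\<bar>"
      using arg_cong[OF eq, of abs] by (simp add: abs_mult)
    also have "\<dots> < \<bar>?h b - ?h a\<bar> * (fst (c z) powr (- (p $ i)) * \<bar>fst (c' z)\<bar>)"
      using hne kasner_timelike_component[OF M' tl[OF z]] by (intro mult_strict_left_mono) auto
    finally show ?thesis
      using M' kasner_timelike_fst[OF M' tl[OF z]] by (simp add: mult_less_cancel_right)
  qed
qed

lemma kasner_timelike_curve_inj:
  fixes c c' :: "real \<Rightarrow> 'n::finite spt"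
  assumes cont: "continuous_on {a..b} c"
    and M: "\<And>s. s \<in> {a..b} \<Longrightarrow> fst (c s) > 0"
    and der: "\<And>s. s \<in> {a<..<b} \<Longrightarrow> (c has_vector_derivative c' s) (at s)"
    and tl: "\<And>s. s \<in> {a<..<b} \<Longrightarrow> kasner_g p (c s) (c' s) (c' s) < 0"
  shows "inj_on (\<lambda>s. fst (c s)) {a..b}"
proof (rule linorder_inj_onI)
  fix x y assume xy: "x < y" "x \<in> {a..b}" "y \<in> {a..b}"
  show "fst (c x) \<noteq> fst (c y)"
    by (rule kasner_timelike_curve(1)[OF xy(1) continuous_on_subset[OF cont] M der tl])
      (use xy in auto)
qed auto

section \<open>Segments in open sets and cones around a vector\<close>

lemma open_forall_compact:
  assumes "compact K" "open W"
  shows "open {x. \<forall>k\<in>K. (x, k) \<in> W}"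
proof (subst open_subopen, intro ballI)
  fix x assume "x \<in> {x. \<forall>k\<in>K. (x, k) \<in> W}"
  then have "{x} \<times> K \<subseteq> W" by auto
  from Elementary_Topology.tube_lemma[OF assms this]
  show "\<exists>T. open T \<and> x \<in> T \<and> T \<subseteq> {x. \<forall>k\<in>K. (x, k) \<in> W}" by auto
qed

text \<open>Segments are parametrized by the compact interval \<open>{0..1}\<close>, so the tube
  lemma applies. This is the openness half of the continuation arguments for segments.\<close>

lemma open_segment_pairs:
  fixes Y :: "'a::real_normed_vector set"
  assumes "open Y"
  shows "open {q. closed_segment (fst q) (snd q) \<subseteq> Y}"
proof -
  let ?h = "\<lambda>x::('a \<times> 'a) \<times> real. (1 - snd x) *\<^sub>R fst (fst x) + snd x *\<^sub>R snd (fst x)"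
  have "open (?h -` Y)"
    using assms by (intro open_vimage continuous_intros)
  from open_forall_compact[OF compact_Icc[of 0 1] this]
  have "open {q. \<forall>k\<in>{0..1}. (1 - k) *\<^sub>R fst q + k *\<^sub>R snd q \<in> Y}" by simp
  moreover have "{q. \<forall>k\<in>{0..1}. (1 - k) *\<^sub>R fst q + k *\<^sub>R snd q \<in> Y} = {q. closed_segment (fst q) (snd q) \<subseteq> Y}"
    unfolding closed_segment_def by fastforce
  ultimately show ?thesis by simp
qed

text \<open>The convex cone over the closed ball of radius \<open>k\<close> around \<open>n\<close>.
  The scale \<open>a\<close> is explicit because scales add when vectors are added.\<close>

definition cone_around :: "'a::real_normed_vector \<Rightarrow> real \<Rightarrow> 'a set" where
  "cone_around n k = {v. \<exists>a\<ge>0. norm (v - a *\<^sub>R n) \<le> k * a}"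

lemma cone_around_mono: "k \<le> k' \<Longrightarrow> cone_around n k \<subseteq> cone_around n k'"
  unfolding cone_around_def by (blast intro: order_trans mult_right_mono)

lemma cone_around_add:
  assumes "v \<in> cone_around n k" "w \<in> cone_around n k"
  shows "v + w \<in> cone_around n k"
proof -
  obtain a b where ab: "a \<ge> 0" "norm (v - a *\<^sub>R n) \<le> k * a" "b \<ge> 0" "norm (w - b *\<^sub>R n) \<le> k * b"
    using assms by (auto simp: cone_around_def)
  have "norm (v + w - (a + b) *\<^sub>R n) \<le> norm (v - a *\<^sub>R n) + norm (w - b *\<^sub>R n)"
    using norm_triangle_ineq[of "v - a *\<^sub>R n" "w - b *\<^sub>R n"] by (simp add: algebra_simps)
  then show ?thesis
    unfolding cone_around_def using ab by (intro CollectI exI[of _ "a + b"]) (auto simp: algebra_simps)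
qed

lemma cone_around_perturb:
  assumes v: "v \<in> cone_around n (k / 2)" and k: "k > 0"
    and e: "norm e \<le> (k / 2) / (norm n + k / 2) * norm v"
  shows "v + e \<in> cone_around n k"
proof -
  obtain a where a: "a \<ge> 0" "norm (v - a *\<^sub>R n) \<le> k / 2 * a" using v by (auto simp: cone_around_def)
  have pos: "norm n + k / 2 > 0" using k by (simp add: add_nonneg_pos)
  have "norm v \<le> norm (v - a *\<^sub>R n) + norm (a *\<^sub>R n)"
    using norm_triangle_ineq[of "v - a *\<^sub>R n" "a *\<^sub>R n"] by simp
  also have "\<dots> \<le> (norm n + k / 2) * a" using a by (simp add: algebra_simps)
  finally have "(k / 2) / (norm n + k / 2) * norm v \<le> (k / 2) / (norm n + k / 2) * ((norm n + k / 2) * a)"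
    using k pos by (intro mult_left_mono) auto
  also have "\<dots> = k / 2 * a" using pos by (metis less_irrefl mult.assoc nonzero_eq_divide_eq)
  finally have "norm e \<le> k / 2 * a" using e by linarith
  moreover have "norm (v + e - a *\<^sub>R n) \<le> norm (v - a *\<^sub>R n) + norm e"
    using norm_triangle_ineq[of "v - a *\<^sub>R n" e] by (simp add: algebra_simps)
  ultimately have "norm (v + e - a *\<^sub>R n) \<le> k * a" using a(2) by simp
  then show ?thesis using a(1) by (auto simp: cone_around_def)
qed

text \<open>If the sum vanished, the scales would satisfy
  \<open>norm n * (a + b) \<le> k * (a + b)\<close>, impossible for positive total scale when the
  axis is longer than the aperture.\<close>

lemma cone_around_pointed:
  assumes "v \<in> cone_around n k" "w \<in> cone_around n k" "v \<noteq> 0" "0 < k" "k < norm n"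
  shows "v + w \<noteq> 0"
proof
  assume 0: "v + w = 0"
  obtain a b where ab: "a \<ge> 0" "norm (v - a *\<^sub>R n) \<le> k * a" "b \<ge> 0" "norm (w - b *\<^sub>R n) \<le> k * b"
    using assms by (auto simp: cone_around_def)
  have "a \<noteq> 0" using ab(2) assms(3) by auto
  then have "a + b > 0" using ab by auto
  have "norm ((a + b) *\<^sub>R n) = norm (v - a *\<^sub>R n + (w - b *\<^sub>R n))"
    using 0 by (metis add.commute add_diff_add diff_0 norm_minus_cancel scaleR_add_left)
  also have "\<dots> \<le> k * (a + b)"
    using norm_triangle_ineq[of "v - a *\<^sub>R n" "w - b *\<^sub>R n"] ab by (simp add: algebra_simps)
  also have "\<dots> < norm n * (a + b)" using assms(5) \<open>a + b > 0\<close> by simp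
  finally show False using \<open>a + b > 0\<close> by (simp add: mult.commute)
qed

section \<open>Bilinear forms near a fixed Lorentzian form\<close>

lemma bilinear_norm_le:
  fixes B :: "'a::euclidean_space \<Rightarrow> 'a \<Rightarrow> real"
  assumes "bilinear B"
  shows "\<bar>B v w\<bar> \<le> (\<Sum>i\<in>Basis. \<Sum>j\<in>Basis. \<bar>B i j\<bar>) * norm v * norm w"
proof -
  have "B v w = B (\<Sum>i\<in>Basis. (v \<bullet> i) *\<^sub>R i) (\<Sum>j\<in>Basis. (w \<bullet> j) *\<^sub>R j)"
    by (simp add: euclidean_representation)
  also have "\<dots> = (\<Sum>(i,j)\<in>Basis \<times> Basis. B ((v \<bullet> i) *\<^sub>R i) ((w \<bullet> j) *\<^sub>R j))"
    by (rule bilinear_sum[OF assms])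
  also have "\<dots> = (\<Sum>i\<in>Basis. \<Sum>j\<in>Basis. (v \<bullet> i) * (w \<bullet> j) * B i j)"
    by (simp add: sum.cartesian_product bilinear_lmul[OF assms] bilinear_rmul[OF assms] mult_ac)
  also have "\<bar>\<dots>\<bar> \<le> (\<Sum>i\<in>Basis. \<Sum>j\<in>Basis. \<bar>(v \<bullet> i) * (w \<bullet> j) * B i j\<bar>)"
    by (intro order_trans[OF sum_abs] sum_mono order_refl)
  also have "\<dots> \<le> (\<Sum>i\<in>Basis. \<Sum>j\<in>Basis. norm v * norm w * \<bar>B i j\<bar>)"
    by (intro sum_mono) (auto simp: abs_mult Basis_le_norm intro!: mult_mono)
  finally show ?thesis
    by (simp add: sum_distrib_left mult_ac)
qed

text \<open>Finitely many basis coefficients control a form, so continuity for each fixed pair of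
  vectors becomes uniform in the vectors.\<close>

lemma bilinear_family_close:
  fixes g :: "'a::euclidean_space \<Rightarrow> 'a \<Rightarrow> 'a \<Rightarrow> real"
  assumes "open S" "y0 \<in> S" "\<And>v w. continuous_on S (\<lambda>y. g y v w)" "\<And>y. y \<in> S \<Longrightarrow> bilinear (g y)" "\<delta> > 0"
  obtains r where "r > 0" "ball y0 r \<subseteq> S"
    "\<And>y v w. y \<in> ball y0 r \<Longrightarrow> \<bar>g y v w - g y0 v w\<bar> \<le> \<delta> * norm v * norm w"
proof -
  let ?D = "\<lambda>y. \<Sum>i\<in>Basis. \<Sum>j\<in>Basis. \<bar>g y i j - g y0 i j\<bar>"
  have "continuous_on S ?D"
    using assms(3) by (intro continuous_intros)
  then have "isCont ?D y0"
    using assms(1,2) by (simp only: continuous_on_eq_continuous_at)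
  then have "(?D \<longlongrightarrow> ?D y0) (at y0)"
    by (simp only: isCont_def)
  then have "\<forall>\<^sub>F y in at y0. ?D y < \<delta>"
    using assms(5) by (intro order_tendstoD(2)) auto
  then obtain r1 where r1: "r1 > 0" "\<And>y. y \<noteq> y0 \<Longrightarrow> dist y y0 < r1 \<Longrightarrow> ?D y < \<delta>"
    by (auto simp: eventually_at)
  obtain r2 where r2: "r2 > 0" "ball y0 r2 \<subseteq> S"
    using assms(1,2) open_contains_ball by blast
  show thesis
  proof (rule that[of "min r1 r2"])
    show "min r1 r2 > 0" using r1 r2 by auto
    show sub: "ball y0 (min r1 r2) \<subseteq> S" using r2 by auto
    fix y v w assume y: "y \<in> ball y0 (min r1 r2)"
    have D: "?D y \<le> \<delta>"
      using r1(2)[of y] y assms(5) by (cases "y = y0") (auto simp: dist_commute less_imp_le)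
    have "bilinear (\<lambda>v w. g y v w - g y0 v w)"
      using assms(4)[of y] assms(4)[of y0] assms(2) y sub
      by (auto simp: bilinear_def linear_compose_sub)
    from bilinear_norm_le[OF this, of v w]
    have "\<bar>g y v w - g y0 v w\<bar> \<le> ?D y * (norm v * norm w)" by (simp add: mult_ac)
    also have "\<dots> \<le> \<delta> * (norm v * norm w)" using D by (intro mult_right_mono) auto
    finally show "\<bar>g y v w - g y0 v w\<bar> \<le> \<delta> * norm v * norm w" by (simp add: mult_ac)
  qed
qed

lemma lorentzian_form_bilinear:
  fixes B :: "'n::finite spt \<Rightarrow> 'n spt \<Rightarrow> real"
  assumes "lorentzian_form B"
  shows "bilinear B"
proof -
  obtain L :: "'n spt \<Rightarrow> 'n spt" where L: "linear L" "bij L" "\<And>v w. B (L v) (L w) = minkowski v w"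
    using assms unfolding lorentzian_form_def by metis
  have iv: "linear (inv L)"
    using L by (metis bij_betw_def inj_linear_imp_inv_linear)
  have "B v w = minkowski (inv L v) (inv L w)" for v w
    using L(2,3) by (metis bij_inv_eq_iff)
  then have "B = (\<lambda>v w. minkowski (inv L v) (inv L w))" by (simp add: fun_eq_iff)
  then show ?thesis
    using iv by (auto simp: bilinear_def linear_iff minkowski_def algebra_simps inner_add_left inner_add_right)
qed

text \<open>In a neighbourhood of \<open>y0\<close> the timelike cones stay inside a fixed proper cone, described by
  the linear functional \<open>l\<close>, and contain a fixed cone around a given timelike vector.\<close>

lemma lorentzian_family_cones:
  fixes g :: "'n::finite spt \<Rightarrow> 'n spt \<Rightarrow> 'n spt \<Rightarrow> real"
  assumes "open S" "y0 \<in> S" "\<And>v w. continuous_on S (\<lambda>y. g y v w)"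
    "\<And>y. y \<in> S \<Longrightarrow> lorentzian_form (g y)" and n: "g y0 n n < 0"
  obtains R C l k K B where "R > 0" "ball y0 R \<subseteq> S" "C > 0" "linear l" "l n > (0::real)"
    "\<And>y v. y \<in> ball y0 R \<Longrightarrow> g y v v < 0 \<Longrightarrow> norm v \<le> C * \<bar>l v\<bar>"
    "k > 0" "k < norm n" "K > 0" "\<And>y v. y \<in> ball y0 R \<Longrightarrow> v \<in> cone_around n k \<Longrightarrow> g y v v \<le> - K * (norm v)\<^sup>2"
    "B > 0" "\<And>y v w. y \<in> ball y0 R \<Longrightarrow> \<bar>g y v w\<bar> \<le> B * norm v * norm w"
proof -
  have bil: "bilinear (g y)" if "y \<in> S" for y
    using assms(4)[OF that] by (rule lorentzian_form_bilinear)
  obtain L :: "'n spt \<Rightarrow> 'n spt" where L: "linear L" "bij L" "\<And>v w. g y0 (L v) (L w) = minkowski v w"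
    using assms(4)[OF assms(2)] unfolding lorentzian_form_def by metis
  define J where "J = inv L"
  have J: "linear J" unfolding J_def using L by (metis bij_betw_def inj_linear_imp_inv_linear)
  have LJ: "L (J v) = v" for v unfolding J_def using L(2) by (simp add: bij_is_surj surj_f_inv_f)
  have g0: "g y0 v v = (norm (snd (J v)))\<^sup>2 - (fst (J v))\<^sup>2" for v
    unfolding power2_norm_eq_inner
    using L(3)[of "J v" "J v"] by (simp add: LJ minkowski_def power2_eq_square)
  obtain c where c: "c > 0" "\<And>v. norm (L v) \<le> c * norm v"
    using linear_bounded_pos[OF L(1)] by blast
  have vJ: "norm v \<le> c * norm (J v)" for v using c(2)[of "J v"] by (simp add: LJ)
  define m where "m = - g y0 n n"
  have m: "m > 0" using n by (simp add: m_def)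
  define B0 where "B0 = (\<Sum>i\<in>Basis. \<Sum>j\<in>Basis. \<bar>g y0 i j\<bar>)"
  have B0: "\<bar>g y0 v w\<bar> \<le> B0 * norm v * norm w" for v w
    unfolding B0_def by (rule bilinear_norm_le[OF bil[OF assms(2)]])
  have B0nn: "B0 \<ge> 0" unfolding B0_def by (intro sum_nonneg) auto
  have nn: "n \<noteq> 0" using n bilinear_lzero[OF bil[OF assms(2)]] by (metis less_irrefl)
  define N where "N = norm n"
  have N: "N > 0" using nn by (simp add: N_def)
  \<comment> \<open>\<open>N / 2\<close> keeps the cone pointed; the second bound limits the error
    terms of \<open>g y0\<close> on the cone to \<open>m / 4\<close> times the squared scale. The
    summand \<open>1\<close> guards the denominator.\<close>
  define k where "k = min (N / 2) (m / (16 * (B0 + 1) * N))"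
  \<comment> \<open>The first bound lets the perturbation absorb at most half of the squared frame
    norm, which fixes the outer cone; the second costs at most \<open>m / 4\<close> times the
    squared scale on the inner cone.\<close>
  define \<delta> where "\<delta> = min (1 / (2 * c\<^sup>2)) (m / (16 * N\<^sup>2))"
  have k: "k > 0" "k < N" "k \<le> N" "k * (16 * (B0 + 1) * N) \<le> m"
  proof -
    have D: "16 * (B0 + 1) * N > 0" using N B0nn by simp
    show "k > 0" "k < N" "k \<le> N" using m N D unfolding k_def by simp_all
    have "k \<le> m / (16 * (B0 + 1) * N)" by (simp add: k_def)
    then show "k * (16 * (B0 + 1) * N) \<le> m" using D by (simp only: pos_le_divide_eq)
  qed
  have \<delta>: "\<delta> > 0" "\<delta> * (2 * c\<^sup>2) \<le> 1" "\<delta> * (16 * N\<^sup>2) \<le> m"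
  proof -
    have D: "2 * c\<^sup>2 > 0" "16 * N\<^sup>2 > 0" using N c(1) by simp_all
    show "\<delta> > 0" using m D unfolding \<delta>_def by simp
    have "\<delta> \<le> 1 / (2 * c\<^sup>2)" "\<delta> \<le> m / (16 * N\<^sup>2)" by (simp_all add: \<delta>_def)
    then show "\<delta> * (2 * c\<^sup>2) \<le> 1" "\<delta> * (16 * N\<^sup>2) \<le> m" using D by (simp_all only: pos_le_divide_eq)
  qed
  obtain R where R: "R > 0" "ball y0 R \<subseteq> S"
    "\<And>y v w. y \<in> ball y0 R \<Longrightarrow> \<bar>g y v w - g y0 v w\<bar> \<le> \<delta> * norm v * norm w"
    using bilinear_family_close[OF assms(1-3) bil \<delta>(1)] by blast
  \<comment> \<open>The time coordinate of a Minkowski frame at \<open>y0\<close>, with the sign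
    that makes it positive on \<open>n\<close>.\<close>
  define l where "l = (\<lambda>v. sgn (fst (J n)) * fst (J v))"
  have fn: "fst (J n) \<noteq> 0" using n g0[of n] by auto
  have labs: "\<bar>l v\<bar> = \<bar>fst (J v)\<bar>" for v using fn by (simp add: l_def sgn_real_def)
  show thesis
  proof (rule that[of R "2 * c" l k "m / (8 * N\<^sup>2)" "B0 + \<delta>"])
    show "linear l" unfolding l_def
      by (rule linearI) (simp_all add: linear_add[OF J] linear_cmul[OF J] algebra_simps)
    show "l n > 0" using fn by (simp add: l_def sgn_real_def)
    show "2 * c > 0" using c by simp
    show "norm v \<le> 2 * c * \<bar>l v\<bar>" if y: "y \<in> ball y0 R" and tl: "g y v v < 0" for y v
    proof -
      have "g y0 v v < \<delta> * (norm v)\<^sup>2"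
        using R(3)[OF y, of v v] tl by (simp add: power2_eq_square mult.assoc)
      also have "\<dots> \<le> \<delta> * (c * norm (J v))\<^sup>2"
        using \<delta>(1) vJ[of v] by (intro mult_left_mono power_mono) auto
      also have "\<dots> = (\<delta> * (2 * c\<^sup>2)) * ((norm (J v))\<^sup>2 / 2)" by (simp add: power_mult_distrib)
      also have "\<dots> \<le> 1 * ((norm (J v))\<^sup>2 / 2)" using \<delta>(2) by (intro mult_right_mono) auto
      also have "(norm (J v))\<^sup>2 = (fst (J v))\<^sup>2 + (norm (snd (J v)))\<^sup>2"
        by (simp add: norm_prod_def)
      finally have "(norm (snd (J v)))\<^sup>2 \<le> 3 * (fst (J v))\<^sup>2"
        unfolding g0 by simp
      then have "(norm (J v))\<^sup>2 \<le> (2 * \<bar>fst (J v)\<bar>)\<^sup>2"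
        by (simp add: norm_prod_def power_mult_distrib)
      then have "norm (J v) \<le> 2 * \<bar>fst (J v)\<bar>"
        by (rule power2_le_imp_le) simp
      then show ?thesis
        using order_trans[OF vJ[of v] mult_left_mono[of "norm (J v)" "2 * \<bar>fst (J v)\<bar>" c]] c(1)
        by (simp add: labs)
    qed
    show "g y v v \<le> - (m / (8 * N\<^sup>2)) * (norm v)\<^sup>2" if y: "y \<in> ball y0 R" and v: "v \<in> cone_around n k" for y v
    proof -
      obtain a where a: "a \<ge> 0" "norm (v - a *\<^sub>R n) \<le> k * a"
        using v by (auto simp: cone_around_def)
      define e where "e = v - a *\<^sub>R n"
      have v_eq: "v = a *\<^sub>R n + e" by (simp add: e_def)
      have e: "norm e \<le> k * a" using a(2) by (simp add: e_def)
      have "norm v \<le> a * N + k * a"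
        using norm_triangle_ineq[of "a *\<^sub>R n" e] a(1) e by (simp add: v_eq N_def)
      also have "\<dots> \<le> 2 * N * a" using mult_right_mono[OF k(3) a(1)] by (simp add: algebra_simps)
      finally have vn: "(norm v)\<^sup>2 \<le> 4 * N\<^sup>2 * a\<^sup>2"
        using power_mono[of "norm v" "2 * N * a" 2] by (simp add: power_mult_distrib)
      note bl = bilinear_ladd[OF bil[OF assms(2)]] bilinear_radd[OF bil[OF assms(2)]]
        bilinear_lmul[OF bil[OF assms(2)]] bilinear_rmul[OF bil[OF assms(2)]]
      have "g y0 v v = - m * a\<^sup>2 + a * g y0 n e + a * g y0 e n + g y0 e e"
        by (simp add: v_eq bl m_def power2_eq_square algebra_simps)
      moreover have "a * g y0 n e \<le> a * (B0 * N * (k * a))"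
      proof -
        have "g y0 n e \<le> B0 * N * norm e" using B0[of n e] by (simp add: N_def)
        also have "\<dots> \<le> B0 * N * (k * a)" using e B0nn N by (intro mult_left_mono) auto
        finally show ?thesis using a(1) by (rule mult_left_mono)
      qed
      moreover have "a * g y0 e n \<le> a * (B0 * N * (k * a))"
      proof -
        have "g y0 e n \<le> B0 * N * norm e" using B0[of e n] by (simp add: N_def mult_ac)
        also have "\<dots> \<le> B0 * N * (k * a)" using e B0nn N by (intro mult_left_mono) auto
        finally show ?thesis using a(1) by (rule mult_left_mono)
      qed
      moreover have "g y0 e e \<le> B0 * ((k * a) * (N * a))"
      proof -
        have "g y0 e e \<le> B0 * (norm e * norm e)" using B0[of e e] by (simp add: mult_ac)
        also have "\<dots> \<le> B0 * ((k * a) * (N * a))"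
          by (intro mult_left_mono mult_mono e order_trans[OF e mult_right_mono[OF k(3) a(1)]] B0nn)
            (use k(1) a(1) in auto)
        finally show ?thesis .
      qed
      \<comment> \<open>Bounding one factor \<open>norm e\<close> by \<open>N * a\<close> gives the
        quadratic error the shape of the two cross terms, whence the coefficient
        \<open>3\<close>.\<close>
      ultimately have "g y0 v v \<le> - m * a\<^sup>2 + 3 * B0 * N * k * a\<^sup>2"
        by (simp add: power2_eq_square algebra_simps)
      also have "\<dots> \<le> - m * a\<^sup>2 + m / 4 * a\<^sup>2"
      proof -
        have "0 \<le> k * N * B0" using k N B0nn by simp
        moreover have "16 * (k * N * B0) + 16 * (k * N) \<le> m" using k(4) by (simp add: algebra_simps)
        moreover have "0 \<le> k * N" using k N by simp
        ultimately have "3 * (k * N * B0) \<le> m / 4" by linarith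
        then have "3 * B0 * N * k \<le> m / 4" by (simp add: mult_ac)
        then show ?thesis by (intro add_left_mono mult_right_mono) auto
      qed
      finally have 1: "g y0 v v \<le> - (3 * m / 4) * a\<^sup>2" by linarith
      have "g y v v \<le> g y0 v v + \<delta> * (norm v)\<^sup>2"
        using R(3)[OF y, of v v] by (simp add: power2_eq_square mult.assoc)
      also have "\<delta> * (norm v)\<^sup>2 \<le> (\<delta> * (16 * N\<^sup>2)) * (a\<^sup>2 / 4)"
        using mult_left_mono[OF vn, of \<delta>] \<delta>(1) by (simp add: algebra_simps)
      also have "\<dots> \<le> m * (a\<^sup>2 / 4)" using \<delta>(3) by (intro mult_right_mono) auto
      finally have "g y v v \<le> - (m / 2) * a\<^sup>2" using 1 by linarith
      also have "\<dots> \<le> - (m / (8 * N\<^sup>2)) * (norm v)\<^sup>2"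
      proof -
        have "m / (8 * N\<^sup>2) * (norm v)\<^sup>2 \<le> m / (8 * N\<^sup>2) * (4 * N\<^sup>2 * a\<^sup>2)"
          using vn m N by (intro mult_left_mono) auto
        also have "\<dots> = m / 2 * a\<^sup>2" using N by simp
        finally show ?thesis by linarith
      qed
      finally show ?thesis .
    qed
    show "\<bar>g y v w\<bar> \<le> (B0 + \<delta>) * norm v * norm w" if "y \<in> ball y0 R" for y v w
      using R(3)[OF that, of v w] B0[of v w] by (simp add: algebra_simps)
  qed (use R k m N B0nn \<delta> in \<open>auto simp: N_def\<close>)
qed

section \<open>Charts of a Kasner extension\<close>

text \<open>The part of a Kasner extension seen in one chart: \<open>E\<close> maps the open set \<open>D\<close> of Kasner
  spacetime to the open part \<open>Y\<close> of the chart domain \<open>\<Omega>\<close>, with inverse \<open>F\<close>, and \<open>g\<close> is the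
  coordinate expression of the extended metric. The last assumption encodes that the extension is
  Hausdorff.\<close>

locale kasner_patch =
  fixes p :: "real ^ 'n::finite" and \<Omega> Y :: "'a::euclidean_space set" and D :: "'n spt set"
    and E :: "'n spt \<Rightarrow> 'a" and F :: "'a \<Rightarrow> 'n spt" and E' :: "'n spt \<Rightarrow> 'n spt \<Rightarrow> 'a"
    and F' :: "'a \<Rightarrow> 'a \<Rightarrow> 'n spt" and g :: "'a \<Rightarrow> 'a \<Rightarrow> 'a \<Rightarrow> real"
  assumes p_less_1: "p $ i < 1"
    and open_Y: "open Y" and open_D: "open D" and D_sub: "D \<subseteq> kasner_M" and Y_sub: "Y \<subseteq> \<Omega>"
    and E_in: "m \<in> D \<Longrightarrow> E m \<in> Y" and F_in: "y \<in> Y \<Longrightarrow> F y \<in> D"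
    and FE: "m \<in> D \<Longrightarrow> F (E m) = m" and EF: "y \<in> Y \<Longrightarrow> E (F y) = y"
    and E_deriv: "m \<in> D \<Longrightarrow> (E has_derivative E' m) (at m)"
    and F_deriv: "y \<in> Y \<Longrightarrow> (F has_derivative F' y) (at y)"
    and iso_E: "m \<in> D \<Longrightarrow> g (E m) (E' m v) (E' m v) = kasner_g p m v v"
    and iso_F: "y \<in> Y \<Longrightarrow> kasner_g p (F y) (F' y w) (F' y w) = g y w w"
    and cont_E': "continuous_on D (\<lambda>m. E' m (1, 0))"
    and closed_graph: "\<lbrakk>\<And>k. f k \<in> D; f \<longlonglongrightarrow> m; m \<in> kasner_M; (\<lambda>k. E (f k)) \<longlonglongrightarrow> y; y \<in> \<Omega>\<rbrakk> \<Longrightarrow> m \<in> D"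
begin

abbreviation "T y \<equiv> fst (F y)"
abbreviation "X y i \<equiv> snd (F y) $ i"
abbreviation "\<eta> i \<equiv> horizon (p $ i)"

lemma T_pos: "y \<in> Y \<Longrightarrow> T y > 0"
  using F_in[of y] D_sub unfolding kasner_M_def by blast

lemma cont_F: "continuous_on Y F"
  using F_deriv by (meson has_derivative_continuous continuous_at_imp_continuous_on)

lemma cont_E: "continuous_on D E"
  using E_deriv by (meson has_derivative_continuous continuous_at_imp_continuous_on)

lemma isCont_F: "y \<in> Y \<Longrightarrow> isCont F y"
  using F_deriv has_derivative_continuous by blast

lemma isCont_E: "m \<in> D \<Longrightarrow> isCont E m"
  using E_deriv has_derivative_continuous by blast

lemma closed_graph_E:
  assumes "\<And>k. f k \<in> D" "f \<longlonglongrightarrow> m" "m \<in> kasner_M" "(\<lambda>k. E (f k)) \<longlonglongrightarrow> y" "y \<in> \<Omega>"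
  shows "m \<in> D" "E m = y"
proof -
  show m: "m \<in> D" by (rule closed_graph[OF assms])
  have "(\<lambda>k. E (f k)) \<longlonglongrightarrow> E m"
    using isCont_tendsto_compose[OF isCont_E[OF m] assms(2)] .
  then show "E m = y" using assms(4) LIMSEQ_unique by blast
qed

text \<open>Bounded Kasner coordinates with time bounded away from \<open>0\<close> have a
  subsequence converging inside Kasner spacetime, and the closed graph identifies its image with the
  chart limit. This closes the continuation arguments for segments and lines.\<close>

lemma limit_in_Y:
  assumes y: "\<And>k. y k \<in> Y" "y \<longlonglongrightarrow> y'" "y' \<in> \<Omega>" and bd: "bounded (range (\<lambda>k. F (y k)))"
    and lo: "lo > 0" "\<And>k. lo \<le> T (y k)"
  shows "y' \<in> Y"
proof -
  obtain m r where r: "strict_mono r" "((\<lambda>k. F (y k)) \<circ> r) \<longlonglongrightarrow> m"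
    using bounded_imp_convergent_subsequence[OF bd] by auto
  have "(\<lambda>k. T (y (r k))) \<longlonglongrightarrow> fst m"
    using tendsto_fst[OF r(2)] by (simp add: o_def)
  then have "lo \<le> fst m"
    using lo(2) by (intro LIMSEQ_le_const) auto
  then have M: "m \<in> kasner_M" using lo(1) by (simp add: kasner_M_def)
  have "(\<lambda>k. E (F (y (r k)))) \<longlonglongrightarrow> y'"
    using LIMSEQ_subseq_LIMSEQ[OF y(2) r(1)] by (simp add: o_def EF y(1))
  then have "m \<in> D" "E m = y'"
    using closed_graph_E[of "\<lambda>k. F (y (r k))" m y'] r(2) M y(3) F_in[OF y(1)] by (auto simp: o_def)
  then show ?thesis using E_in by blast
qed

lemma curve_deriv:
  assumes "(c has_vector_derivative c') (at s)" "c s \<in> Y"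
  shows "((\<lambda>s. F (c s)) has_vector_derivative F' (c s) c') (at s)"
  using vector_derivative_diff_chain_within[OF assms(1) has_derivative_at_withinI[OF F_deriv[OF assms(2)]]]
  by (simp add: o_def)

lemma timelike_curve:
  assumes ab: "a < b" and cont: "continuous_on {a..b} c"
    and Y: "\<And>s. s \<in> {a..b} \<Longrightarrow> c s \<in> Y"
    and der: "\<And>s. s \<in> {a<..<b} \<Longrightarrow> (c has_vector_derivative c' s) (at s)"
    and tl: "\<And>s. s \<in> {a<..<b} \<Longrightarrow> g (c s) (c' s) (c' s) < 0"
  shows "T (c a) \<noteq> T (c b)"
    and "\<bar>X (c b) i - X (c a) i\<bar> < \<bar>\<eta> i (T (c b)) - \<eta> i (T (c a))\<bar>"
    and "inj_on (\<lambda>s. T (c s)) {a..b}"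
proof -
  have 1: "continuous_on {a..b} (\<lambda>s. F (c s))"
    by (rule continuous_on_compose2[OF cont_F cont]) (use Y in auto)
  have 2: "((\<lambda>s. F (c s)) has_vector_derivative F' (c s) (c' s)) (at s)" if "s \<in> {a<..<b}" for s
    using curve_deriv[OF der[OF that] Y] that by auto
  have 3: "kasner_g p (F (c s)) (F' (c s) (c' s)) (F' (c s) (c' s)) < 0" if "s \<in> {a<..<b}" for s
    using iso_F[OF Y] tl[OF that] that by auto
  show "T (c a) \<noteq> T (c b)" "\<bar>X (c b) i - X (c a) i\<bar> < \<bar>\<eta> i (T (c b)) - \<eta> i (T (c a))\<bar>"
    using kasner_timelike_curve[OF ab 1 T_pos[OF Y] 2 3] p_less_1 by auto
  show "inj_on (\<lambda>s. T (c s)) {a..b}"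
    using kasner_timelike_curve_inj[OF 1 T_pos[OF Y] 2 3] .
qed

lemma timelike_segment:
  assumes Y: "closed_segment z w \<subseteq> Y" and zw: "z \<noteq> w"
    and tl: "\<And>y. y \<in> closed_segment z w \<Longrightarrow> g y (w - z) (w - z) < 0"
  shows "T z \<noteq> T w" and "\<bar>X w i - X z i\<bar> < \<bar>\<eta> i (T w) - \<eta> i (T z)\<bar>"
    and "y \<in> open_segment z w \<Longrightarrow> (T z < T y \<and> T y < T w) \<or> (T w < T y \<and> T y < T z)"
proof -
  define c where "c = (\<lambda>s::real. z + s *\<^sub>R (w - z))"
  have seg: "c s \<in> closed_segment z w" if "s \<in> {0..1}" for s
    using that by (auto simp: c_def closed_segment_def algebra_simps intro!: exI[of _ s])
  have cont: "continuous_on {0..1} c" unfolding c_def by (intro continuous_intros)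
  have der: "(c has_vector_derivative (w - z)) (at s)" for s
    unfolding c_def by (auto intro!: derivative_eq_intros)
  have ends: "c 0 = z" "c 1 = w" by (simp_all add: c_def)
  note tc = timelike_curve[OF zero_less_one cont subsetD[OF Y seg] der tl[OF seg], simplified ends]
  show "T z \<noteq> T w" "\<bar>X w i - X z i\<bar> < \<bar>\<eta> i (T w) - \<eta> i (T z)\<bar>"
    using tc(1,2) by auto
  have inj: "inj_on (\<lambda>s. T (c s)) {0..1}"
    using tc(3) by auto
  have contT: "continuous_on {0..1} (\<lambda>s. T (c s))"
    by (intro continuous_on_fst continuous_on_compose2[OF cont_F cont]) (use seg Y in auto)
  assume "y \<in> open_segment z w"
  then obtain u where u: "0 < u" "u < 1" "y = c u"
    by (auto simp: in_segment c_def algebra_simps)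
  show "(T z < T y \<and> T y < T w) \<or> (T w < T y \<and> T y < T z)"
    using continuous_inj_imp_mono[OF u(1,2) contT inj] by (simp add: ends u(3))
qed

text \<open>Weak inequalities admit degenerate segments, so that a family may start from a single
  point. The coordinate estimate comes from the subsegment between \<open>z\<close> and
  \<open>y\<close>.\<close>

lemma timelike_segment_le:
  assumes Y: "closed_segment z w \<subseteq> Y"
    and tl: "\<And>y. y \<in> closed_segment z w \<Longrightarrow> z \<noteq> w \<Longrightarrow> g y (w - z) (w - z) < 0"
    and y: "y \<in> closed_segment z w"
  shows "min (T z) (T w) \<le> T y" "T y \<le> max (T z) (T w)"
    "\<bar>X y i - X z i\<bar> \<le> \<bar>\<eta> i (T y) - \<eta> i (T z)\<bar>"
proof -
  have "min (T z) (T w) \<le> T y \<and> T y \<le> max (T z) (T w)"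
  proof (cases "y = z \<or> y = w")
    case False
    with y have zw: "z \<noteq> w" "y \<in> open_segment z w" by (auto simp: open_segment_def)
    show ?thesis
      using timelike_segment(3)[OF Y zw(1) tl[OF _ zw(1)] zw(2)] by linarith
  qed auto
  then show "min (T z) (T w) \<le> T y" "T y \<le> max (T z) (T w)" by auto
  show "\<bar>X y i - X z i\<bar> \<le> \<bar>\<eta> i (T y) - \<eta> i (T z)\<bar>"
  proof (cases "y = z")
    case False
    obtain u where u: "0 \<le> u" "u \<le> 1" "y = (1 - u) *\<^sub>R z + u *\<^sub>R w"
      using y by (auto simp: in_segment)
    then have yz: "y - z = u *\<^sub>R (w - z)" by (simp add: algebra_simps)
    with False have "u \<noteq> 0" "z \<noteq> w" by auto
    with u have u0: "u > 0" by auto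
    have sub: "closed_segment z y \<subseteq> closed_segment z w"
      using y by (simp add: subset_closed_segment)
    have "\<bar>X y i - X z i\<bar> < \<bar>\<eta> i (T y) - \<eta> i (T z)\<bar>"
    proof (rule timelike_segment(2))
      show "closed_segment z y \<subseteq> Y" using sub Y by auto
      fix y' assume "y' \<in> closed_segment z y"
      then have y': "y' \<in> closed_segment z w" using sub by auto
      have "y' \<in> Y" using y' Y by auto
      have lin: "linear (F' y')" using F_deriv[OF \<open>y' \<in> Y\<close>] has_derivative_linear by blast
      \<comment> \<open>Bilinearity of \<open>g\<close> is not among the assumptions of the patch,
        so scaling is read off from the Kasner metric through the isometry.\<close>
      have "g y' (y - z) (y - z) = u\<^sup>2 * g y' (w - z) (w - z)"
        unfolding iso_F[OF \<open>y' \<in> Y\<close>, symmetric] yz linear_cmul[OF lin]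
        by (simp add: kasner_g_def power2_eq_square sum_distrib_left algebra_simps)
      then show "g y' (y - z) (y - z) < 0"
        using tl[OF y' \<open>z \<noteq> w\<close>] u0 by (simp add: mult_less_0_iff)
    qed (use False in auto)
    then show ?thesis by simp
  qed simp
qed

lemma bounded_F:
  assumes "\<And>k::nat. \<bar>T (y k)\<bar> \<le> c" "\<And>k i. \<bar>X (y k) i\<bar> \<le> d i"
  shows "bounded (range (\<lambda>k. F (y k)))"
proof (rule boundedI)
  fix q assume "q \<in> range (\<lambda>k. F (y k))"
  then obtain k where q: "q = F (y k)" by auto
  have "norm q \<le> \<bar>T (y k)\<bar> + norm (snd (F (y k)))"
    using norm_Pair_le[of "T (y k)" "snd (F (y k))"] by (simp add: q)
  also have "\<dots> \<le> c + (\<Sum>i\<in>UNIV. d i)"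
    using norm_le_l1_cart[of "snd (F (y k))"] assms(1)[of k] sum_mono[of UNIV "\<lambda>i. \<bar>X (y k) i\<bar>" d] assms(2)
    by fastforce
  finally show "norm q \<le> c + (\<Sum>i\<in>UNIV. d i)" .
qed

text \<open>Along a continuous family of timelike chart segments with end points in \<open>Y\<close>, no segment can
  leave \<open>Y\<close>: its Kasner time stays between the times of its ends, so it stays in a compact part of
  Kasner spacetime.\<close>

lemma segment_continuation:
  assumes conn: "connected P" and q0: "q0 \<in> P" "closed_segment (fst q0) (snd q0) \<subseteq> Y"
    and P: "\<And>z w. (z, w) \<in> P \<Longrightarrow> z \<in> Y \<and> w \<in> Y \<and> closed_segment z w \<subseteq> \<Omega>"
    and tl: "\<And>z w y. (z, w) \<in> P \<Longrightarrow> y \<in> closed_segment z w \<Longrightarrow> z \<noteq> w \<Longrightarrow> g y (w - z) (w - z) < 0"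
    and zw: "(z, w) \<in> P"
  shows "closed_segment z w \<subseteq> Y"
proof -
  define A where "A = P \<inter> {q. closed_segment (fst q) (snd q) \<subseteq> Y}"
  have op: "openin (top_of_set P) A"
    unfolding A_def by (intro openin_open_Int open_segment_pairs open_Y)
  have cl: "closedin (top_of_set P) A"
    unfolding closedin_limpt
  proof (intro conjI allI impI)
    show "A \<subseteq> P" by (auto simp: A_def)
    fix q assume q: "q islimpt A \<and> q \<in> P"
    then obtain f where f: "\<And>n::nat. f n \<in> A" "f \<longlonglongrightarrow> q"
      unfolding islimpt_sequential by blast
    obtain z w where zw: "q = (z, w)" by (cases q)
    have zwP: "z \<in> Y" "w \<in> Y" "closed_segment z w \<subseteq> \<Omega>" using P[of z w] q zw by blast+
    have fz: "(\<lambda>n. fst (f n)) \<longlonglongrightarrow> z" and fw: "(\<lambda>n. snd (f n)) \<longlonglongrightarrow> w"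
      using tendsto_fst[OF f(2)] tendsto_snd[OF f(2)] by (simp_all add: zw)
    have Fz: "(\<lambda>n. F (fst (f n))) \<longlonglongrightarrow> F z" and Fw: "(\<lambda>n. F (snd (f n))) \<longlonglongrightarrow> F w"
      using isCont_tendsto_compose[OF isCont_F] fz fw zwP by auto
    \<comment> \<open>Any positive bounds strictly around the two end times would do; they then hold
      for the ends of all late segments of the sequence.\<close>
    define lo where "lo = min (T z) (T w) / 2"
    define hi where "hi = max (T z) (T w) + 1"
    have lo: "lo > 0" "lo < T z" "lo < T w" "T z < hi" "T w < hi"
      using T_pos[OF zwP(1)] T_pos[OF zwP(2)] unfolding lo_def hi_def by linarith+
    have ev: "\<forall>\<^sub>F n in sequentially. lo < T (fst (f n)) \<and> lo < T (snd (f n)) \<and> T (fst (f n)) < hi \<and> T (snd (f n)) < hi"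
      by (intro eventually_conj order_tendstoD(1)[OF tendsto_fst[OF Fz]] order_tendstoD(1)[OF tendsto_fst[OF Fw]]
          order_tendstoD(2)[OF tendsto_fst[OF Fz]] order_tendstoD(2)[OF tendsto_fst[OF Fw]] lo)
    have evX: "\<forall>\<^sub>F n in sequentially. \<bar>X (fst (f n)) i\<bar> < \<bar>X z i\<bar> + 1" for i
      by (rule order_tendstoD(2)[OF tendsto_rabs[OF tendsto_vec_nth[OF tendsto_snd[OF Fz]]]]) simp
    have evX': "\<forall>\<^sub>F n in sequentially. \<forall>i\<in>UNIV. \<bar>X (fst (f n)) i\<bar> < \<bar>X z i\<bar> + 1"
      using evX by (intro eventually_ball_finite) auto
    obtain n0 where n0: "\<And>n. n \<ge> n0 \<Longrightarrow> lo < T (fst (f n)) \<and> lo < T (snd (f n)) \<and> T (fst (f n)) < hi \<and> T (snd (f n)) < hi"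
      "\<And>n i. n \<ge> n0 \<Longrightarrow> \<bar>X (fst (f n)) i\<bar> < \<bar>X z i\<bar> + 1"
      using eventually_conj[OF ev evX'] unfolding eventually_sequentially by blast
    have "closed_segment z w \<subseteq> Y"
    proof
      fix y assume y: "y \<in> closed_segment z w"
      then obtain u where u: "0 \<le> u" "u \<le> 1" "y = (1 - u) *\<^sub>R z + u *\<^sub>R w"
        by (auto simp: in_segment)
      \<comment> \<open>Points with the same parameter \<open>u\<close> on the approximating
        segments; the shift by \<open>n0\<close> makes the bounds valid for every index.\<close>
      define h where "h n = (1 - u) *\<^sub>R fst (f (n + n0)) + u *\<^sub>R snd (f (n + n0))" for n
      have hseg: "h n \<in> closed_segment (fst (f (n + n0))) (snd (f (n + n0)))" for n
        using u by (auto simp: h_def in_segment)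
      have segY: "closed_segment (fst (f n)) (snd (f n)) \<subseteq> Y" for n
        using f(1)[of n] by (auto simp: A_def)
      have fP: "(fst (f n), snd (f n)) \<in> P" for n using f(1)[of n] by (auto simp: A_def)
      note le = timelike_segment_le[OF segY tl[OF fP] hseg]
      have T1: "lo \<le> T (h n)" "T (h n) \<le> hi" for n
        using le(1,2)[of n] n0(1)[of "n + n0"] by (auto simp: min_def max_def split: if_splits)
      have T2: "\<bar>T (h n)\<bar> \<le> hi" for n using T1[of n] lo(1) by linarith
      have X1: "\<bar>X (h n) i\<bar> \<le> \<bar>X z i\<bar> + 1 + 2 * \<eta> i hi" for n i
      proof -
        have "0 < T (fst (f (n + n0)))" using n0(1)[of "n + n0"] lo by auto
        then have "\<eta> i (T (fst (f (n + n0)))) \<le> \<eta> i hi" "0 < \<eta> i (T (fst (f (n + n0))))"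
          using n0(1)[of "n + n0"] p_less_1 by (auto intro!: horizon_mono horizon_pos)
        moreover have "\<eta> i (T (h n)) \<le> \<eta> i hi" "0 < \<eta> i (T (h n))"
          using T1[of n] lo p_less_1 by (auto intro!: horizon_mono horizon_pos)
        ultimately show ?thesis
          using le(3)[of n i] n0(2)[of "n + n0" i] by linarith
      qed
      show "y \<in> Y"
      proof (rule limit_in_Y)
        show "h n \<in> Y" for n using hseg segY by blast
        show "h \<longlonglongrightarrow> y" unfolding h_def u(3)
          by (intro tendsto_intros LIMSEQ_ignore_initial_segment[OF fz] LIMSEQ_ignore_initial_segment[OF fw])
        show "y \<in> \<Omega>" using y zwP by auto
        show "bounded (range (\<lambda>k. F (h k)))"
          by (rule bounded_F[OF T2 X1])
        show "lo \<le> T (h k)" for k by (rule T1)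
      qed (rule lo)
    qed
    then show "q \<in> A" using q by (auto simp: A_def zw)
  qed
  have "A = {} \<or> A = P" using conn op cl unfolding connected_clopen by blast
  moreover have "q0 \<in> A" using q0 by (simp add: A_def)
  ultimately have "(z, w) \<in> A" using zw by blast
  then show ?thesis by (auto simp: A_def)
qed

text \<open>The time difference of the end points is continuous on the connected family and never
  zero, since the segments are timelike; hence its sign is constant.\<close>

lemma segment_orientation:
  assumes conn: "connected P" and q0: "(z0, w0) \<in> P" "T z0 < T w0"
    and P: "\<And>z w. (z, w) \<in> P \<Longrightarrow> z \<noteq> w \<and> closed_segment z w \<subseteq> Y"
    and tl: "\<And>z w y. (z, w) \<in> P \<Longrightarrow> y \<in> closed_segment z w \<Longrightarrow> g y (w - z) (w - z) < 0"
    and zw: "(z, w) \<in> P"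
  shows "T z < T w"
proof (rule ccontr)
  assume "\<not> T z < T w"
  then have le: "T w - T z \<le> 0" by simp
  let ?f = "\<lambda>q. T (snd q) - T (fst q)"
  have "continuous_on P ?f"
  proof (intro continuous_on_diff continuous_on_fst)
    have "fst q \<in> Y \<and> snd q \<in> Y" if "q \<in> P" for q
      using P[of "fst q" "snd q"] that by auto
    then have "fst ` P \<subseteq> Y" "snd ` P \<subseteq> Y" by auto
    then show "continuous_on P (\<lambda>q. F (snd q))" "continuous_on P (\<lambda>q. F (fst q))"
      by (auto intro!: continuous_on_compose2[OF cont_F] continuous_on_fst continuous_on_snd)
  qed
  then have "connected (?f ` P)" using conn by (rule connected_continuous_image)
  moreover have "T w - T z \<in> ?f ` P" "T w0 - T z0 \<in> ?f ` P"
    using imageI[OF zw, of ?f] imageI[OF q0(1), of ?f] by simp_all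
  ultimately have "0 \<in> ?f ` P"
    using connectedD_interval[of "?f ` P" "T w - T z" "T w0 - T z0" 0] le q0(2) by simp
  then obtain z1 w1 where zw1: "(z1, w1) \<in> P" "T w1 = T z1" by auto
  have "T z1 \<noteq> T w1"
    using P[OF zw1(1)] by (intro timelike_segment(1)) (auto intro: tl[OF zw1(1)])
  then show False using zw1 by simp
qed

end

section \<open>Curves running into the past boundary\<close>

text \<open>A chart near the end of a past directed curve: \<open>l\<close> controls the outer cone,
  \<open>n0\<close> and \<open>k\<close> an inner timelike cone. Chords of \<open>\<gamma>\<close>
  lie in the inner cone of half the aperture, so they stay timelike after perturbation, and
  \<open>R / 10\<close> leaves room for lines twice as long as a chord.\<close>

locale kasner_past_curve = kasner_patch p \<Omega> Y D E F E' F' g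
  for p :: "real ^ 'n::finite" and \<Omega> Y :: "'a::euclidean_space set" and D E F E' F' g +
  fixes y0 n0 :: 'a and R C L k K B s0 :: real and l :: "'a \<Rightarrow> real" and \<gamma> \<gamma>' :: "real \<Rightarrow> 'a"
  assumes ball_sub: "ball y0 R \<subseteq> \<Omega>" and R_pos: "R > 0" and C_pos: "C > 0" and l_lin: "linear l"
    and l_cone: "y \<in> ball y0 R \<Longrightarrow> g y v v < 0 \<Longrightarrow> norm v \<le> C * \<bar>l v\<bar>"
    and L_pos: "L > 0" and l_bound: "\<bar>l v\<bar> \<le> L * norm v"
    and k_pos: "0 < k" and k_less: "k < norm n0" and K_pos: "0 < K"
    and cone_timelike: "y \<in> ball y0 R \<Longrightarrow> v \<in> cone_around n0 k \<Longrightarrow> g y v v \<le> - K * (norm v)\<^sup>2"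
    and B_pos: "0 < B" and g_bound: "y \<in> ball y0 R \<Longrightarrow> \<bar>g y v w\<bar> \<le> B * norm v * norm w"
    and g_bilinear: "y \<in> ball y0 R \<Longrightarrow> bilinear (g y)"
    and y0_notin: "y0 \<notin> Y" and s0_less: "s0 < 1"
    and \<gamma>_cont: "continuous_on {s0..1} \<gamma>" and \<gamma>_end: "\<gamma> 1 = y0"
    and \<gamma>_Y: "s \<in> {s0..<1} \<Longrightarrow> \<gamma> s \<in> Y"
    and \<gamma>_ball: "s \<in> {s0..1} \<Longrightarrow> norm (\<gamma> s - y0) \<le> R / 10"
    and \<gamma>_deriv: "s \<in> {s0<..<1} \<Longrightarrow> (\<gamma> has_vector_derivative \<gamma>' s) (at s)"
    and \<gamma>_timelike: "s \<in> {s0<..<1} \<Longrightarrow> g (\<gamma> s) (\<gamma>' s) (\<gamma>' s) < 0"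
    and \<gamma>_l: "s \<in> {s0<..<1} \<Longrightarrow> l (\<gamma>' s) < 0"
    and \<gamma>_past: "s \<in> {s0<..<1} \<Longrightarrow> fst (F' (\<gamma> s) (\<gamma>' s)) < 0"
    and \<gamma>_cone: "s0 \<le> s \<Longrightarrow> s < s' \<Longrightarrow> s' \<le> 1 \<Longrightarrow> \<gamma> s - \<gamma> s' \<in> cone_around n0 (k / 2)"
begin

lemma y0_in: "y0 \<in> \<Omega>"
  using ball_sub R_pos by auto

lemma cone_neg: "y \<in> ball y0 R \<Longrightarrow> v \<in> cone_around n0 k \<Longrightarrow> v \<noteq> 0 \<Longrightarrow> g y v v < 0"
  using cone_timelike[of y v] K_pos by (smt (verit) mult_pos_pos mult_minus_left zero_less_norm_iff zero_less_power)

lemma continuous_F_\<gamma>: "continuous_on {s0..<1} (\<lambda>s. F (\<gamma> s))"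
  by (rule continuous_on_compose2[OF cont_F continuous_on_subset[OF \<gamma>_cont]]) (use \<gamma>_Y in auto)

lemma F_\<gamma>_deriv:
  "s \<in> {s0<..<1} \<Longrightarrow> ((\<lambda>s. F (\<gamma> s)) has_vector_derivative F' (\<gamma> s) (\<gamma>' s)) (at s)"
  using curve_deriv[OF \<gamma>_deriv \<gamma>_Y] by auto

lemma T_\<gamma>_less:
  assumes "s0 \<le> s" "s < s'" "s' < 1"
  shows "T (\<gamma> s') < T (\<gamma> s)"
proof (rule DERIV_neg_imp_decreasing_open[OF assms(2)])
  show "continuous_on {s..s'} (\<lambda>s. T (\<gamma> s))"
    by (intro continuous_on_fst continuous_on_subset[OF continuous_F_\<gamma>]) (use assms in auto)
  fix x assume "s < x" "x < s'"
  then have x: "x \<in> {s0<..<1}" using assms by auto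
  have "((\<lambda>s. T (\<gamma> s)) has_real_derivative fst (F' (\<gamma> x) (\<gamma>' x))) (at x)"
    using bounded_linear.has_vector_derivative[OF bounded_linear_fst F_\<gamma>_deriv[OF x]]
    by (simp add: has_real_derivative_iff_has_vector_derivative)
  then show "\<exists>y. ((\<lambda>s. T (\<gamma> s)) has_real_derivative y) (at x) \<and> y < 0"
    using \<gamma>_past[OF x] by blast
qed

lemma T_\<gamma>_le:
  assumes "s0 \<le> s" "s \<le> s'" "s' < 1"
  shows "T (\<gamma> s') \<le> T (\<gamma> s)"
  using T_\<gamma>_less[of s s'] assms by (cases "s = s'") auto

lemma \<gamma>_neq:
  assumes "s0 \<le> s" "s < s'" "s' \<le> 1"
  shows "\<gamma> s \<noteq> \<gamma> s'"
proof (cases "s' = 1")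
  case True
  then show ?thesis using \<gamma>_Y[of s] \<gamma>_end y0_notin assms by auto
next
  case False
  then show ?thesis using T_\<gamma>_less[of s s'] assms by auto
qed

lemma X_\<gamma>_le:
  assumes "s0 \<le> s" "s \<le> s'" "s' < 1"
  shows "\<bar>X (\<gamma> s') i - X (\<gamma> s) i\<bar> \<le> \<eta> i (T (\<gamma> s)) - \<eta> i (T (\<gamma> s'))"
proof (cases "s = s'")
  case False
  then have less: "s < s'" using assms by simp
  have "\<bar>X (\<gamma> s') i - X (\<gamma> s) i\<bar> < \<bar>\<eta> i (T (\<gamma> s')) - \<eta> i (T (\<gamma> s))\<bar>"
    by (rule timelike_curve(2)[OF less, where c' = \<gamma>'])
      (use assms \<gamma>_Y \<gamma>_deriv \<gamma>_timelike in \<open>auto intro: continuous_on_subset[OF \<gamma>_cont]\<close>)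
  moreover have "\<eta> i (T (\<gamma> s')) \<le> \<eta> i (T (\<gamma> s))"
    using T_\<gamma>_le[OF assms] T_pos[OF \<gamma>_Y, of s'] p_less_1 assms by (intro horizon_mono) auto
  ultimately show ?thesis by linarith
qed simp

text \<open>Parameters converging to \<open>1\<close>, with \<open>sk 0 = s0\<close>; limits at the
  end of \<open>\<gamma>\<close> are expressed through this sequence.\<close>

definition sk :: "nat \<Rightarrow> real" where "sk j = 1 - (1 - s0) / (real j + 1)"

lemma sk: "sk j \<in> {s0..<1}" "sk \<longlonglongrightarrow> 1" "i \<le> j \<Longrightarrow> sk i \<le> sk j"
proof -
  have "(1 - s0) / (real j + 1) \<le> (1 - s0) / 1" "(1 - s0) / (real j + 1) > 0"
    using s0_less by (auto simp: divide_le_eq mult_le_cancel_left1)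
  then show "sk j \<in> {s0..<1}" unfolding sk_def by simp
  have "(\<lambda>j. 1 - (1 - s0) / (real j + 1)) \<longlonglongrightarrow> 1 - 0"
    using LIMSEQ_Suc[OF lim_const_over_n[of "1 - s0"]]
    by (intro tendsto_diff tendsto_const) (simp add: add.commute)
  then show "sk \<longlonglongrightarrow> 1" unfolding sk_def by simp
  show "i \<le> j \<Longrightarrow> sk i \<le> sk j"
    unfolding sk_def using s0_less by (auto intro!: divide_left_mono)
qed

lemma \<gamma>_sk: "(\<lambda>j. \<gamma> (sk j)) \<longlonglongrightarrow> y0"
  using continuous_on_tendsto_compose[OF \<gamma>_cont sk(2)] sk(1) s0_less \<gamma>_end
  by (auto simp: less_imp_le)

text \<open>If the time stayed above \<open>e\<close>, the total comoving displacement would be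
  bounded by the horizon at \<open>s0\<close>, and \<open>limit_in_Y\<close> would put
  \<open>y0\<close> into \<open>Y\<close>.\<close>

lemma T_\<gamma>_small:
  assumes "e > 0"
  obtains s where "s0 \<le> s" "s < 1" "T (\<gamma> s) < e"
proof (rule ccontr)
  assume contr: "\<not> thesis"
  have ge: "e \<le> T (\<gamma> (sk j))" for j
    using that[of "sk j"] sk(1)[of j] contr by fastforce
  have "\<bar>T (\<gamma> (sk j))\<bar> \<le> T (\<gamma> s0)" for j
    using T_\<gamma>_le[of s0 "sk j"] sk(1)[of j] ge[of j] assms by auto
  moreover have "\<bar>X (\<gamma> (sk j)) i\<bar> \<le> \<bar>X (\<gamma> s0) i\<bar> + \<eta> i (T (\<gamma> s0))" for j i
  proof -
    have "0 < \<eta> i (T (\<gamma> (sk j)))" using ge[of j] assms p_less_1 by (intro horizon_pos) auto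
    then show ?thesis
      using X_\<gamma>_le[of s0 "sk j" i] sk(1)[of j] by auto
  qed
  ultimately have "bounded (range (\<lambda>j. F (\<gamma> (sk j))))" by (rule bounded_F)
  then have "y0 \<in> Y"
    using limit_in_Y[OF \<gamma>_Y[OF sk(1)] \<gamma>_sk y0_in _ assms ge] by simp
  then show False using y0_notin by simp
qed

lemma T_\<gamma>_eventually_small:
  assumes "e > 0"
  obtains r where "s0 < r" "r < 1" "\<And>s. r \<le> s \<Longrightarrow> s < 1 \<Longrightarrow> T (\<gamma> s) < e"
proof -
  obtain s where s: "s0 \<le> s" "s < 1" "T (\<gamma> s) < e" using T_\<gamma>_small[OF assms] .
  have "T (\<gamma> s') < e" if "(s + 1) / 2 \<le> s'" "s' < 1" for s'
    using T_\<gamma>_le[of s s'] s that by auto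
  then show thesis using that[of "(s + 1) / 2"] s by auto
qed

text \<open>The displacement after parameter \<open>s\<close> is at most the horizon at
  \<open>T (\<gamma> s)\<close>, which tends to \<open>0\<close>; so the coordinates are Cauchy.
  Passing to the limit leaves only a weak inequality.\<close>

lemma X_\<gamma>_limit:
  obtains x :: "real ^ 'n" where "\<And>s i. s0 \<le> s \<Longrightarrow> s < 1 \<Longrightarrow> \<bar>X (\<gamma> s) i - x $ i\<bar> \<le> \<eta> i (T (\<gamma> s))"
proof -
  have bd: "\<bar>X (\<gamma> (sk j)) i - X (\<gamma> s) i\<bar> \<le> \<eta> i (T (\<gamma> s))" if "s0 \<le> s" "s \<le> sk j" for s j i
  proof -
    have "0 < \<eta> i (T (\<gamma> (sk j)))"
      using T_pos[OF \<gamma>_Y[OF sk(1)]] p_less_1 by (intro horizon_pos) auto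
    then show ?thesis using X_\<gamma>_le[of s "sk j" i] sk(1)[of j] that by auto
  qed
  have "convergent (\<lambda>j. X (\<gamma> (sk j)) i)" for i
  proof (rule real_Cauchy_convergent, rule metric_CauchyI)
    fix e :: real assume e: "e > 0"
    have "((\<lambda>t. \<eta> i t) \<longlongrightarrow> 0) (at_right 0)"
      using p_less_1 by (intro tendsto_horizon_0) (auto simp: eventually_at intro!: exI[of _ 1])
    then have "\<forall>\<^sub>F t in at_right 0. \<eta> i t < e / 2"
      using e by (intro order_tendstoD(2)) auto
    then obtain d where d: "d > 0" "\<And>t. 0 < t \<Longrightarrow> t < d \<Longrightarrow> \<eta> i t < e / 2"
      by (auto simp: eventually_at_right_field)
    obtain r where r: "s0 < r" "r < 1" "\<And>s. r \<le> s \<Longrightarrow> s < 1 \<Longrightarrow> T (\<gamma> s) < d"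
      using T_\<gamma>_eventually_small[OF d(1)] by blast
    have "\<forall>\<^sub>F j in sequentially. sk j > r"
      using r(2) sk(2) order_tendstoD(1) by blast
    then obtain M where M: "\<And>j. j \<ge> M \<Longrightarrow> sk j > r" by (auto simp: eventually_sequentially)
    have small: "\<eta> i (T (\<gamma> (sk M))) < e / 2"
      using M[of M] r(3)[of "sk M"] sk(1)[of M] T_pos[OF \<gamma>_Y[OF sk(1)[of M]]] by (intro d(2)) auto
    have "dist (X (\<gamma> (sk m)) i) (X (\<gamma> (sk n)) i) < e" if "m \<ge> M" "n \<ge> M" for m n
      using bd[of "sk M" m i] bd[of "sk M" n i] sk(3)[OF that(1)] sk(3)[OF that(2)] sk(1)[of M] small
      by (auto simp: dist_real_def)
    then show "\<exists>M. \<forall>m\<ge>M. \<forall>n\<ge>M. dist (X (\<gamma> (sk m)) i) (X (\<gamma> (sk n)) i) < e" by blast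
  qed
  then have lim: "(\<lambda>j. X (\<gamma> (sk j)) i) \<longlonglongrightarrow> lim (\<lambda>j. X (\<gamma> (sk j)) i)" for i
    by (simp add: convergent_LIMSEQ_iff)
  define x :: "real ^ 'n" where "x = (\<chi> i. lim (\<lambda>j. X (\<gamma> (sk j)) i))"
  have "\<bar>X (\<gamma> s) i - x $ i\<bar> \<le> \<eta> i (T (\<gamma> s))" if s: "s0 \<le> s" "s < 1" for s i
  proof -
    have "\<forall>\<^sub>F j in sequentially. sk j > s" using s(2) sk(2) order_tendstoD(1) by blast
    then have "\<forall>\<^sub>F j in sequentially. \<bar>X (\<gamma> s) i - X (\<gamma> (sk j)) i\<bar> \<le> \<eta> i (T (\<gamma> s))"
      by eventually_elim (use bd s(1) in \<open>auto simp: abs_minus_commute\<close>)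
    moreover have "(\<lambda>j. \<bar>X (\<gamma> s) i - X (\<gamma> (sk j)) i\<bar>) \<longlonglongrightarrow> \<bar>X (\<gamma> s) i - x $ i\<bar>"
      using lim by (auto simp: x_def intro!: tendsto_intros)
    ultimately show ?thesis by (intro tendsto_upperbound) auto
  qed
  then show thesis by (rule that)
qed

text \<open>The sign of \<open>l \<circ> E'\<close> on future directed timelike vectors is that on \<open>\<partial>\<^sub>t\<close>, since the future
  cone is convex and \<open>l\<close> has no zero on it.\<close>

lemma l_past_sign:
  assumes m: "m \<in> D" "E m \<in> ball y0 R" and v: "kasner_g p m v v < 0" "fst v < 0"
  shows "l (E' m v) * l (E' m (1, 0)) < 0"
proof -
  have lin: "linear (E' m)" using E_deriv[OF m(1)] has_derivative_linear by blast
  have m0: "fst m > 0" using m(1) D_sub by (auto simp: kasner_M_def)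
  have nz: "l (E' m w) \<noteq> 0" if "kasner_g p m w w < 0" for w
  proof
    assume 0: "l (E' m w) = 0"
    have g: "g (E m) (E' m w) (E' m w) < 0" using that iso_E[OF m(1)] by simp
    then have "E' m w = 0" using l_cone[OF m(2) g] 0 by simp
    then show False using g bilinear_lzero[OF g_bilinear[OF m(2)]] by simp
  qed
  define a where "a = l (E' m v)"
  \<comment> \<open>The value of \<open>l\<close> on the purely temporal vector with the same time
    component as \<open>v\<close>.\<close>
  define b where "b = fst v * l (E' m (1, 0))"
  have "kasner_g p m (1, 0) (1, 0) < 0" by (simp add: kasner_g_def)
  from nz[OF this] have b: "b \<noteq> 0" using v(2) by (simp add: b_def)
  have "a * b > 0"
  proof (rule ccontr)
    assume "\<not> a * b > 0"
    then have ab: "a * b \<le> 0" by simp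
    define t where "t = a / (a - b)"
    have t: "0 \<le> t" "t \<le> 1" "(1 - t) * a + t * b = 0"
      using ab b unfolding t_def by (auto simp: mult_le_0_iff field_simps)
    \<comment> \<open>At this \<open>t\<close> the affine interpolation between \<open>a\<close> and
      \<open>b\<close> vanishes. The vector keeps the time component of \<open>v\<close> and shrinks
      its space part, so it is timelike although \<open>l\<close> vanishes on its image.\<close>
    define w where "w = (1 - t) *\<^sub>R v + (t * fst v) *\<^sub>R (1, 0)"
    have fw: "fst w = fst v" and sw: "snd w = (1 - t) *\<^sub>R snd v"
      by (simp_all add: w_def algebra_simps)
    have "norm ((1 - t) *\<^sub>R kasner_scale p (fst m) (snd v)) \<le> 1 * norm (kasner_scale p (fst m) (snd v))"
      unfolding norm_scaleR using t by (intro mult_right_mono) auto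
    also have "\<dots> < \<bar>fst v\<bar>" using v(1) unfolding kasner_timelike_iff[OF m0] by simp
    finally have "kasner_g p m w w < 0"
      unfolding kasner_timelike_iff[OF m0] fw sw linear_cmul[OF linear_kasner_scale] .
    moreover have "l (E' m w) = (1 - t) * a + t * b"
      unfolding w_def b_def a_def
      by (simp only: linear_add[OF lin] linear_cmul[OF lin] linear_add[OF l_lin] linear_cmul[OF l_lin]) simp
    ultimately show False using nz[of w] t(3) by simp
  qed
  then have "fst v * (l (E' m v) * l (E' m (1, 0))) > 0" by (simp add: a_def b_def mult_ac)
  then show ?thesis using v(2) by (simp add: zero_less_mult_iff)
qed

section \<open>Confinement of past directed curves in the chart\<close>

lemma l_past_neg:
  assumes m: "m \<in> D" "E m \<in> ball y0 R" and pos: "l (E' m (1, 0)) > 0"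
    and v: "kasner_g p m v v < 0" "fst v < 0"
  shows "l (E' m v) < 0"
  using l_past_sign[OF m v] pos by (simp add: mult_less_0_iff)

text \<open>On past directed timelike vectors \<open>l\<close> is negative and dominates the norm,
  so the chart speed is at most \<open>C\<close> times the rate at which \<open>l\<close>
  decreases.\<close>

lemma past_curve_bound:
  assumes ab: "a \<le> b" and cont: "continuous_on {a..b} c"
    and D: "\<And>s. s \<in> {a..b} \<Longrightarrow> c s \<in> D \<and> E (c s) \<in> ball y0 R"
    and der: "\<And>s. s \<in> {a<..<b} \<Longrightarrow> (c has_vector_derivative c' s) (at s)"
    and tl: "\<And>s. s \<in> {a<..<b} \<Longrightarrow> kasner_g p (c s) (c' s) (c' s) < 0 \<and> fst (c' s) < 0"
    and pos: "\<And>s. s \<in> {a..b} \<Longrightarrow> l (E' (c s) (1, 0)) > 0"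
  shows "norm (E (c b) - E (c a)) \<le> C * (l (E (c a)) - l (E (c b)))"
proof (cases "a = b")
  case False
  have bl: "bounded_linear l" using l_lin by (simp add: linear_conv_bounded_linear)
  have contE: "continuous_on {a..b} (\<lambda>s. E (c s))"
    by (rule continuous_on_compose2[OF cont_E cont]) (use D in auto)
  have dE: "((\<lambda>s. E (c s)) has_vector_derivative E' (c s) (c' s)) (at s)" if "s \<in> {a<..<b}" for s
    using vector_derivative_diff_chain_within[OF der[OF that] has_derivative_at_withinI[OF E_deriv]] D that
    by (simp add: o_def)
  have "norm (E (c b) - E (c a)) \<le> - C * l (E (c b)) - - C * l (E (c a))"
  proof (rule differentiable_bound_general)
    show "a < b" using ab False by simp
    show "continuous_on {a..b} (\<lambda>s. E (c s))" by (rule contE)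
    show "continuous_on {a..b} (\<lambda>s. - C * l (E (c s)))"
      by (intro continuous_on_mult continuous_on_const bounded_linear.continuous_on[OF bl contE])
    show "((\<lambda>s. E (c s)) has_vector_derivative E' (c s) (c' s)) (at s)" if "a < s" "s < b" for s
      using dE that by auto
    show "((\<lambda>s. - C * l (E (c s))) has_vector_derivative - C * l (E' (c s) (c' s))) (at s)" if "a < s" "s < b" for s
      using bounded_linear.has_vector_derivative[OF bounded_linear_compose[OF bounded_linear_mult_right[of "- C"] bl] dE] that
      by auto
    show "norm (E' (c s) (c' s)) \<le> - C * l (E' (c s) (c' s))" if "a < s" "s < b" for s
    proof -
      have s: "s \<in> {a<..<b}" "s \<in> {a..b}" using that by auto
      have Ds: "c s \<in> D" "E (c s) \<in> ball y0 R" using D s by auto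
      have "l (E' (c s) (c' s)) < 0"
        using l_past_neg[OF Ds pos[OF s(2)]] tl[OF s(1)] by blast
      moreover have "norm (E' (c s) (c' s)) \<le> C * \<bar>l (E' (c s) (c' s))\<bar>"
        using l_cone[OF Ds(2)] iso_E[OF Ds(1)] tl[OF s(1)] by simp
      ultimately show ?thesis by simp
    qed
  qed
  then show ?thesis by (simp add: algebra_simps)
qed simp

lemma E'_F':
  assumes "y \<in> Y"
  shows "E' (F y) (F' y w) = w"
proof -
  have "((\<lambda>y. E (F y)) has_derivative (\<lambda>w. E' (F y) (F' y w))) (at y)"
    using diff_chain_at[OF F_deriv[OF assms] E_deriv[OF F_in[OF assms]]] by (simp add: o_def)
  moreover have "((\<lambda>y. E (F y)) has_derivative (\<lambda>w. w)) (at y)"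
    by (rule has_derivative_transform_within_open[OF has_derivative_ident open_Y assms]) (simp add: EF)
  ultimately show ?thesis using has_derivative_unique by metis
qed

text \<open>The curve is past directed and \<open>l\<close> decreases along it, so \<open>l\<close>
  must increase in the direction of Kasner time.\<close>

lemma l_pos_\<gamma>:
  assumes "s \<in> {s0<..<1}"
  shows "l (E' (F (\<gamma> s)) (1, 0)) > 0"
proof -
  have Y: "\<gamma> s \<in> Y" using \<gamma>_Y assms by auto
  have "\<gamma> s \<in> ball y0 R" using \<gamma>_ball[of s] assms R_pos by (auto simp: dist_norm norm_minus_commute)
  then have "l (E' (F (\<gamma> s)) (F' (\<gamma> s) (\<gamma>' s))) * l (E' (F (\<gamma> s)) (1, 0)) < 0"
    using l_past_sign[of "F (\<gamma> s)" "F' (\<gamma> s) (\<gamma>' s)"] F_in[OF Y] EF[OF Y] iso_F[OF Y]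
      \<gamma>_timelike[OF assms] \<gamma>_past[OF assms] by simp
  then show ?thesis using \<gamma>_l[OF assms] by (simp add: E'_F'[OF Y] mult_less_0_iff)
qed

text \<open>Compactness of \<open>S\<close> supplies, along a subsequence, the convergence of chart
  images that the closed graph requires.\<close>

lemma closed_graph_compact:
  assumes "\<And>k. f k \<in> D" "f \<longlonglongrightarrow> m" "m \<in> kasner_M" "\<And>k. E (f k) \<in> S" "compact S" "S \<subseteq> \<Omega>"
  shows "m \<in> D" "E m \<in> S"
proof -
  obtain y r where r: "y \<in> S" "strict_mono r" "((\<lambda>k. E (f k)) \<circ> r) \<longlonglongrightarrow> y"
    using assms(4,5) unfolding compact_eq_seq_compact_metric seq_compact_def by metis
  have "m \<in> D" "E m = y"
    using closed_graph_E[of "f \<circ> r" m y] assms LIMSEQ_subseq_LIMSEQ[OF assms(2) r(2)] r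
    by (auto simp: o_def)
  then show "m \<in> D" "E m \<in> S" using r by auto
qed

text \<open>A homotopy of past directed timelike Kasner curves that ends at a fixed point and starts near
  the chart cannot leave the chart: as long as it is inside, the functional \<open>l\<close> confines it to a
  ball determined by its end points.\<close>

lemma homotopy_in_patch:
  fixes c c' :: "real \<Rightarrow> real \<Rightarrow> 'n spt"
  assumes h: "a1 \<le> h" "h \<le> a2"
    and cont: "continuous_on ({0..1} \<times> {a1..a2}) (\<lambda>q. c (fst q) (snd q))"
    and M: "\<And>u s. u \<in> {0..1} \<Longrightarrow> s \<in> {a1..a2} \<Longrightarrow> c u s \<in> kasner_M"
    and der: "\<And>u s. u \<in> {0..1} \<Longrightarrow> s \<in> {a1<..<a2} \<Longrightarrow> s \<noteq> h \<Longrightarrow> (c u has_vector_derivative c' u s) (at s)"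
    and tl: "\<And>u s. u \<in> {0..1} \<Longrightarrow> s \<in> {a1<..<a2} \<Longrightarrow> s \<noteq> h \<Longrightarrow>
      kasner_g p (c u s) (c' u s) (c' u s) < 0 \<and> fst (c' u s) < 0"
    and start: "\<And>s. s \<in> {a1..a2} \<Longrightarrow> c 0 s \<in> D \<and> E (c 0 s) \<in> ball y0 R"
    and bot: "\<And>u. u \<in> {0..1} \<Longrightarrow> c u a2 = m"
    and pos: "l (E' m (1, 0)) > 0"
    and top: "\<And>u. u \<in> {0..1} \<Longrightarrow> l (E (c u a1)) - l (E m) \<le> r"
    and r: "cball (E m) (C * r) \<subseteq> ball y0 R"
    and u: "u \<in> {0..1}" and s: "s \<in> {a1..a2}"
  shows "c u s \<in> D \<and> E (c u s) \<in> cball (E m) (C * r)"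
proof -
  \<comment> \<open>The deformation parameters whose entire curve stays in the patch over the ball;
    this set turns out to be open and closed in \<open>{0..1}\<close>.\<close>
  define A where "A = {u \<in> {0..1}. \<forall>s\<in>{a1..a2}. c u s \<in> D \<and> E (c u s) \<in> ball y0 R}"
  have contu: "continuous_on {a1..a2} (c u)" if "u \<in> {0..1}" for u
  proof -
    have "continuous_on {a1..a2} (\<lambda>s. (\<lambda>q. c (fst q) (snd q)) (u, s))"
      by (rule continuous_on_compose2[OF cont]) (use that in \<open>auto intro!: continuous_intros\<close>)
    then show ?thesis by simp
  qed
  have bound: "E (c u s) \<in> cball (E m) (C * r)" if u: "u \<in> A" and s: "s \<in> {a1..a2}" for u s
  proof -
    have u01: "u \<in> {0..1}" and inD: "\<And>s. s \<in> {a1..a2} \<Longrightarrow> c u s \<in> D \<and> E (c u s) \<in> ball y0 R"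
      using u by (auto simp: A_def)
    let ?n = "\<lambda>s. l (E' (c u s) (1, 0))"
    have contn: "continuous_on {a1..a2} ?n"
    proof (rule bounded_linear.continuous_on[of l])
      show "bounded_linear l" using l_lin by (simp add: linear_conv_bounded_linear)
      show "continuous_on {a1..a2} (\<lambda>s. E' (c u s) (1, 0))"
        by (rule continuous_on_compose2[OF cont_E' contu[OF u01]]) (use inD in blast)
    qed
    have nz: "?n s \<noteq> 0" if "s \<in> {a1..a2}" for s
      using l_past_sign[of "c u s" "(-1, 0)"] inD[OF that] by (auto simp: kasner_g_def)
    \<comment> \<open>The sign known at the common lower end \<open>m\<close> propagates along the
      curve, because this continuous function has no zero.\<close>
    have npos: "?n s > 0" if s: "s \<in> {a1..a2}" for s
    proof (rule ccontr)
      assume "\<not> ?n s > 0"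
      moreover have "?n a2 > 0" using bot[OF u01] pos by simp
      moreover have "continuous_on {s..a2} ?n" using contn by (rule continuous_on_subset) (use s in auto)
      ultimately obtain x where "s \<le> x" "x \<le> a2" "?n x = 0"
        using IVT'[of ?n s 0 a2] s by auto
      then show False using nz[of x] s by auto
    qed
    have piece: "norm (E (c u b) - E (c u a)) \<le> C * (l (E (c u a)) - l (E (c u b)))"
      if "a1 \<le> a" "a \<le> b" "b \<le> a2" "b \<le> h \<or> h \<le> a" for a b
    proof (rule past_curve_bound[OF that(2), where c' = "c' u"])
      show "continuous_on {a..b} (c u)"
        by (rule continuous_on_subset[OF contu[OF u01]]) (use that in auto)
    qed (use that inD npos der[OF u01] tl[OF u01] in auto)
    \<comment> \<open>The curve may have a corner at \<open>h\<close>; the estimates on its two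
      sides telescope.\<close>
    have all: "norm (E (c u b) - E (c u a)) \<le> C * (l (E (c u a)) - l (E (c u b)))"
      if ab: "a1 \<le> a" "a \<le> b" "b \<le> a2" for a b
    proof (cases "b \<le> h \<or> h \<le> a")
      case False
      have "norm (E (c u b) - E (c u a)) \<le> norm (E (c u b) - E (c u h)) + norm (E (c u h) - E (c u a))"
        using norm_triangle_ineq[of "E (c u b) - E (c u h)" "E (c u h) - E (c u a)"] by simp
      also have "\<dots> \<le> C * (l (E (c u h)) - l (E (c u b))) + C * (l (E (c u a)) - l (E (c u h)))"
        using False ab by (intro add_mono piece) auto
      finally show ?thesis by (simp add: algebra_simps)
    qed (use piece ab in auto)
    have "0 \<le> C * (l (E (c u a1)) - l (E (c u s)))"
      using order_trans[OF norm_ge_zero all[of a1 s]] s by auto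
    then have "l (E (c u s)) \<le> l (E (c u a1))" using C_pos by (simp add: zero_le_mult_iff)
    then have "C * (l (E (c u s)) - l (E m)) \<le> C * r"
      using top[OF u01] C_pos by (intro mult_left_mono) auto
    then show ?thesis
      using all[of s a2] s bot[OF u01] by (auto simp: dist_norm)
  qed
  have "openin (top_of_set {0..1}) A"
    unfolding openin_contains_ball
  proof (intro conjI ballI)
    show "A \<subseteq> {0..1}" by (auto simp: A_def)
    fix u assume u: "u \<in> A"
    then have u01: "u \<in> {0..1}" by (auto simp: A_def)
    define W where "W = D \<inter> E -` ball y0 R"
    have W: "open W"
      unfolding W_def by (rule continuous_open_preimage[OF cont_E open_D open_ball])
    have "compact (c u ` {a1..a2})" "c u ` {a1..a2} \<subseteq> W"
      using u compact_continuous_image[OF contu[OF u01]] by (auto simp: A_def W_def)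
    then obtain e where e: "e > 0" "(\<Union>x\<in>c u ` {a1..a2}. cball x e) \<subseteq> W"
      using compact_subset_open_imp_cball_epsilon_subset[OF _ W] by blast
    obtain X0 where X0: "u \<in> X0" "open X0"
      "\<forall>x\<in>X0 \<inter> {0..1}. \<forall>t\<in>{a1..a2}. dist (c (fst (x, t)) (snd (x, t))) (c (fst (u, t)) (snd (u, t))) \<le> e"
      using continuous_on_prod_compactE[OF cont compact_Icc u01 e(1)] by blast
    obtain d where d: "d > 0" "ball u d \<subseteq> X0" using X0(1,2) open_contains_ball by blast
    have "c x t \<in> W" if "x \<in> ball u d \<inter> {0..1}" "t \<in> {a1..a2}" for x t
    proof -
      have "x \<in> X0 \<inter> {0..1}" using that d(2) by blast
      then have "dist (c x t) (c u t) \<le> e" using X0(3) that(2) by auto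
      then have "c x t \<in> cball (c u t) e" by (simp add: dist_commute)
      then show ?thesis using e(2) that(2) by blast
    qed
    then have "ball u d \<inter> {0..1} \<subseteq> A" by (auto simp: A_def W_def)
    then show "\<exists>e>0. ball u e \<inter> {0..1} \<subseteq> A" using d(1) by blast
  qed
  moreover have "closedin (top_of_set {0..1}) A"
    unfolding closedin_limpt
  proof (intro conjI allI impI)
    show "A \<subseteq> {0..1}" by (auto simp: A_def)
    fix u assume "u islimpt A \<and> u \<in> {0..1}"
    then have u01: "u \<in> {0..1}" and "u islimpt A" by auto
    then obtain f where f: "\<And>n::nat. f n \<in> A" "f \<longlonglongrightarrow> u"
      unfolding islimpt_sequential by blast
    have "c u s \<in> D \<and> E (c u s) \<in> ball y0 R" if s: "s \<in> {a1..a2}" for s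
    proof -
      have fA: "f n \<in> {0..1}" "c (f n) s \<in> D" for n using f(1)[of n] s by (auto simp: A_def)
      have "(\<lambda>n. (\<lambda>q. c (fst q) (snd q)) (f n, s)) \<longlonglongrightarrow> (\<lambda>q. c (fst q) (snd q)) (u, s)"
        by (rule continuous_on_tendsto_compose[OF cont])
          (use u01 s fA(1) f(2) in \<open>auto intro!: tendsto_intros always_eventually\<close>)
      then have lim: "(\<lambda>n. c (f n) s) \<longlonglongrightarrow> c u s" by simp
      \<comment> \<open>The bound puts all approximating points into one compact ball inside the
        chart, so the limit cannot leave the patch.\<close>
      have "c u s \<in> D" "E (c u s) \<in> cball (E m) (C * r)"
        using closed_graph_compact[OF fA(2) lim M[OF u01 s] bound[OF f(1) s] compact_cball]
          r ball_sub by auto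
      then show ?thesis using r by blast
    qed
    then show "u \<in> A" using u01 by (auto simp: A_def)
  qed
  ultimately have "A = {} \<or> A = {0..1}"
    using connected_Icc[of 0 "1::real"] unfolding connected_clopen by blast
  moreover have "0 \<in> A" using start by (simp add: A_def)
  ultimately have "u \<in> A" using u by blast
  then show ?thesis using bound[OF _ s] s by (auto simp: A_def)
qed

text \<open>Follow \<open>\<gamma>\<close> displaced in the \<open>j\<close>-th direction down to the parameter \<open>h\<close>, then return to
  \<open>\<gamma> s'\<close> along an almost null curve in the \<open>j\<close>-th direction.\<close>

definition displacement :: "'n \<Rightarrow> real \<Rightarrow> real \<Rightarrow> real \<Rightarrow> real ^ 'n" where
  "displacement j \<theta> s' s = snd (F (\<gamma> s')) - snd (F (\<gamma> s))
     + axis j (\<theta> * (\<eta> j (T (\<gamma> s)) - \<eta> j (T (\<gamma> s'))))"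

lemma continuous_displacement:
  assumes "s' < 1"
  shows "continuous_on {s0..s'} (displacement j \<theta> s')"
proof -
  have cF: "continuous_on {s0..s'} (\<lambda>s. F (\<gamma> s))"
    by (rule continuous_on_subset[OF continuous_F_\<gamma>]) (use assms in auto)
  have pos: "T (\<gamma> s) > 0" if "s \<in> {s0..s'}" for s
    using T_pos[OF \<gamma>_Y, of s] that assms by auto
  have "continuous_on {s0..s'} (\<lambda>s. \<eta> j (T (\<gamma> s)))"
    unfolding horizon_def
    by (intro continuous_on_divide continuous_on_powr continuous_on_const continuous_on_fst cF)
      (use pos p_less_1[of j] in \<open>auto simp: less_imp_neq dest: less_imp_neq\<close>, fastforce)
  then have "continuous_on {s0..s'} (\<lambda>s. \<theta> * (\<eta> j (T (\<gamma> s)) - \<eta> j (T (\<gamma> s'))))"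
    by (intro continuous_on_mult continuous_on_diff continuous_on_const)
  then have "continuous_on {s0..s'} (\<lambda>s. (\<theta> * (\<eta> j (T (\<gamma> s)) - \<eta> j (T (\<gamma> s')))) *\<^sub>R axis j (1::real))"
    by (intro continuous_on_scaleR continuous_on_const)
  moreover have "x *\<^sub>R axis j (1::real) = axis j x" for x by (simp add: axis_def vec_eq_iff)
  ultimately show ?thesis
    unfolding displacement_def
    by (intro continuous_on_add continuous_on_diff continuous_on_const continuous_on_snd cF) simp
qed

text \<open>Added to the spatial velocity of \<open>\<gamma>\<close>, this leaves only the axis
  term, whose frame length is \<open>\<theta>\<close> times the time component: timelike for
  \<open>\<theta> < 1\<close> and null in the limit.\<close>

lemma displacement_deriv:
  assumes "s \<in> {s0<..<1}"
  shows "(displacement j \<theta> s' has_vector_derivative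
     - snd (F' (\<gamma> s) (\<gamma>' s)) + axis j (T (\<gamma> s) powr (- (p $ j)) * (\<theta> * fst (F' (\<gamma> s) (\<gamma>' s))))) (at s)"
proof -
  have pos: "T (\<gamma> s) > 0" using T_pos[OF \<gamma>_Y, of s] assms by auto
  have dT: "((\<lambda>s. T (\<gamma> s)) has_real_derivative fst (F' (\<gamma> s) (\<gamma>' s))) (at s)"
    using bounded_linear.has_vector_derivative[OF bounded_linear_fst F_\<gamma>_deriv[OF assms]]
    by (simp add: has_real_derivative_iff_has_vector_derivative)
  have dX: "((\<lambda>s. snd (F (\<gamma> s))) has_vector_derivative snd (F' (\<gamma> s) (\<gamma>' s))) (at s)"
    using bounded_linear.has_vector_derivative[OF bounded_linear_snd F_\<gamma>_deriv[OF assms]] .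
  have "((\<lambda>s. \<theta> * (\<eta> j (T (\<gamma> s)) - \<eta> j (T (\<gamma> s')))) has_real_derivative
      T (\<gamma> s) powr (- (p $ j)) * (\<theta> * fst (F' (\<gamma> s) (\<gamma>' s)))) (at s)"
    using DERIV_chain2[OF horizon_has_derivative[OF pos p_less_1] dT, of j]
    by (auto intro!: derivative_eq_intros)
  then have dh: "((\<lambda>s. (\<theta> * (\<eta> j (T (\<gamma> s)) - \<eta> j (T (\<gamma> s')))) *\<^sub>R axis j (1::real)) has_vector_derivative
      (T (\<gamma> s) powr (- (p $ j)) * (\<theta> * fst (F' (\<gamma> s) (\<gamma>' s)))) *\<^sub>R axis j 1) (at s)"
    using has_vector_derivative_scaleR[OF _ has_vector_derivative_const] by fastforce
  have ax: "x *\<^sub>R axis j (1::real) = axis j x" for x by (simp add: axis_def vec_eq_iff)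
  show ?thesis
    unfolding displacement_def
    using has_vector_derivative_add[OF has_vector_derivative_diff[OF has_vector_derivative_const dX] dh]
    by (simp add: ax)
qed

text \<open>The curves with parameter \<open>u\<close> interpolate in space, at equal times, between
  \<open>\<gamma>\<close> and its displaced version. All end at \<open>\<gamma> s'\<close>, and
  convexity keeps them timelike. The final radius is \<open>\<epsilon>\<close> for the distance of
  \<open>\<gamma> s'\<close> from \<open>y0\<close> plus \<open>C * (2 * L * \<epsilon>)\<close>
  from \<open>homotopy_in_patch\<close>.\<close>

lemma displaced_curve_in_patch:
  assumes s: "s0 < s1" "s1 \<le> h" "h \<le> s'" "s' < 1" and \<theta>: "0 \<le> \<theta>" "\<theta> < 1"
    and top: "\<And>u. u \<in> {0..1} \<Longrightarrow> norm (E (T (\<gamma> s1), snd (F (\<gamma> s1)) + u *\<^sub>R displacement j \<theta> s' h) - y0) \<le> \<epsilon>"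
    and bot: "norm (\<gamma> s' - y0) \<le> \<epsilon>"
    and small: "(1 + 2 * C * L) * \<epsilon> < R"
    and x: "x \<in> {s1..h}"
  shows "(T (\<gamma> x), snd (F (\<gamma> x)) + displacement j \<theta> s' h) \<in> D"
    and "norm (E (T (\<gamma> x), snd (F (\<gamma> x)) + displacement j \<theta> s' h) - y0) \<le> (1 + 2 * C * L) * \<epsilon>"
proof -
  \<comment> \<open>Before \<open>h\<close> the displacement is frozen at its value at
    \<open>h\<close>; \<open>max\<close> keeps it continuous, with a possible corner only
    there.\<close>
  define \<delta> where "\<delta> s = displacement j \<theta> s' (max h s)" for s
  define c where "c u s = (T (\<gamma> s), snd (F (\<gamma> s)) + u *\<^sub>R \<delta> s)" for u s
  define t' where "t' s = fst (F' (\<gamma> s) (\<gamma>' s))" for s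
  define x' where "x' s = snd (F' (\<gamma> s) (\<gamma>' s))" for s
  define \<delta>' where "\<delta>' s = (if s < h then 0 else - x' s + axis j (T (\<gamma> s) powr (- (p $ j)) * (\<theta> * t' s)))" for s
  define c' where "c' u s = (t' s, x' s + u *\<^sub>R \<delta>' s)" for u s
  have sub: "s \<in> {s0<..<1}" if "s \<in> {s1..s'}" for s using that s by auto
  have pos: "T (\<gamma> s) > 0" if "s \<in> {s1..s'}" for s
    using T_pos[OF \<gamma>_Y, of s] sub[OF that] by auto
  have "0 \<le> \<epsilon>" using order_trans[OF norm_ge_zero bot] .
  have \<delta>s': "\<delta> s' = 0" using s by (simp add: \<delta>_def displacement_def axis_def vec_eq_iff max_def)
  have cF: "continuous_on {s1..s'} (\<lambda>s. F (\<gamma> s))"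
    by (rule continuous_on_subset[OF continuous_F_\<gamma>]) (use s in auto)
  have c\<delta>: "continuous_on {s1..s'} \<delta>"
    unfolding \<delta>_def
    by (rule continuous_on_compose2[OF continuous_displacement[OF s(4)] continuous_on_max
          [OF continuous_on_const continuous_on_id]]) (use s in auto)
  have main: "c 1 x \<in> D \<and> E (c 1 x) \<in> cball (E (F (\<gamma> s'))) (C * (2 * L * \<epsilon>))"
  proof (rule homotopy_in_patch[where h = h and c' = c' and ?a1.0 = s1 and ?a2.0 = s'])
    show "continuous_on ({0..1} \<times> {s1..s'}) (\<lambda>q. c (fst q) (snd q))"
      unfolding c_def
      by (intro continuous_on_Pair continuous_on_add continuous_on_scaleR continuous_on_fst continuous_on_snd
          continuous_on_compose2[OF cF] continuous_on_compose2[OF c\<delta>] continuous_on_id) auto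
    show "c u s \<in> kasner_M" if "s \<in> {s1..s'}" for u s
      using pos[OF that] by (simp add: c_def kasner_M_def)
    show "(c u has_vector_derivative c' u s) (at s)" if "s \<in> {s1<..<s'}" "s \<noteq> h" for u s
    proof -
      have s01: "s \<in> {s0<..<1}" using sub that by auto
      have "(\<delta> has_vector_derivative \<delta>' s) (at s)"
      proof (cases "s < h")
        case True
        have "(\<delta> has_vector_derivative 0) (at s)"
          by (rule has_vector_derivative_transform_within_open[OF has_vector_derivative_const[of "displacement j \<theta> s' h"], where S = "{..<h}"])
            (use True in \<open>auto simp: \<delta>_def max_def\<close>)
        then show ?thesis using True by (simp add: \<delta>'_def)
      next
        case False
        have "(\<delta> has_vector_derivative - x' s + axis j (T (\<gamma> s) powr (- (p $ j)) * (\<theta> * t' s))) (at s)"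
          unfolding x'_def t'_def
          by (rule has_vector_derivative_transform_within_open[OF displacement_deriv[OF s01], where S = "{h<..}"])
            (use False that(2) in \<open>auto simp: \<delta>_def max_def\<close>)
        then show ?thesis using False by (simp add: \<delta>'_def)
      qed
      then have d: "((\<lambda>s. u *\<^sub>R \<delta> s) has_vector_derivative u *\<^sub>R \<delta>' s) (at s)"
        by (rule bounded_linear.has_vector_derivative[OF bounded_linear_scaleR_right])
      show ?thesis
        unfolding c_def c'_def t'_def x'_def
        by (intro has_vector_derivative_Pair has_vector_derivative_add d
            bounded_linear.has_vector_derivative[OF bounded_linear_fst F_\<gamma>_deriv[OF s01]]
            bounded_linear.has_vector_derivative[OF bounded_linear_snd F_\<gamma>_deriv[OF s01]])
    qed
    show "kasner_g p (c u s) (c' u s) (c' u s) < 0 \<and> fst (c' u s) < 0"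
      if u: "u \<in> {0..1}" and ss: "s \<in> {s1<..<s'}" and "s \<noteq> h" for u s
    proof
      have s01: "s \<in> {s0<..<1}" and ps: "T (\<gamma> s) > 0" using sub pos ss by auto
      have neg: "t' s < 0" using \<gamma>_past[OF s01] by (simp add: t'_def)
      then show "fst (c' u s) < 0" by (simp add: c'_def)
      let ?S = "kasner_scale p (T (\<gamma> s))"
      have lin: "linear ?S" by (rule linear_kasner_scale)
      have "kasner_g p (F (\<gamma> s)) (t' s, x' s) (t' s, x' s) < 0"
        using iso_F[OF \<gamma>_Y] \<gamma>_timelike[OF s01] s01 by (simp add: t'_def x'_def)
      then have A: "norm (?S (x' s)) < \<bar>t' s\<bar>" using kasner_timelike_iff[OF ps, of p "(t' s, x' s)"] by simp
      have "norm (?S (x' s + u *\<^sub>R \<delta>' s)) < \<bar>t' s\<bar>"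
      proof (cases "s < h")
        case True
        then show ?thesis using A by (simp add: \<delta>'_def)
      next
        case False
        let ?a = "axis j (T (\<gamma> s) powr (- (p $ j)) * (\<theta> * t' s))"
        have "x' s + u *\<^sub>R \<delta>' s = (1 - u) *\<^sub>R x' s + u *\<^sub>R ?a"
          using False by (simp add: \<delta>'_def algebra_simps)
        then have "norm (?S (x' s + u *\<^sub>R \<delta>' s)) = norm ((1 - u) *\<^sub>R ?S (x' s) + u *\<^sub>R ?S ?a)"
          by (simp only: linear_add[OF lin] linear_cmul[OF lin])
        also have "\<dots> \<le> norm ((1 - u) *\<^sub>R ?S (x' s)) + norm (u *\<^sub>R ?S ?a)" by (rule norm_triangle_ineq)
        also have "\<dots> = (1 - u) * norm (?S (x' s)) + u * (\<theta> * \<bar>t' s\<bar>)"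
          using u \<theta> by (simp add: kasner_scale_axis[OF ps] abs_mult)
        also have "\<dots> < \<bar>t' s\<bar>"
        \<comment> \<open>For \<open>u = 1\<close> only the displaced velocity remains and
          strictness comes from \<open>\<theta> < 1\<close>; otherwise it comes from
          \<open>\<gamma>\<close>.\<close>
        proof (cases "u = 1")
          case True
          then show ?thesis using \<theta> neg by (simp add: mult_less_cancel_right2)
        next
          case False
          have "(1 - u) * norm (?S (x' s)) < (1 - u) * \<bar>t' s\<bar>" using A False u by auto
          moreover have "u * (\<theta> * \<bar>t' s\<bar>) \<le> u * (1 * \<bar>t' s\<bar>)"
            using u \<theta> by (intro mult_left_mono mult_right_mono) auto
          ultimately show ?thesis by (simp add: algebra_simps)
        qed
        finally show ?thesis .
      qed
      then show "kasner_g p (c u s) (c' u s) (c' u s) < 0"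
        using kasner_timelike_iff[of "c u s" p "c' u s"] ps by (simp add: c_def c'_def)
    qed
    show "c 0 s \<in> D \<and> E (c 0 s) \<in> ball y0 R" if "s \<in> {s1..s'}" for s
    proof -
      have Y: "\<gamma> s \<in> Y" using \<gamma>_Y[of s] sub[OF that] by auto
      have "norm (\<gamma> s - y0) \<le> R / 10" using \<gamma>_ball[of s] sub[OF that] by auto
      then show ?thesis using F_in[OF Y] EF[OF Y] R_pos
        by (simp add: c_def dist_norm norm_minus_commute)
    qed
    show "c u s' = F (\<gamma> s')" for u by (simp add: c_def \<delta>s')
    show "l (E' (F (\<gamma> s')) (1, 0)) > 0" by (rule l_pos_\<gamma>) (use s in auto)
    have EFs: "E (F (\<gamma> s')) = \<gamma> s'" using EF[OF \<gamma>_Y] s by auto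
    show "l (E (c u s1)) - l (E (F (\<gamma> s'))) \<le> 2 * L * \<epsilon>" if u: "u \<in> {0..1}" for u
    proof -
      have e: "norm (E (c u s1) - y0) \<le> \<epsilon>" using top[OF u] s by (simp add: c_def \<delta>_def max_def)
      have "norm (E (c u s1) - \<gamma> s') \<le> norm (E (c u s1) - y0) + norm (\<gamma> s' - y0)"
        using norm_triangle_ineq4[of "E (c u s1) - y0" "\<gamma> s' - y0"] by simp
      then have n: "norm (E (c u s1) - \<gamma> s') \<le> 2 * \<epsilon>" using e bot by linarith
      have "l (E (c u s1)) - l (\<gamma> s') = l (E (c u s1) - \<gamma> s')" by (simp add: linear_diff[OF l_lin])
      also have "\<dots> \<le> L * norm (E (c u s1) - \<gamma> s')" using l_bound[of "E (c u s1) - \<gamma> s'"] by linarith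
      also have "\<dots> \<le> L * (2 * \<epsilon>)" using n L_pos by (intro mult_left_mono) auto
      finally show ?thesis by (simp add: EFs mult_ac)
    qed
    show "cball (E (F (\<gamma> s'))) (C * (2 * L * \<epsilon>)) \<subseteq> ball y0 R"
    proof
      fix y assume "y \<in> cball (E (F (\<gamma> s'))) (C * (2 * L * \<epsilon>))"
      then have "norm (y - \<gamma> s') \<le> C * (2 * L * \<epsilon>)" by (simp add: EFs dist_norm norm_minus_commute)
      moreover have "norm (y - y0) \<le> norm (y - \<gamma> s') + norm (\<gamma> s' - y0)"
        using norm_triangle_ineq[of "y - \<gamma> s'" "\<gamma> s' - y0"] by simp
      ultimately show "y \<in> ball y0 R" using small bot by (simp add: dist_norm norm_minus_commute algebra_simps)
    qed
  qed (use s x in auto)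
  have cx: "c 1 x = (T (\<gamma> x), snd (F (\<gamma> x)) + displacement j \<theta> s' h)"
    using x by (simp add: c_def \<delta>_def max_absorb1)
  show "(T (\<gamma> x), snd (F (\<gamma> x)) + displacement j \<theta> s' h) \<in> D" using main by (simp add: cx)
  have EFs: "E (F (\<gamma> s')) = \<gamma> s'" using EF[OF \<gamma>_Y] s by auto
  have "norm (E (c 1 x) - \<gamma> s') \<le> C * (2 * L * \<epsilon>)"
    using main by (simp add: EFs dist_norm norm_minus_commute)
  moreover have "norm (E (c 1 x) - y0) \<le> norm (E (c 1 x) - \<gamma> s') + norm (\<gamma> s' - y0)"
    using norm_triangle_ineq[of "E (c 1 x) - \<gamma> s'" "\<gamma> s' - y0"] by simp
  ultimately show "norm (E (T (\<gamma> x), snd (F (\<gamma> x)) + displacement j \<theta> s' h) - y0) \<le> (1 + 2 * C * L) * \<epsilon>"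
    using bot by (simp add: cx algebra_simps)
qed

section \<open>Reaching the boundary of the horizon\<close>

lemma T_\<gamma>_sk: "(\<lambda>j. T (\<gamma> (sk j))) \<longlonglongrightarrow> 0"
proof (rule tendstoI)
  fix e :: real assume "e > 0"
  then obtain r where r: "r < 1" "\<And>s. r \<le> s \<Longrightarrow> s < 1 \<Longrightarrow> T (\<gamma> s) < e"
    using T_\<gamma>_eventually_small[of e] by blast
  have "\<forall>\<^sub>F j in sequentially. sk j > r" using r(1) sk(2) order_tendstoD(1) by blast
  then show "\<forall>\<^sub>F j in sequentially. dist (T (\<gamma> (sk j))) 0 < e"
  proof eventually_elim
    case (elim j)
    then show ?case using r(2)[of "sk j"] sk(1)[of j] T_pos[OF \<gamma>_Y[OF sk(1)[of j]]] by auto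
  qed
qed

lemma \<eta>_\<gamma>_sk: "(\<lambda>j. \<eta> i (T (\<gamma> (sk j)))) \<longlonglongrightarrow> 0"
  using T_pos[OF \<gamma>_Y[OF sk(1)]] by (intro tendsto_horizon_0 p_less_1 T_\<gamma>_sk always_eventually allI less_imp_le)

lemma X_\<gamma>_sk:
  assumes "\<And>s i. s0 \<le> s \<Longrightarrow> s < 1 \<Longrightarrow> \<bar>X (\<gamma> s) i - x $ i\<bar> \<le> \<eta> i (T (\<gamma> s))"
  shows "(\<lambda>j. snd (F (\<gamma> (sk j)))) \<longlonglongrightarrow> x"
proof (rule vec_tendstoI)
  fix i
  have "(\<lambda>j. X (\<gamma> (sk j)) i - x $ i) \<longlonglongrightarrow> 0"
    by (rule Lim_null_comparison[OF _ \<eta>_\<gamma>_sk[of i]]) (use assms sk(1) in auto)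
  then show "(\<lambda>j. X (\<gamma> (sk j)) i) \<longlonglongrightarrow> x $ i" using LIM_zero_iff by blast
qed

text \<open>The translation \<open>d\<close> puts the point at \<open>h\<close> on the boundary of
  the horizon, where the return curve would be null. It is approached by timelike returns with
  \<open>\<theta>\<close> tending to \<open>1\<close> and lower ends moving along
  \<open>\<gamma>\<close> to its end; confinement to a compact ball survives the limit.\<close>

lemma translated_curve_in_patch:
  assumes lim: "\<And>s i. s0 \<le> s \<Longrightarrow> s < 1 \<Longrightarrow> \<bar>X (\<gamma> s) i - x0 $ i\<bar> \<le> \<eta> i (T (\<gamma> s))"
    and s: "s0 < s1" "s1 \<le> h" "h < 1"
    and d: "d = x0 + axis j (\<eta> j (T (\<gamma> h))) - snd (F (\<gamma> h))" "norm d < e"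
    and top: "\<And>v. norm v < e \<Longrightarrow> norm (E (T (\<gamma> s1), snd (F (\<gamma> s1)) + v) - y0) \<le> \<epsilon>"
    and bot: "\<And>s. h \<le> s \<Longrightarrow> s < 1 \<Longrightarrow> norm (\<gamma> s - y0) \<le> \<epsilon>"
    and small: "(1 + 2 * C * L) * \<epsilon> < R"
    and x: "x \<in> {s1..h}"
  shows "(T (\<gamma> x), snd (F (\<gamma> x)) + d) \<in> D"
    and "norm (E (T (\<gamma> x), snd (F (\<gamma> x)) + d) - y0) \<le> (1 + 2 * C * L) * \<epsilon>"
proof -
  define \<theta> where "\<theta> k = 1 - 1 / real (Suc k)" for k
  have \<theta>: "0 \<le> \<theta> k" "\<theta> k < 1" for k by (auto simp: \<theta>_def)
  have \<theta>lim: "\<theta> \<longlonglongrightarrow> 1 - 0"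
    unfolding \<theta>_def using LIMSEQ_Suc[OF lim_const_over_n[of "1::real"]]
    by (intro tendsto_diff tendsto_const) simp
  have ax: "a *\<^sub>R axis j (1::real) = axis j a" for a by (simp add: axis_def vec_eq_iff)
  define f where "f k = displacement j (\<theta> k) (sk k) h" for k
  have "(\<lambda>k. snd (F (\<gamma> (sk k))) - snd (F (\<gamma> h))
      + (\<theta> k * (\<eta> j (T (\<gamma> h)) - \<eta> j (T (\<gamma> (sk k))))) *\<^sub>R axis j (1::real))
      \<longlonglongrightarrow> x0 - snd (F (\<gamma> h)) + ((1 - 0) * (\<eta> j (T (\<gamma> h)) - 0)) *\<^sub>R axis j (1::real)"
    by (intro tendsto_intros X_\<gamma>_sk lim \<theta>lim \<eta>_\<gamma>_sk)
  then have flim: "f \<longlonglongrightarrow> d"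
    by (simp add: f_def[abs_def] displacement_def d(1) ax algebra_simps)
  have "\<forall>\<^sub>F k in sequentially. norm (f k) < e \<and> h < sk k"
    using order_tendstoD(2)[OF tendsto_norm[OF flim] d(2)] order_tendstoD(1)[OF sk(2) s(3)]
    by (rule eventually_conj)
  then obtain N where N: "\<And>k. k \<ge> N \<Longrightarrow> norm (f k) < e \<and> h < sk k"
    by (auto simp: eventually_sequentially)
  define c where "c k = (T (\<gamma> x), snd (F (\<gamma> x)) + f (k + N))" for k
  have cD: "c k \<in> D" "norm (E (c k) - y0) \<le> (1 + 2 * C * L) * \<epsilon>" for k
  proof -
    have k: "norm (f (k + N)) < e" "h \<le> sk (k + N)" "sk (k + N) < 1"
      using N[of "k + N"] sk(1)[of "k + N"] by auto
    have top': "norm (E (T (\<gamma> s1), snd (F (\<gamma> s1)) + u *\<^sub>R displacement j (\<theta> (k + N)) (sk (k + N)) h) - y0) \<le> \<epsilon>"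
      if "u \<in> {0..1}" for u
    proof (rule top)
      have "norm (u *\<^sub>R f (k + N)) \<le> 1 * norm (f (k + N))"
        unfolding norm_scaleR using that by (intro mult_right_mono) auto
      then show "norm (u *\<^sub>R displacement j (\<theta> (k + N)) (sk (k + N)) h) < e"
        using k(1) by (simp add: f_def)
    qed
    show "c k \<in> D" "norm (E (c k) - y0) \<le> (1 + 2 * C * L) * \<epsilon>"
      using displaced_curve_in_patch[OF s(1,2) k(2,3) \<theta>(1) \<theta>(2) top' bot[OF k(2,3)] small x]
      by (simp_all add: c_def f_def)
  qed
  have clim: "c \<longlonglongrightarrow> (T (\<gamma> x), snd (F (\<gamma> x)) + d)"
    unfolding c_def by (intro tendsto_intros LIMSEQ_ignore_initial_segment[OF flim])
  have "T (\<gamma> x) > 0" using T_pos[OF \<gamma>_Y, of x] x s by auto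
  then have M: "(T (\<gamma> x), snd (F (\<gamma> x)) + d) \<in> kasner_M" by (simp add: kasner_M_def)
  have S: "cball y0 ((1 + 2 * C * L) * \<epsilon>) \<subseteq> \<Omega>" using small ball_sub by auto
  have cS: "E (c k) \<in> cball y0 ((1 + 2 * C * L) * \<epsilon>)" for k
    using cD(2)[of k] by (simp add: dist_norm norm_minus_commute)
  show "(T (\<gamma> x), snd (F (\<gamma> x)) + d) \<in> D"
    by (rule closed_graph_compact(1)[OF cD(1) clim M cS compact_cball S])
  have "E (T (\<gamma> x), snd (F (\<gamma> x)) + d) \<in> cball y0 ((1 + 2 * C * L) * \<epsilon>)"
    by (rule closed_graph_compact(2)[OF cD(1) clim M cS compact_cball S])
  then show "norm (E (T (\<gamma> x), snd (F (\<gamma> x)) + d) - y0) \<le> (1 + 2 * C * L) * \<epsilon>"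
    by (simp add: dist_norm norm_minus_commute)
qed

section \<open>Lines parallel to a chord of the curve\<close>

lemma segment_in_ball: "z \<in> ball y0 R \<Longrightarrow> w \<in> ball y0 R \<Longrightarrow> closed_segment z w \<subseteq> ball y0 R"
  by (simp add: closed_segment_subset)

lemma \<gamma>_in_ball: "s \<in> {s0..1} \<Longrightarrow> \<gamma> s \<in> ball y0 R"
  using \<gamma>_ball[of s] R_pos by (auto simp: dist_norm norm_minus_commute)

lemma \<gamma>_cone_k: "s0 \<le> s \<Longrightarrow> s < s' \<Longrightarrow> s' \<le> 1 \<Longrightarrow> \<gamma> s - \<gamma> s' \<in> cone_around n0 k"
  using \<gamma>_cone cone_around_mono[of "k / 2" k n0] k_pos by auto

text \<open>The chords with fixed upper end \<open>\<gamma> s0\<close> form a connected family that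
  starts with the degenerate one, and the nondegenerate ones lie in the timelike cone.\<close>

lemma \<gamma>_segment:
  assumes "s0 \<le> s" "s < 1"
  shows "closed_segment (\<gamma> s) (\<gamma> s0) \<subseteq> Y"
proof (rule segment_continuation)
  let ?P = "(\<lambda>s. (\<gamma> s, \<gamma> s0)) ` {s0..<1}"
  have "continuous_on {s0..<1} (\<lambda>s. (\<gamma> s, \<gamma> s0))"
    by (intro continuous_intros continuous_on_subset[OF \<gamma>_cont]) auto
  then show "connected ?P" by (rule connected_continuous_image) simp
  show "(\<gamma> s0, \<gamma> s0) \<in> ?P" using s0_less by auto
  show "closed_segment (fst (\<gamma> s0, \<gamma> s0)) (snd (\<gamma> s0, \<gamma> s0)) \<subseteq> Y" using \<gamma>_Y s0_less by auto
  show "(\<gamma> s, \<gamma> s0) \<in> ?P" using assms by auto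
  have b: "\<gamma> s0 \<in> ball y0 R" using \<gamma>_in_ball s0_less by auto
  show "z \<in> Y \<and> w \<in> Y \<and> closed_segment z w \<subseteq> \<Omega>" if "(z, w) \<in> ?P" for z w
  proof -
    obtain s where "z = \<gamma> s" "w = \<gamma> s0" "s \<in> {s0..<1}" using \<open>(z, w) \<in> ?P\<close> by auto
    then show ?thesis using \<gamma>_Y[of s] \<gamma>_Y[of s0] s0_less segment_in_ball[OF \<gamma>_in_ball[of s] b] ball_sub by auto
  qed
  show "g y (w - z) (w - z) < 0" if P: "(z, w) \<in> ?P" and y: "y \<in> closed_segment z w" and ne: "z \<noteq> w" for z w y
  proof -
    obtain s where s: "z = \<gamma> s" "w = \<gamma> s0" "s \<in> {s0..<1}" using P by auto
    then have "s0 < s" using ne by (cases "s = s0") auto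
    then have "w - z \<in> cone_around n0 k" using \<gamma>_cone_k[of s0 s] s by auto
    then show ?thesis
      using cone_neg[of y] y segment_in_ball[OF \<gamma>_in_ball[of s] b] s ne by auto
  qed
qed

end

text \<open>Straight lines in the direction \<open>n = b - b'\<close> of a chord of \<open>\<gamma>\<close>, issuing from the points of a
  ball around the upper end \<open>b\<close> of the chord.\<close>

locale kasner_lines = kasner_past_curve +
  fixes s1 \<rho> :: real and n b b' :: 'b
  assumes s1: "s0 < s1" "s1 < 1" and b_def: "b = \<gamma> s0" and b'_def: "b' = \<gamma> s1" and n_def: "n = b - b'"
    and \<rho>_pos: "\<rho> > 0" and \<rho>_R: "\<rho> \<le> R / 10" and \<rho>_Y: "cball b (2 * \<rho>) \<subseteq> Y"
    and \<rho>_cone: "\<rho> + norm (b' - y0) \<le> (k / 2) / (norm n0 + k / 2) * norm n"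
begin

lemma n_cone: "n \<in> cone_around n0 (k / 2)"
  using \<gamma>_cone[of s0 s1] s1 by (simp add: n_def b_def b'_def)

lemma n_cone_k: "n \<in> cone_around n0 k"
  using \<gamma>_cone_k[of s0 s1] s1 by (simp add: n_def b_def b'_def)

lemma n_neq: "n \<noteq> 0"
  using \<gamma>_neq[of s0 s1] s1 by (simp add: n_def b_def b'_def)

lemma n_norm: "norm n \<le> R / 5"
proof -
  have "norm n \<le> norm (b - y0) + norm (b' - y0)"
    using norm_triangle_ineq4[of "b - y0" "b' - y0"] by (simp add: n_def)
  then show ?thesis using \<gamma>_ball[of s0] \<gamma>_ball[of s1] s1 by (simp add: b_def b'_def)
qed

text \<open>The distances add up to at most \<open>R / 10\<close> for \<open>w\<close> from
  \<open>b\<close>, \<open>R / 10\<close> for \<open>b\<close> from \<open>y0\<close>, and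
  \<open>2 * (R / 5)\<close> along the line.\<close>

lemma line_in_ball:
  assumes "w \<in> cball b \<rho>" "\<bar>t\<bar> \<le> 2"
  shows "w - t *\<^sub>R n \<in> ball y0 R"
proof -
  have "norm (w - t *\<^sub>R n - y0) \<le> norm (w - y0) + norm (t *\<^sub>R n)"
    using norm_triangle_ineq4[of "w - y0" "t *\<^sub>R n"] by (simp add: algebra_simps)
  also have "norm (w - y0) \<le> norm (w - b) + norm (b - y0)"
    using norm_triangle_ineq[of "w - b" "b - y0"] by simp
  also have "norm (t *\<^sub>R n) \<le> 2 * (R / 5)"
    unfolding norm_scaleR using assms(2) n_norm by (intro mult_mono) auto
  finally show ?thesis
    using assms(1) \<rho>_R \<gamma>_ball[of s0] s1 R_pos by (simp add: dist_norm norm_minus_commute b_def)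
qed

lemma line_timelike:
  assumes "y \<in> ball y0 R" "t \<noteq> 0"
  shows "g y (t *\<^sub>R n) (t *\<^sub>R n) < 0"
proof -
  have "g y (t *\<^sub>R n) (t *\<^sub>R n) = t\<^sup>2 * g y n n"
    using g_bilinear[OF assms(1)] by (simp add: bilinear_lmul bilinear_rmul power2_eq_square)
  then show ?thesis
    using cone_neg[OF assms(1) n_cone_k n_neq] assms(2) by (simp add: mult_less_0_iff)
qed

lemma line_segment_timelike:
  assumes "w \<in> cball b \<rho>" "\<bar>t\<bar> \<le> 2" "\<bar>t'\<bar> \<le> 2" "y \<in> closed_segment (w - t *\<^sub>R n) (w - t' *\<^sub>R n)" "t \<noteq> t'"
  shows "g y ((w - t' *\<^sub>R n) - (w - t *\<^sub>R n)) ((w - t' *\<^sub>R n) - (w - t *\<^sub>R n)) < 0"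
proof -
  have "y \<in> ball y0 R" using assms segment_in_ball line_in_ball by blast
  then show ?thesis using line_timelike[of y "t - t'"] assms(5) by (simp add: algebra_simps)
qed

lemma line_subsegment:
  assumes "0 \<le> t" "t \<le> a"
  shows "w - t *\<^sub>R n \<in> closed_segment (w - a *\<^sub>R n) w"
proof (cases "a = 0")
  case False
  then have a: "a > 0" using assms by auto
  have "w - t *\<^sub>R n = (1 - (1 - t / a)) *\<^sub>R (w - a *\<^sub>R n) + (1 - t / a) *\<^sub>R w"
    using a by (simp add: algebra_simps)
  then show ?thesis using assms a unfolding closed_segment_def
    by (intro CollectI exI[of _ "1 - t / a"]) auto
qed (use assms in auto)

lemma line_subset:
  assumes "0 \<le> t" "t \<le> t'" "t' \<le> a" "closed_segment (w - a *\<^sub>R n) w \<subseteq> Y"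
  shows "closed_segment (w - t' *\<^sub>R n) (w - t *\<^sub>R n) \<subseteq> Y"
proof -
  have "closed_segment (w - t' *\<^sub>R n) (w - t *\<^sub>R n) \<subseteq> closed_segment (w - a *\<^sub>R n) w"
    using assms by (simp add: subset_closed_segment line_subsegment)
  then show ?thesis using assms(4) by blast
qed

lemma line_T_neq:
  assumes "w \<in> cball b \<rho>" "0 \<le> t" "t < t'" "t' \<le> 2" "closed_segment (w - t' *\<^sub>R n) w \<subseteq> Y"
  shows "T (w - t' *\<^sub>R n) \<noteq> T (w - t *\<^sub>R n)"
proof (rule timelike_segment(1))
  show "closed_segment (w - t' *\<^sub>R n) (w - t *\<^sub>R n) \<subseteq> Y" by (rule line_subset) (use assms in auto)
  show "w - t' *\<^sub>R n \<noteq> w - t *\<^sub>R n" using n_neq assms by auto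
qed (use line_segment_timelike assms in auto)

lemma line_T_less_iff:
  assumes w: "w \<in> cball b \<rho>" and t: "0 < t" "t \<le> t'" "t' \<le> 2" and Y: "closed_segment (w - t' *\<^sub>R n) w \<subseteq> Y"
  shows "T (w - t *\<^sub>R n) < T w \<longleftrightarrow> T (w - t' *\<^sub>R n) < T w"
proof (cases "t = t'")
  case False
  have ne: "w - t' *\<^sub>R n \<noteq> w" "w - t *\<^sub>R n \<noteq> w" "w - t *\<^sub>R n \<noteq> w - t' *\<^sub>R n"
    using t n_neq False by auto
  then have op: "w - t *\<^sub>R n \<in> open_segment (w - t' *\<^sub>R n) w"
    using line_subsegment[of t t' w] t by (auto simp: open_segment_def)
  have tl: "g y (w - (w - t' *\<^sub>R n)) (w - (w - t' *\<^sub>R n)) < 0" if "y \<in> closed_segment (w - t' *\<^sub>R n) w" for y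
    using line_segment_timelike[OF w, of t' 0 y] that t by auto
  show ?thesis
    using timelike_segment(3)[OF Y ne(1) tl op] by auto
qed simp

text \<open>The orientation is known on the line through \<open>b\<close>, which meets
  \<open>\<gamma> s1\<close> at parameter \<open>1\<close>. Short pieces of all lines form a
  connected family inside \<open>Y\<close>, so it carries over to them, and along each line it is
  constant.\<close>

lemma line_T_less:
  assumes w: "w \<in> cball b \<rho>" and t: "0 < t" "t \<le> 2" and Y: "closed_segment (w - t *\<^sub>R n) w \<subseteq> Y"
  shows "T (w - t *\<^sub>R n) < T w"
proof -
  have bn: "b - 1 *\<^sub>R n = \<gamma> s1" by (simp add: n_def b'_def)
  have b: "b \<in> cball b \<rho>" using \<rho>_pos by simp
  \<comment> \<open>Short enough to keep the pieces in \<open>cball b (2 * \<rho>)\<close>; the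
    bounds \<open>1\<close> and \<open>t\<close> allow comparison along the lines through
    \<open>b\<close> and \<open>w\<close>.\<close>
  define e where "e = min (min 1 t) (\<rho> / norm n)"
  have e: "0 < e" "e \<le> 1" "e \<le> t" "e * norm n \<le> \<rho>"
  proof -
    show "0 < e" "e \<le> 1" "e \<le> t" using t \<rho>_pos n_neq by (auto simp: e_def)
    have "e \<le> \<rho> / norm n" by (simp add: e_def)
    then show "e * norm n \<le> \<rho>" using n_neq by (simp add: pos_le_divide_eq)
  qed
  have segY: "closed_segment (w' - e *\<^sub>R n) w' \<subseteq> Y" if "w' \<in> cball b \<rho>" for w'
  proof -
    have "norm (w' - e *\<^sub>R n - b) \<le> norm (w' - b) + norm (e *\<^sub>R n)"
      using norm_triangle_ineq4[of "w' - b" "e *\<^sub>R n"] by (simp add: algebra_simps)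
    then have "w' - e *\<^sub>R n \<in> cball b (2 * \<rho>)"
      using that e by (simp add: dist_norm norm_minus_commute)
    moreover have "w' \<in> cball b (2 * \<rho>)" using that \<rho>_pos by auto
    ultimately show ?thesis using \<rho>_Y closed_segment_subset[OF _ _ convex_cball] by blast
  qed
  have "T (b - 1 *\<^sub>R n) < T b" unfolding bn using T_\<gamma>_less[of s0 s1] s1 by (simp add: b_def)
  moreover have "closed_segment (b - 1 *\<^sub>R n) b \<subseteq> Y"
    unfolding bn using \<gamma>_segment[of s1] s1 by (simp add: b_def)
  ultimately have 1: "T (b - e *\<^sub>R n) < T b"
    using line_T_less_iff[OF b e(1,2)] by simp
  have "T (w - e *\<^sub>R n) < T w"
  proof (rule segment_orientation[OF _ _ 1])
    let ?P = "(\<lambda>w. (w - e *\<^sub>R n, w)) ` cball b \<rho>"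
    show "connected ?P"
      by (intro connected_continuous_image continuous_intros convex_connected convex_cball)
    show "(b - e *\<^sub>R n, b) \<in> ?P" "(w - e *\<^sub>R n, w) \<in> ?P" using w b by auto
    show "z \<noteq> w \<and> closed_segment z w \<subseteq> Y" if "(z, w) \<in> ?P" for z w
      using that segY[of w] e n_neq by auto
    show "g y (w - z) (w - z) < 0" if "(z, w) \<in> ?P" "y \<in> closed_segment z w" for z w y
    proof -
      have z: "z = w - e *\<^sub>R n" "w \<in> cball b \<rho>" using that(1) by auto
      show ?thesis using line_segment_timelike[OF z(2), of e 0 y] that(2) e z(1) by auto
    qed
  qed
  then show ?thesis using line_T_less_iff[OF w e(1,3) t(2) Y] by simp
qed

text \<open>If such a line stayed in \<open>Y\<close> down to \<open>r = w - 2 n\<close>, then \<open>r\<close> could be joined to all points of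
  \<open>\<gamma>\<close> by timelike segments inside \<open>Y\<close>, although the Kasner time tends to \<open>0\<close> along \<open>\<gamma>\<close>.\<close>

lemma line_exits:
  assumes w: "w \<in> cball b \<rho>"
  shows "\<not> closed_segment (w - 2 *\<^sub>R n) w \<subseteq> Y"
proof
  assume Y: "closed_segment (w - 2 *\<^sub>R n) w \<subseteq> Y"
  define r where "r = w - 2 *\<^sub>R n"
  have Tr: "T r < T w" unfolding r_def by (rule line_T_less[OF w _ _ Y]) auto
  have rY: "r \<in> Y" using Y by (auto simp: r_def)
  have rb: "r \<in> ball y0 R" unfolding r_def by (rule line_in_ball[OF w]) simp
  \<comment> \<open>A connected set leading from \<open>w\<close> to \<open>b\<close> and on along
    \<open>\<gamma>\<close>, all of it in the timelike cone above \<open>r\<close>.\<close>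
  define Q where "Q = closed_segment w b \<union> \<gamma> ` {s0..<1}"
  have "connected (\<gamma> ` {s0..<1})"
    by (intro connected_continuous_image continuous_on_subset[OF \<gamma>_cont]) auto
  moreover have "b \<in> \<gamma> ` {s0..<1}" using s0_less by (auto simp: b_def)
  ultimately have "connected Q"
    unfolding Q_def by (intro connected_Un) auto
  then have conn: "connected ((\<lambda>z. (r, z)) ` Q)"
    by (intro connected_continuous_image continuous_intros)
  have segb: "closed_segment w b \<subseteq> cball b \<rho>"
    using w \<rho>_pos by (intro closed_segment_subset) auto
  \<comment> \<open>For a point \<open>z\<close> of \<open>\<gamma>\<close> the vector
    \<open>z - r\<close> is \<open>(z - y0) + n\<close> plus this error. One copy of
    \<open>n\<close> in \<open>r\<close> bridges \<open>b\<close> and \<open>b'\<close>, the other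
    absorbs the error; this is why the line is followed to parameter \<open>2\<close>.\<close>
  have small: "norm ((y0 - b') + (b - w)) \<le> (k / 2) / (norm n0 + k / 2) * norm n"
    using norm_triangle_ineq[of "y0 - b'" "b - w"] w \<rho>_cone by (simp add: dist_norm norm_minus_commute)
  have Q: "z \<in> Y \<and> z \<in> ball y0 R \<and> z \<noteq> r \<and> z - r \<in> cone_around n0 k" if "z \<in> Q" for z
    using that unfolding Q_def
  proof
    assume z: "z \<in> closed_segment w b"
    then have zb: "z \<in> cball b \<rho>" using segb by auto
    have "norm (z - w) \<le> norm (b - w)"
      using segment_bound(1)[OF z] by simp
    also have "\<dots> \<le> \<rho>" using w by (simp add: dist_norm)
    also have "\<dots> \<le> (k / 2) / (norm n0 + k / 2) * norm n" using \<rho>_cone norm_ge_zero[of "b' - y0"] by linarith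
    finally have sm: "norm (z - w) \<le> (k / 2) / (norm n0 + k / 2) * norm n" .
    have "n + (z - w) \<in> cone_around n0 k" by (rule cone_around_perturb[OF n_cone k_pos sm])
    then have "n + (n + (z - w)) \<in> cone_around n0 k" "n + (n + (z - w)) \<noteq> 0"
      using cone_around_add[OF n_cone_k] cone_around_pointed[OF n_cone_k _ n_neq k_pos k_less] by blast+
    moreover have "n + (n + (z - w)) = z - r" by (simp add: r_def algebra_simps scaleR_2)
    ultimately have "z - r \<in> cone_around n0 k" "z - r \<noteq> 0" by metis+
    then show ?thesis using zb \<rho>_Y \<rho>_pos line_in_ball[OF zb, of 0] by auto
  next
    assume "z \<in> \<gamma> ` {s0..<1}"
    then obtain s where s: "z = \<gamma> s" "s \<in> {s0..<1}" by auto
    have c1: "z - y0 \<in> cone_around n0 k" using \<gamma>_cone_k[of s 1] s \<gamma>_end by auto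
    have "n + ((y0 - b') + (b - w)) \<in> cone_around n0 k" by (rule cone_around_perturb[OF n_cone k_pos small])
    moreover have "z - y0 \<noteq> 0" using s \<gamma>_Y[of s] y0_notin by auto
    ultimately have "(z - y0) + (n + ((y0 - b') + (b - w))) \<in> cone_around n0 k"
      "(z - y0) + (n + ((y0 - b') + (b - w))) \<noteq> 0"
      using cone_around_add[OF c1] cone_around_pointed[OF c1 _ _ k_pos k_less] by blast+
    moreover have "(z - y0) + (n + ((y0 - b') + (b - w))) = z - r"
      by (simp add: r_def n_def algebra_simps scaleR_2)
    ultimately have "z - r \<in> cone_around n0 k" "z - r \<noteq> 0" by metis+
    then show ?thesis using s \<gamma>_Y[of s] \<gamma>_in_ball[of s] by auto
  qed
  have P: "w' \<in> Q" if "(z, w') \<in> (\<lambda>z. (r, z)) ` Q" for z w' using that by auto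
  have Pz: "z = r" if "(z, w') \<in> (\<lambda>z. (r, z)) ` Q" for z w' using that by auto
  have tl: "g y (w' - z) (w' - z) < 0" if "(z, w') \<in> (\<lambda>z. (r, z)) ` Q" "y \<in> closed_segment z w'" for z w' y
    using Q[OF P[OF that(1)]] Pz[OF that(1)] that(2) segment_in_ball[OF rb, of w'] cone_neg[of y "w' - z"] by auto
  have wQ: "w \<in> Q" by (simp add: Q_def)
  have seg: "closed_segment r z \<subseteq> Y" if z: "z \<in> Q" for z
  proof (rule segment_continuation[OF conn])
    show "(r, w) \<in> (\<lambda>z. (r, z)) ` Q" "(r, z) \<in> (\<lambda>z. (r, z)) ` Q" using wQ z by auto
    show "closed_segment (fst (r, w)) (snd (r, w)) \<subseteq> Y" using Y by (simp add: r_def)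
    show "z \<in> Y \<and> w \<in> Y \<and> closed_segment z w \<subseteq> \<Omega>" if "(z, w) \<in> (\<lambda>z. (r, z)) ` Q" for z w
      using Q[OF P[OF that]] Pz[OF that] rY segment_in_ball[OF rb, of w] ball_sub by auto
  qed (rule tl)
  have less: "T r < T z" if z: "z \<in> Q" for z
  proof (rule segment_orientation[OF conn _ Tr])
    show "(r, w) \<in> (\<lambda>z. (r, z)) ` Q" "(r, z) \<in> (\<lambda>z. (r, z)) ` Q" using wQ z by auto
    show "z \<noteq> w \<and> closed_segment z w \<subseteq> Y" if "(z, w) \<in> (\<lambda>z. (r, z)) ` Q" for z w
      using Q[OF P[OF that]] Pz[OF that] seg[OF P[OF that]] by auto
  qed (rule tl)
  \<comment> \<open>The time of \<open>r\<close> would be a positive lower bound for the time along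
    \<open>\<gamma>\<close>.\<close>
  obtain s where "s0 \<le> s" "s < 1" "T (\<gamma> s) < T r" using T_\<gamma>_small[OF T_pos[OF rY]] by blast
  moreover from this have "T r < T (\<gamma> s)" by (intro less) (auto simp: Q_def)
  ultimately show False by simp
qed

text \<open>If time \<open>\<tau>\<close> were never met, the time would stay above
  \<open>\<tau>\<close> as long as the line is in \<open>Y\<close>. Coordinates would then stay
  bounded, the set of admissible parameters would be open and closed in \<open>{0..2}\<close>, and
  the line could not exit.\<close>

lemma line_hits_slice:
  assumes w: "w \<in> cball b \<rho>" and \<tau>: "0 < \<tau>" "\<tau> < T w"
  obtains t where "0 < t" "t < 2" "closed_segment (w - t *\<^sub>R n) w \<subseteq> Y" "T (w - t *\<^sub>R n) = \<tau>"
proof (rule ccontr)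
  assume contr: "\<not> thesis"
  note hit = that
  have wY: "w \<in> Y" using w \<rho>_Y \<rho>_pos by auto
  define S where "S = {0..2} \<inter> {t. closed_segment (w - t *\<^sub>R n) w \<subseteq> Y}"
  have T_ge: "\<tau> \<le> T (w - t *\<^sub>R n)" if t: "t \<in> S" for t
  proof (rule ccontr)
    assume *: "\<not> \<tau> \<le> T (w - t *\<^sub>R n)"
    have t2: "0 \<le> t" "t \<le> 2" and Yt: "closed_segment (w - t *\<^sub>R n) w \<subseteq> Y" using t by (auto simp: S_def)
    have sub: "w - x *\<^sub>R n \<in> Y" if "x \<in> {0..t}" for x
      using line_subsegment[of x t w] that Yt by auto
    have "continuous_on {0..t} (\<lambda>x. T (w - x *\<^sub>R n))"
      by (intro continuous_on_fst continuous_on_compose2[OF cont_F, of _ "\<lambda>x. w - x *\<^sub>R n"] continuous_intros)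
        (use sub in auto)
    then obtain x where x: "0 \<le> x" "x \<le> t" "T (w - x *\<^sub>R n) = \<tau>"
      using IVT2'[of "\<lambda>x. T (w - x *\<^sub>R n)" t \<tau> 0] * \<tau> t2 by auto
    have "x \<noteq> 0" "x \<noteq> t" using x \<tau> * by auto
    moreover have "closed_segment (w - x *\<^sub>R n) w \<subseteq> Y"
      using line_subset[of 0 x t w] x Yt by simp
    ultimately show False using hit[of x] contr x t2 by auto
  qed
  have "openin (top_of_set {0..2}) S"
    unfolding S_def
  proof (rule openin_open_Int)
    have "open ((\<lambda>t. (w - t *\<^sub>R n, w)) -` {q. closed_segment (fst q) (snd q) \<subseteq> Y})"
      by (intro open_vimage open_segment_pairs open_Y continuous_intros)
    then show "open {t. closed_segment (w - t *\<^sub>R n) w \<subseteq> Y}" by (simp add: vimage_def)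
  qed
  moreover have "closedin (top_of_set {0..2}) S"
    unfolding closedin_limpt
  proof (intro conjI allI impI)
    show "S \<subseteq> {0..2}" by (auto simp: S_def)
    fix t assume "t islimpt S \<and> t \<in> {0..2}"
    then have t2: "t \<in> {0..2}" and "t islimpt S" by auto
    then obtain f where f: "\<And>i::nat. f i \<in> S" "f \<longlonglongrightarrow> t"
      unfolding islimpt_sequential by blast
    have "y \<in> Y" if y: "y \<in> closed_segment (w - t *\<^sub>R n) w" for y
    proof -
      obtain u where u: "0 \<le> u" "u \<le> 1" "y = (1 - u) *\<^sub>R (w - t *\<^sub>R n) + u *\<^sub>R w"
        using y by (auto simp: in_segment)
      define x where "x i = (1 - u) *\<^sub>R (w - f i *\<^sub>R n) + u *\<^sub>R w" for i
      have fi: "0 \<le> f i" "f i \<le> 2" "closed_segment (w - f i *\<^sub>R n) w \<subseteq> Y" for i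
        using f(1)[of i] by (auto simp: S_def)
      have xi: "x i \<in> closed_segment w (w - f i *\<^sub>R n)" for i
        using u unfolding x_def closed_segment_commute[of w] by (auto simp: in_segment)
      have segY: "closed_segment w (w - f i *\<^sub>R n) \<subseteq> Y" for i
        using fi(3) by (simp add: closed_segment_commute)
      have tl: "g y' ((w - f i *\<^sub>R n) - w) ((w - f i *\<^sub>R n) - w) < 0"
        if "y' \<in> closed_segment w (w - f i *\<^sub>R n)" "w \<noteq> w - f i *\<^sub>R n" for y' i
        using line_segment_timelike[OF w, of 0 "f i" y'] that fi[of i] by auto
      note le = timelike_segment_le[OF segY tl xi]
      have Tx: "\<tau> \<le> T (x i)" "T (x i) \<le> T w" for i
      proof -
        have a: "\<tau> \<le> T (w - f i *\<^sub>R n)" by (rule T_ge[OF f(1)])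
        have "T (w - f i *\<^sub>R n) \<le> T w"
          using line_T_less[OF w, of "f i"] fi[of i] by (cases "f i = 0") auto
        then show "\<tau> \<le> T (x i)" "T (x i) \<le> T w" using le(1,2)[of i] a by auto
      qed
      have Xx: "\<bar>X (x i) j\<bar> \<le> \<bar>X w j\<bar> + 2 * \<eta> j (T w)" for i j
      proof -
        have "\<eta> j (T (x i)) \<le> \<eta> j (T w)" "0 < \<eta> j (T (x i))"
          using Tx[of i] \<tau> p_less_1 by (auto intro!: horizon_mono horizon_pos)
        then show ?thesis using le(3)[of i j] by linarith
      qed
      have "\<bar>T (x i)\<bar> \<le> T w" for i using Tx[of i] \<tau>(1) by linarith
      then have bd: "bounded (range (\<lambda>i. F (x i)))" using Xx by (rule bounded_F)
      show "y \<in> Y"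
      proof (rule limit_in_Y[OF _ _ _ bd \<tau>(1) Tx(1)])
        show "x i \<in> Y" for i using xi segY by blast
        show "x \<longlonglongrightarrow> y" unfolding x_def u(3) by (intro tendsto_intros f(2))
        have "closed_segment (w - t *\<^sub>R n) w \<subseteq> ball y0 R"
          using segment_in_ball[OF line_in_ball[OF w, of t] line_in_ball[OF w, of 0]] t2 by auto
        then show "y \<in> \<Omega>" using y ball_sub by auto
      qed
    qed
    then show "t \<in> S" using t2 by (auto simp: S_def)
  qed
  ultimately have "S = {} \<or> S = {0..2}"
    using connected_Icc[of 0 "2::real"] unfolding connected_clopen by blast
  moreover have "0 \<in> S" using wY by (simp add: S_def)
  ultimately have "2 \<in> S" by auto
  then show False using line_exits[OF w] by (simp add: S_def)
qed

text \<open>Completing the square: the projection of \<open>d\<close> along the timelike direction \<open>n\<close> has squared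
  length bounded in terms of \<open>d\<close> alone.\<close>

lemma transversal_bound:
  assumes y: "y \<in> ball y0 R"
  shows "g y (d - q *\<^sub>R n) (d - q *\<^sub>R n) \<le> (B + B\<^sup>2 / K) * (norm d)\<^sup>2"
proof -
  note bil = g_bilinear[OF y]
  define N where "N = \<bar>q\<bar> * norm n"
  have "g y (d - q *\<^sub>R n) (d - q *\<^sub>R n) = g y d d - g y d (q *\<^sub>R n) - g y (q *\<^sub>R n) d + q\<^sup>2 * g y n n"
    by (simp add: bilinear_lsub[OF bil] bilinear_rsub[OF bil] bilinear_lmul[OF bil] bilinear_rmul[OF bil]
        power2_eq_square algebra_simps)
  also have "\<dots> \<le> B * (norm d)\<^sup>2 + B * norm d * N + B * norm d * N - K * N\<^sup>2"
  proof -
    have "g y d d \<le> B * (norm d)\<^sup>2" using g_bound[OF y, of d d] by (simp add: power2_eq_square)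
    moreover have "- g y d (q *\<^sub>R n) \<le> B * norm d * N" using g_bound[OF y, of d "q *\<^sub>R n"] by (simp add: N_def)
    moreover have "- g y (q *\<^sub>R n) d \<le> B * norm d * N" using g_bound[OF y, of "q *\<^sub>R n" d] by (simp add: N_def mult_ac)
    moreover have "q\<^sup>2 * g y n n \<le> q\<^sup>2 * (- K * (norm n)\<^sup>2)"
      using cone_timelike[OF y n_cone_k] by (intro mult_left_mono) auto
    moreover have "q\<^sup>2 * (- K * (norm n)\<^sup>2) = - K * N\<^sup>2" by (simp add: N_def power_mult_distrib)
    ultimately show ?thesis by linarith
  qed
  also have "\<dots> \<le> (B + B\<^sup>2 / K) * (norm d)\<^sup>2"
  proof -
    have "0 \<le> K * (N - B * norm d / K)\<^sup>2" using K_pos by simp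
    also have "\<dots> = K * N\<^sup>2 - 2 * (B * norm d * N) + B\<^sup>2 / K * (norm d)\<^sup>2"
      using K_pos by (simp add: power2_eq_square field_simps)
    finally show ?thesis by (simp add: algebra_simps)
  qed
  finally show ?thesis .
qed

text \<open>The lines over the segment from \<open>w0\<close> to \<open>w1\<close> meet the slice in
  a differentiable curve. Its tangents differ from \<open>d\<close> by multiples of
  \<open>n\<close>, so \<open>transversal_bound\<close> limits their length, and
  \<open>kasner_scale_component\<close> turns this into a bound on the \<open>j\<close>-th
  coordinate.\<close>

lemma slice_bound:
  assumes w: "w0 \<in> ball b \<rho>" "w1 \<in> ball b \<rho>"
    and \<tau>: "0 < \<tau>" "\<And>w. w \<in> cball b \<rho> \<Longrightarrow> \<tau> < T w"
    and t0: "0 < t0" "t0 \<le> 2" "closed_segment (w0 - t0 *\<^sub>R n) w0 \<subseteq> Y" "T (w0 - t0 *\<^sub>R n) = \<tau>"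
    and t1: "0 < t1" "t1 \<le> 2" "closed_segment (w1 - t1 *\<^sub>R n) w1 \<subseteq> Y" "T (w1 - t1 *\<^sub>R n) = \<tau>"
  shows "\<bar>X (w1 - t1 *\<^sub>R n) j - X (w0 - t0 *\<^sub>R n) j\<bar>
    \<le> \<tau> powr (- (p $ j)) * sqrt (B + B\<^sup>2 / K) * norm (w1 - w0)"
proof -
  define d where "d = w1 - w0"
  define wv where "wv v = w0 + v *\<^sub>R d" for v :: real
  define pt where "pt q = wv (fst q) - snd q *\<^sub>R n" for q :: "real \<times> real"
  \<comment> \<open>An open parameter domain reaching beyond \<open>v = 0\<close> and
    \<open>v = 1\<close>, so that two-sided derivatives exist there; for this \<open>w0\<close> and
    \<open>w1\<close> lie in the open ball.\<close>
  define Dm where "Dm = {q. wv (fst q) \<in> ball b \<rho> \<and> 0 < snd q \<and> snd q < 2 \<and> closed_segment (pt q) (wv (fst q)) \<subseteq> Y}"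
  define \<Psi> where "\<Psi> q = (fst q, T (pt q))" for q :: "real \<times> real"
  have pt_cont: "continuous_on UNIV pt" and wv_cont: "continuous_on UNIV (\<lambda>q::real \<times> real. wv (fst q))"
    unfolding pt_def wv_def by (intro continuous_intros)+
  have "open ((\<lambda>q. (pt q, wv (fst q))) -` {q. closed_segment (fst q) (snd q) \<subseteq> Y})"
    by (intro open_vimage open_segment_pairs open_Y continuous_on_Pair pt_cont wv_cont)
  moreover have "open ((\<lambda>q::real\<times>real. wv (fst q)) -` ball b \<rho>)"
    by (intro open_vimage open_ball wv_cont)
  moreover have "open {q :: real \<times> real. 0 < snd q}" "open {q :: real \<times> real. snd q < 2}"
    by (intro open_Collect_less continuous_intros)+
  ultimately have "open (((\<lambda>q. (pt q, wv (fst q))) -` {q. closed_segment (fst q) (snd q) \<subseteq> Y}) \<inter>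
    ((\<lambda>q::real\<times>real. wv (fst q)) -` ball b \<rho>) \<inter> ({q. 0 < snd q} \<inter> {q. snd q < 2}))"
    by (intro open_Int)
  moreover have "\<dots> = Dm" by (auto simp: Dm_def)
  ultimately have Dm_open: "open Dm" by simp
  have ptY: "pt q \<in> Y" if "q \<in> Dm" for q using that by (auto simp: Dm_def)
  have pt_ball: "pt q \<in> ball y0 R" if "q \<in> Dm" for q
    using that line_in_ball[of "wv (fst q)" "snd q"] by (auto simp: Dm_def pt_def)
  have \<Psi>_cont: "continuous_on Dm \<Psi>"
    unfolding \<Psi>_def by (intro continuous_on_Pair continuous_on_fst continuous_on_id
        continuous_on_compose2[OF cont_F continuous_on_subset[OF pt_cont]]) (use ptY in auto)
  have \<Psi>_inj: "inj_on \<Psi> Dm"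
  proof (rule inj_onI)
    fix q q' assume q: "q \<in> Dm" "q' \<in> Dm" "\<Psi> q = \<Psi> q'"
    then have f: "fst q = fst q'" and eqT: "T (pt q) = T (pt q')" by (auto simp: \<Psi>_def)
    have ne: "T (pt q2) \<noteq> T (pt q1)" if "q1 \<in> Dm" "q2 \<in> Dm" "fst q1 = fst q2" "snd q1 < snd q2" for q1 q2
      using line_T_neq[of "wv (fst q2)" "snd q1" "snd q2"] that by (auto simp: Dm_def pt_def)
    then have "snd q = snd q'" using q f eqT by (metis linorder_neqE)
    then show "q = q'" using f by (simp add: prod_eq_iff)
  qed
  define G where "G = inv_into Dm \<Psi>"
  \<comment> \<open>The patch provides derivatives of \<open>F\<close> without continuity of
    \<open>F'\<close>, so openness of the image and continuity of the inverse come from invariance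
    of domain; the derivative of \<open>G\<close> then follows pointwise.\<close>
  have im_open: "open (\<Psi> ` Dm)" by (rule invariance_of_domain[OF \<Psi>_cont Dm_open \<Psi>_inj])
  have G_cont: "continuous_on (\<Psi> ` Dm) G"
    unfolding G_def by (rule continuous_on_inverse_open[OF Dm_open \<Psi>_cont]) (use \<Psi>_inj in auto)
  have G: "G q \<in> Dm" "\<Psi> (G q) = q" if "q \<in> \<Psi> ` Dm" for q
    using that unfolding G_def by (auto intro: inv_into_into f_inv_into_f)
  have wv_ball: "wv v \<in> ball b \<rho>" if "v \<in> {0..1}" for v
  proof -
    have "wv v = (1 - v) *\<^sub>R w0 + v *\<^sub>R w1" by (simp add: wv_def d_def algebra_simps)
    then show ?thesis using w convexD[OF convex_ball, of w0 b \<rho> w1 "1 - v" v] that by auto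
  qed
  have \<tau>_im: "(v, \<tau>) \<in> \<Psi> ` Dm" if v: "v \<in> {0..1}" for v
  proof -
    have c: "wv v \<in> cball b \<rho>" using wv_ball[OF v] by auto
    obtain t where "0 < t" "t < 2" "closed_segment (wv v - t *\<^sub>R n) (wv v) \<subseteq> Y" "T (wv v - t *\<^sub>R n) = \<tau>"
      using line_hits_slice[OF c \<tau>(1) \<tau>(2)[OF c]] by blast
    then have "(v, t) \<in> Dm" "\<Psi> (v, t) = (v, \<tau>)" using wv_ball[OF v] by (auto simp: Dm_def \<Psi>_def pt_def)
    then show ?thesis by (metis image_eqI)
  qed
  define P where "P v = pt (G (v, \<tau>))" for v
  have P_eq: "P v = wv v - t *\<^sub>R n"
    if v: "v \<in> {0..1}" and t: "0 < t" "t \<le> 2" "closed_segment (wv v - t *\<^sub>R n) (wv v) \<subseteq> Y" "T (wv v - t *\<^sub>R n) = \<tau>" for v t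
  proof -
    \<comment> \<open>The domain requires a parameter strictly below \<open>2\<close>; no line
      remains in \<open>Y\<close> up to \<open>2\<close>.\<close>
    have "t \<noteq> 2" using line_exits[of "wv v"] wv_ball[OF v] t(3) by auto
    then have "(v, t) \<in> Dm" "\<Psi> (v, t) = (v, \<tau>)" using wv_ball[OF v] t by (auto simp: Dm_def \<Psi>_def pt_def)
    then have "G (v, \<tau>) = (v, t)" unfolding G_def using \<Psi>_inj by (metis inv_into_f_f)
    then show ?thesis by (simp add: P_def pt_def)
  qed
  define H where "H v = X (P v) j" for v
  have H_deriv: "\<exists>H'. (H has_vector_derivative H') (at v) \<and> norm H' \<le> \<tau> powr (- (p $ j)) * sqrt (B + B\<^sup>2 / K) * norm d"
    if v: "v \<in> {0..1}" for v
  proof -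
    define q where "q = G (v, \<tau>)"
    have q: "q \<in> Dm" "\<Psi> q = (v, \<tau>)" using G[OF \<tau>_im[OF v]] by (auto simp: q_def)
    define y where "y = pt q"
    have y: "y \<in> Y" "y \<in> ball y0 R" "T y = \<tau>" "fst q = v"
      using ptY[OF q(1)] pt_ball[OF q(1)] q(2) by (auto simp: y_def \<Psi>_def)
    have lin: "linear (F' y)" using F_deriv[OF y(1)] has_derivative_linear by blast
    define Tn where "Tn = fst (F' y n)"
    define Td where "Td = fst (F' y d)"
    have "kasner_g p (F y) (F' y n) (F' y n) < 0"
      using iso_F[OF y(1)] cone_neg[OF y(2) n_cone_k n_neq] by simp
    then have Tn: "Tn \<noteq> 0" unfolding Tn_def using kasner_timelike_fst[of "F y"] T_pos[OF y(1)] by blast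
    have pt_der: "(pt has_derivative (\<lambda>h. fst h *\<^sub>R d - snd h *\<^sub>R n)) (at q)"
      unfolding pt_def wv_def by (auto intro!: derivative_eq_intros)
    have Fpt_der: "((\<lambda>q. F (pt q)) has_derivative (\<lambda>h. F' y (fst h *\<^sub>R d - snd h *\<^sub>R n))) (at q)"
      using diff_chain_at[OF pt_der F_deriv[OF y(1)[unfolded y_def]]] by (simp add: o_def y_def)
    have lin_eq: "F' y (a *\<^sub>R d - c *\<^sub>R n) = a *\<^sub>R F' y d - c *\<^sub>R F' y n" for a c
      by (simp add: linear_diff[OF lin] linear_cmul[OF lin])
    have \<Psi>_der: "(\<Psi> has_derivative (\<lambda>h. (fst h, fst h * Td - snd h * Tn))) (at q)"
    proof -
      have "((\<lambda>q. (fst q, fst (F (pt q)))) has_derivative (\<lambda>h. (fst h, fst (F' y (fst h *\<^sub>R d - snd h *\<^sub>R n))))) (at q)"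
        by (intro has_derivative_Pair has_derivative_fst Fpt_der has_derivative_ident)
      then show ?thesis by (simp add: \<Psi>_def[abs_def] lin_eq Td_def Tn_def)
    qed
    \<comment> \<open>The inverse of the triangular derivative of \<open>\<Psi>\<close>; it exists
      because the timelike \<open>n\<close> has nonzero time component \<open>Tn\<close>.\<close>
    define G' where "G' h = (fst h, (fst h * Td - snd h) / Tn)" for h :: "real \<times> real"
    have G_der: "(G has_derivative G') (at (v, \<tau>))"
    proof (rule has_derivative_inverse_basic)
      show "(\<Psi> has_derivative (\<lambda>h. (fst h, fst h * Td - snd h * Tn))) (at (G (v, \<tau>)))"
        using \<Psi>_der by (simp add: q_def)
      have "linear G'" unfolding G'_def by (rule linearI) (auto simp: algebra_simps add_divide_distrib diff_divide_distrib)
      then show "bounded_linear G'" by (simp add: linear_conv_bounded_linear)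
      show "G' \<circ> (\<lambda>h. (fst h, fst h * Td - snd h * Tn)) = id"
        using Tn by (auto simp: G'_def fun_eq_iff)
      show "isCont G (v, \<tau>)"
        using G_cont im_open \<tau>_im[OF v] continuous_on_eq_continuous_at by blast
    qed (fact im_open \<tau>_im[OF v] G(2))+
    have "((\<lambda>v. (v, \<tau>)) has_derivative (\<lambda>h. (h, 0))) (at v)"
      by (intro has_derivative_Pair has_derivative_ident has_derivative_const)
    from diff_chain_at[OF this G_der] have "((\<lambda>v. G (v, \<tau>)) has_derivative (\<lambda>h. (h, h * Td / Tn))) (at v)"
      by (simp add: o_def G'_def)
    from diff_chain_at[OF this Fpt_der[unfolded q_def]]
    have "((\<lambda>v. F (P v)) has_derivative (\<lambda>h. h *\<^sub>R F' y (d - (Td / Tn) *\<^sub>R n))) (at v)"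
      by (simp add: o_def P_def lin_eq linear_diff[OF lin] linear_cmul[OF lin] scaleR_diff_right)
    then have FP: "((\<lambda>v. F (P v)) has_vector_derivative F' y (d - (Td / Tn) *\<^sub>R n)) (at v)"
      by (simp add: has_vector_derivative_def)
    \<comment> \<open>This multiple of \<open>n\<close> cancels the time component of
      \<open>d\<close>, so \<open>e\<close> is tangent to the slice.\<close>
    define e where "e = d - (Td / Tn) *\<^sub>R n"
    have "(H has_vector_derivative snd (F' y e) $ j) (at v)"
      unfolding H_def[abs_def] e_def
      by (intro bounded_linear.has_vector_derivative[OF bounded_linear_vec_nth]
          bounded_linear.has_vector_derivative[OF bounded_linear_snd] FP)
    moreover have "norm (snd (F' y e) $ j) \<le> \<tau> powr (- (p $ j)) * sqrt (B + B\<^sup>2 / K) * norm d"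
    proof -
      have fst0: "fst (F' y e) = 0"
        using Tn by (simp add: e_def linear_diff[OF lin] linear_cmul[OF lin] Td_def Tn_def)
      have "(norm (kasner_scale p \<tau> (snd (F' y e))))\<^sup>2 = g y e e"
        using kasner_g_eq[of "F y" p "F' y e"] T_pos[OF y(1)] iso_F[OF y(1), of e] fst0 y(3) by simp
      also have "\<dots> \<le> (B + B\<^sup>2 / K) * (norm d)\<^sup>2" unfolding e_def by (rule transversal_bound[OF y(2)])
      finally have "norm (kasner_scale p \<tau> (snd (F' y e))) \<le> sqrt ((B + B\<^sup>2 / K) * (norm d)\<^sup>2)"
        by (rule real_le_rsqrt)
      also have "\<dots> = sqrt (B + B\<^sup>2 / K) * norm d" by (simp add: real_sqrt_mult)
      finally have "\<tau> powr (- (p $ j)) * norm (kasner_scale p \<tau> (snd (F' y e)))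
          \<le> \<tau> powr (- (p $ j)) * (sqrt (B + B\<^sup>2 / K) * norm d)"
        by (intro mult_left_mono) auto
      then show ?thesis
        using kasner_scale_component[OF \<tau>(1), of "snd (F' y e)" j p] by (simp add: mult.assoc)
    qed
    ultimately show ?thesis by blast
  qed
  then obtain H' where H': "\<And>v. v \<in> {0..1} \<Longrightarrow> (H has_vector_derivative H' v) (at v)"
      "\<And>v. v \<in> {0..1} \<Longrightarrow> norm (H' v) \<le> \<tau> powr (- (p $ j)) * sqrt (B + B\<^sup>2 / K) * norm d"
    by metis
  define c where "c = \<tau> powr (- (p $ j)) * sqrt (B + B\<^sup>2 / K) * norm d"
  have "norm (H 1 - H 0) \<le> c * 1 - c * 0"
  proof (rule differentiable_bound_general[where \<phi> = "\<lambda>v. c * v" and \<phi>' = "\<lambda>_. c" and f' = H'])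
    show "continuous_on {0..1} H"
      using H'(1) by (meson continuous_at_imp_continuous_on has_vector_derivative_continuous)
    show "((\<lambda>v. c * v) has_vector_derivative c) (at x)" for x
      by (auto intro!: derivative_eq_intros)
  qed (use H' in \<open>auto simp: c_def intro!: continuous_intros\<close>)
  moreover have "P 1 = w1 - t1 *\<^sub>R n" "P 0 = w0 - t0 *\<^sub>R n"
    using P_eq[of 1 t1] P_eq[of 0 t0] t0 t1 by (auto simp: wv_def d_def)
  ultimately show ?thesis by (simp add: H_def c_def d_def)
qed

text \<open>Translating the chord from \<open>b'\<close> through a connected set exhibits each point
  of \<open>Z\<close> as the point with parameter \<open>1\<close> on a line issuing from the ball
  around \<open>b\<close>.\<close>

lemma line_up:
  assumes conn: "connected Z" and b': "b' \<in> Z"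
    and Z: "\<And>z. z \<in> Z \<Longrightarrow> z \<in> Y \<and> norm (z - b') \<le> \<rho>" and z: "z \<in> Z"
  shows "closed_segment z (z + n) \<subseteq> Y"
proof (rule segment_continuation)
  let ?P = "(\<lambda>z. (z, z + n)) ` Z"
  show "connected ?P" using conn by (intro connected_continuous_image continuous_intros)
  show "(b', b' + n) \<in> ?P" "(z, z + n) \<in> ?P" using b' z by auto
  show "closed_segment (fst (b', b' + n)) (snd (b', b' + n)) \<subseteq> Y"
    using \<gamma>_segment[of s1] s1 by (simp add: n_def b_def b'_def)
  have P: "w \<in> cball b \<rho> \<and> z \<in> Y \<and> z = w - 1 *\<^sub>R n" if zw: "(z, w) \<in> ?P" for z w
  proof -
    have w: "w = z + n" "z \<in> Z" using zw by auto
    then have "norm (w - b) = norm (z - b')" by (simp add: n_def)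
    then show ?thesis using w Z[of z] by (simp add: mem_cball dist_norm norm_minus_commute[of b])
  qed
  show "z \<in> Y \<and> w \<in> Y \<and> closed_segment z w \<subseteq> \<Omega>" if "(z, w) \<in> ?P" for z w
  proof -
    have w: "w \<in> cball b \<rho>" and "z \<in> Y" and z: "z = w - 1 *\<^sub>R n" using P[OF that] by auto
    moreover have "w \<in> Y" using w \<rho>_Y \<rho>_pos by auto
    moreover have "closed_segment z w \<subseteq> ball y0 R"
      using segment_in_ball[OF line_in_ball[OF w, of 1] line_in_ball[OF w, of 0]] z by simp
    ultimately show ?thesis using ball_sub by blast
  qed
  show "g y (w - z) (w - z) < 0" if "(z, w) \<in> ?P" "y \<in> closed_segment z w" for z w y
    using line_segment_timelike[of w 1 0 y] P[OF that(1)] that(2) by auto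
qed

end

context kasner_past_curve
begin

text \<open>The point \<open>zh\<close> lies on the boundary of the horizon of the ideal end point \<open>x0\<close> of \<open>\<gamma>\<close> in the
  expanding direction \<open>j\<close>. The line through \<open>zh\<close> ends at an ideal point whose \<open>j\<close>-th coordinate is
  again that of \<open>x0\<close>, because distances in the slices of constant Kasner time blow up in
  direction \<open>j\<close>. But a timelike line ends strictly inside the horizon.\<close>

lemma no_past_curve:
  assumes j: "p $ j < 0"
  shows False
proof -
  obtain x0 :: "real ^ 'n" where x0: "\<And>s i. s0 \<le> s \<Longrightarrow> s < 1 \<Longrightarrow> \<bar>X (\<gamma> s) i - x0 $ i\<bar> \<le> \<eta> i (T (\<gamma> s))"
    using X_\<gamma>_limit by blast
  define b where "b = \<gamma> s0"
  define c0 where "c0 = (k / 2) / (norm n0 + k / 2)"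
  define \<beta> where "\<beta> = norm (b - y0)"
  define \<kappa> where "\<kappa> = 1 + 2 * C * L"
  have bY: "b \<in> Y" using \<gamma>_Y s0_less by (simp add: b_def)
  have c0: "0 < c0" "c0 \<le> 1" using k_pos k_less by (auto simp: c0_def)
  have \<beta>: "\<beta> > 0" using bY y0_notin by (auto simp: \<beta>_def)
  have \<kappa>: "\<kappa> \<ge> 1" using C_pos L_pos by (simp add: \<kappa>_def)
  obtain r0 where r0: "r0 > 0" "cball b r0 \<subseteq> Y" using open_Y bY open_contains_cball by blast
  \<comment> \<open>\<open>r0 / 2\<close> keeps the doubled ball in \<open>Y\<close>;
    \<open>c0 * \<beta> / 4\<close> yields the perturbation condition of
    \<open>kasner_lines\<close>, as the chord turns out to have length at least
    \<open>\<beta> / 2\<close>.\<close>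
  define \<rho> where "\<rho> = min (r0 / 2) (min (R / 10) (c0 * \<beta> / 4))"
  have \<rho>: "\<rho> > 0" "2 * \<rho> \<le> r0" "\<rho> \<le> R / 10" "\<rho> \<le> c0 * \<beta> / 4"
    using r0(1) R_pos mult_pos_pos[OF c0(1) \<beta>] unfolding \<rho>_def by linarith+
  \<comment> \<open>Chosen so that \<open>\<kappa> * \<epsilon> + \<epsilon> = \<rho> / 2\<close>:
    points within \<open>\<kappa> * \<epsilon>\<close> of \<open>y0\<close> are then within
    \<open>\<rho>\<close> of \<open>b'\<close>, even after the growth factor \<open>\<kappa>\<close>
    of the deformation.\<close>
  define \<epsilon> where "\<epsilon> = \<rho> / 2 / (\<kappa> + 1)"
  have \<epsilon>_pos: "\<epsilon> > 0" using \<rho> \<kappa> by (simp add: \<epsilon>_def)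
  have \<epsilon>_\<kappa>: "\<kappa> * \<epsilon> + \<epsilon> = \<rho> / 2" 
  proof -
    have "\<kappa> + 1 \<noteq> 0" using \<kappa> by simp
    then have "\<epsilon> * (\<kappa> + 1) = \<rho> / 2"
      using nonzero_eq_divide_eq[of "\<kappa> + 1" \<epsilon> "\<rho> / 2"] \<epsilon>_def by blast
    then show ?thesis by (simp add: distrib_left mult.commute)
  qed
  have "1 * \<epsilon> \<le> \<kappa> * \<epsilon>" using \<kappa> \<epsilon>_pos by (intro mult_right_mono) auto
  then have \<epsilon>_le: "\<epsilon> \<le> \<kappa> * \<epsilon>" "\<kappa> * \<epsilon> < \<rho>" "\<epsilon> < \<rho>" using \<epsilon>_\<kappa> \<epsilon>_pos \<rho>(1) by linarith+
  obtain \<delta> where \<delta>: "\<delta> > 0" "\<And>s. s \<in> {s0..1} \<Longrightarrow> dist s 1 < \<delta> \<Longrightarrow> dist (\<gamma> s) (\<gamma> 1) < \<epsilon> / 2"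
    using \<gamma>_cont \<epsilon>_pos s0_less unfolding continuous_on_iff
    by (metis atLeastAtMost_iff half_gt_zero less_imp_le order_refl)
  define s1 where "s1 = max ((s0 + 1) / 2) (1 - \<delta> / 2)"
  have s1: "s0 < s1" "s1 < 1" using s0_less \<delta>(1) by (auto simp: s1_def max_def)
  have near: "norm (\<gamma> s - y0) < \<epsilon> / 2" if "s1 \<le> s" "s \<le> 1" for s
  proof -
    have "dist s 1 < \<delta>" using that \<delta>(1) by (auto simp: s1_def dist_real_def)
    then show ?thesis using \<delta>(2)[of s] that s1 \<gamma>_end by (auto simp: dist_norm)
  qed
  define b' where "b' = \<gamma> s1"
  define n where "n = b - b'"
  have b'_near: "norm (b' - y0) < \<epsilon> / 2" using near[of s1] s1 by (simp add: b'_def)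
  have b'Y: "b' \<in> Y" using \<gamma>_Y s1 by (simp add: b'_def)
  have "\<beta> \<le> norm n + norm (b' - y0)"
    using norm_triangle_ineq[of n "b' - y0"] by (simp add: n_def \<beta>_def)
  moreover have "\<epsilon> \<le> \<beta> / 4"
  proof -
    have "c0 * \<beta> \<le> 1 * \<beta>" using c0(2) \<beta> by (intro mult_right_mono) auto
    then show ?thesis using \<rho>(4) \<epsilon>_le(3) by linarith
  qed
  ultimately have n_ge: "norm n \<ge> \<beta> / 2" using b'_near \<epsilon>_pos \<beta> by linarith
  have "\<rho> + norm (b' - y0) \<le> 2 * \<rho>" using b'_near \<epsilon>_le(3) \<epsilon>_pos by linarith
  also have "\<dots> \<le> c0 * (\<beta> / 2)" using \<rho>(4) by simp
  also have "\<dots> \<le> c0 * norm n" using n_ge c0 by (intro mult_left_mono) auto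
  finally have \<rho>_cone: "\<rho> + norm (b' - y0) \<le> (k / 2) / (norm n0 + k / 2) * norm n" by (simp add: c0_def)
  have "cball b (2 * \<rho>) \<subseteq> cball b r0" using \<rho>(2) by auto
  then interpret kl: kasner_lines p \<Omega> Y D E F E' F' g y0 n0 R C L k K B s0 l \<gamma> \<gamma>' s1 \<rho> n b b'
    using s1 \<rho> \<rho>_cone r0(2) by unfold_locales (auto simp: b_def b'_def n_def)
  have Fb': "F b' \<in> D" "E (F b') = b'" using F_in EF b'Y by auto
  obtain e1 where e1: "e1 > 0" "ball (F b') e1 \<subseteq> D" using open_D Fb'(1) open_contains_ball by blast
  obtain e2 where e2: "e2 > 0" "\<And>m. dist m (F b') < e2 \<Longrightarrow> dist (E m) (E (F b')) < \<epsilon> / 2"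
    using isCont_E[OF Fb'(1)] \<epsilon>_pos unfolding continuous_at_eps_delta by (metis half_gt_zero)
  define e where "e = min e1 e2"
  have e: "e > 0" using e1 e2 by (simp add: e_def)
  have near_b': "(T b', snd (F b') + v) \<in> D \<and> norm (E (T b', snd (F b') + v) - y0) \<le> \<epsilon>" if "norm v < e" for v
  proof -
    have "dist (T b', snd (F b') + v) (F b') = norm v"
      by (cases "F b'") (simp add: dist_Pair_Pair dist_norm)
    then have "(T b', snd (F b') + v) \<in> ball (F b') e1" "dist (E (T b', snd (F b') + v)) b' < \<epsilon> / 2"
      using e2(2)[of "(T b', snd (F b') + v)"] that Fb'(2) by (auto simp: e_def dist_commute)
    moreover have "norm (E (T b', snd (F b') + v) - y0) \<le> norm (E (T b', snd (F b') + v) - b') + norm (b' - y0)"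
      using norm_triangle_ineq[of "E (T b', snd (F b') + v) - b'" "b' - y0"] by simp
    ultimately show ?thesis using e1(2) b'_near by (auto simp: dist_norm)
  qed
  \<comment> \<open>The translation carrying \<open>\<gamma> h\<close> to the boundary of the
    horizon of \<open>x0\<close> in direction \<open>j\<close>; its size tends to \<open>0\<close>
    with the time of \<open>\<gamma> h\<close>.\<close>
  define dh where "dh h = x0 + axis j (\<eta> j (T (\<gamma> h))) - snd (F (\<gamma> h))" for h
  have dh_le: "norm (dh h) \<le> (\<Sum>i\<in>UNIV. 2 * \<eta> i (T (\<gamma> h)))" if h: "s0 \<le> h" "h < 1" for h
  proof -
    have "\<bar>dh h $ i\<bar> \<le> 2 * \<eta> i (T (\<gamma> h))" for i
    proof -
      have "0 < \<eta> i (T (\<gamma> h))" using T_pos[OF \<gamma>_Y, of h] h p_less_1 by (auto intro!: horizon_pos)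
      then show ?thesis using x0[OF h, of i] by (auto simp: dh_def axis_def)
    qed
    then show ?thesis by (intro order_trans[OF norm_le_l1_cart] sum_mono) auto
  qed
  have "(\<lambda>i. \<Sum>a\<in>UNIV. 2 * \<eta> a (T (\<gamma> (sk i)))) \<longlonglongrightarrow> (\<Sum>a\<in>(UNIV :: 'n set). 2 * 0)"
    by (intro tendsto_sum tendsto_mult tendsto_const \<eta>_\<gamma>_sk)
  then have "\<forall>\<^sub>F i in sequentially. (\<Sum>a\<in>UNIV. 2 * \<eta> a (T (\<gamma> (sk i)))) < e \<and> s1 < sk i"
    using e s1(2) by (intro eventually_conj order_tendstoD(1)[OF sk(2)] order_tendstoD(2)) auto
  then obtain i0 where i0: "(\<Sum>a\<in>UNIV. 2 * \<eta> a (T (\<gamma> (sk i0)))) < e" "s1 < sk i0"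
    by (auto simp: eventually_sequentially)
  define h where "h = sk i0"
  have h: "s1 \<le> h" "h < 1" "s0 \<le> h" using i0(2) sk(1)[of i0] s1 by (auto simp: h_def)
  define d where "d = dh h"
  have d_e: "norm d < e" using dh_le[OF h(3,2)] i0(1) by (simp add: d_def h_def)
  have \<kappa>R: "(1 + 2 * C * L) * \<epsilon> < R" using \<epsilon>_le(2) \<rho>(3) R_pos by (simp add: \<kappa>_def)
  have top: "norm (E (T (\<gamma> s1), snd (F (\<gamma> s1)) + v) - y0) \<le> \<epsilon>" if "norm v < e" for v
    using near_b'[OF that] by (simp add: b'_def)
  have bot: "norm (\<gamma> s - y0) \<le> \<epsilon>" if "h \<le> s" "s < 1" for s
    using near[of s] that h \<epsilon>_pos by simp
  define tr where "tr s = (T (\<gamma> s), snd (F (\<gamma> s)) + d)" for s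
  have tr: "tr s \<in> D" "norm (E (tr s) - y0) \<le> \<kappa> * \<epsilon>" if "s \<in> {s1..h}" for s
    unfolding tr_def \<kappa>_def
    by (rule translated_curve_in_patch[OF x0 s1(1) h(1,2) _ d_e top bot \<kappa>R that];
        (simp add: d_def dh_def)?)+
  define br where "br u = (T b', snd (F b') + u *\<^sub>R d)" for u :: real
  have br: "br u \<in> D" "norm (E (br u) - y0) \<le> \<epsilon>" if "u \<in> {0..1}" for u
  proof -
    have "norm (u *\<^sub>R d) \<le> 1 * norm d"
      unfolding norm_scaleR using that by (intro mult_right_mono) auto
    then show "br u \<in> D" "norm (E (br u) - y0) \<le> \<epsilon>"
      using near_b'[of "u *\<^sub>R d"] d_e by (auto simp: br_def)
  qed
  \<comment> \<open>Three connected pieces lead from \<open>\<gamma>\<close> to the point on the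
    horizon: late points of \<open>\<gamma>\<close>, a translation of \<open>b'\<close> at fixed
    time, and the translated curve down to \<open>h\<close>. \<open>line_up\<close> needs this
    connection to \<open>b'\<close>.\<close>
  define Z where "Z = \<gamma> ` {s1..<1} \<union> (\<lambda>u. E (br u)) ` {0..1} \<union> (\<lambda>s. E (tr s)) ` {s1..h}"
  have conn_br: "connected ((\<lambda>u. E (br u)) ` {0..1})"
  proof (rule connected_continuous_image)
    have "continuous_on {0..1} br" unfolding br_def by (intro continuous_intros)
    then show "continuous_on {0..1} (\<lambda>u. E (br u))"
      by (rule continuous_on_compose2[OF cont_E]) (use br(1) in auto)
  qed simp
  have conn_tr: "connected ((\<lambda>s. E (tr s)) ` {s1..h})"
  proof (rule connected_continuous_image)
    have "continuous_on {s1..h} tr"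
      unfolding tr_def
      by (intro continuous_on_Pair continuous_on_fst continuous_on_add continuous_on_snd continuous_on_const
          continuous_on_subset[OF continuous_F_\<gamma>]) (use h s1 in auto)
    then show "continuous_on {s1..h} (\<lambda>s. E (tr s))"
      by (rule continuous_on_compose2[OF cont_E]) (use tr(1) in auto)
  qed simp
  have conn_\<gamma>: "connected (\<gamma> ` {s1..<1})"
    using s1 by (intro connected_continuous_image continuous_on_subset[OF \<gamma>_cont]) auto
  have "E (br 0) = b'" using Fb' by (simp add: br_def)
  then have b'1: "b' \<in> \<gamma> ` {s1..<1}" "b' \<in> (\<lambda>u. E (br u)) ` {0..1}"
    using imageI[of 0 "{0..1::real}" "\<lambda>u. E (br u)"] s1 by (auto simp: b'_def)
  have "E (br 1) = E (tr s1)" by (simp add: br_def tr_def b'_def)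
  then have b'2: "E (tr s1) \<in> (\<lambda>u. E (br u)) ` {0..1}" "E (tr s1) \<in> (\<lambda>s. E (tr s)) ` {s1..h}"
    using imageI[of 1 "{0..1::real}" "\<lambda>u. E (br u)"] h by auto
  have connZ: "connected Z"
    unfolding Z_def
    by (intro connected_Un conn_\<gamma> conn_br conn_tr) (use b'1 b'2 in blast)+
  have Z: "z \<in> Y \<and> norm (z - y0) \<le> \<kappa> * \<epsilon>" if "z \<in> Z" for z
    using that unfolding Z_def
  proof (elim UnE imageE)
    fix s assume "z = \<gamma> s" "s \<in> {s1..<1}"
    then have "z \<in> Y" "norm (z - y0) < \<epsilon> / 2" using near[of s] \<gamma>_Y[of s] s1 by auto
    then show ?thesis using \<epsilon>_pos \<epsilon>_le(1) by linarith
  next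
    fix u :: real assume "z = E (br u)" "u \<in> {0..1}"
    then have "z \<in> Y" "norm (z - y0) \<le> \<epsilon>" using br[of u] E_in by auto
    then show ?thesis using \<epsilon>_le(1) by linarith
  next
    fix s assume "z = E (tr s)" "s \<in> {s1..h}"
    then show ?thesis using tr[of s] E_in by auto
  qed
  have Z': "z \<in> Y \<and> norm (z - b') < \<rho>" if "z \<in> Z" for z
  proof -
    have "norm (z - b') \<le> norm (z - y0) + norm (b' - y0)"
      using norm_triangle_ineq4[of "z - y0" "b' - y0"] by simp
    then show ?thesis using Z[OF that] b'_near \<epsilon>_\<kappa> \<epsilon>_pos \<rho>(1) by linarith
  qed
  have up: "closed_segment z (z + n) \<subseteq> Y" if "z \<in> Z" for z
    by (rule kl.line_up[OF connZ _ _ that]) (use b'1 Z' in \<open>auto simp: Z_def less_imp_le\<close>)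
  have top_ball: "z + n \<in> ball b \<rho>" if "z \<in> Z" for z
  proof -
    have "norm (z + n - b) = norm (z - b')" by (simp add: n_def)
    then show ?thesis using Z'[OF that] by (simp add: mem_ball dist_norm norm_minus_commute[of b])
  qed
  define zh where "zh = E (tr h)"
  have zhZ: "zh \<in> Z" using h by (auto simp: zh_def Z_def)
  have Fzh: "F zh = tr h" using FE tr(1)[of h] h by (simp add: zh_def)
  define th where "th = T (\<gamma> h)"
  have th: "T zh = th" "X zh j = x0 $ j + \<eta> j th" "th > 0"
    using T_pos[OF \<gamma>_Y, of h] h by (auto simp: Fzh tr_def th_def d_def dh_def axis_def)
  define w1 where "w1 = zh + n"
  have w1: "w1 \<in> ball b \<rho>" "w1 \<in> cball b \<rho>" using top_ball[OF zhZ] by (auto simp: w1_def)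
  have zh_seg: "closed_segment (w1 - 1 *\<^sub>R n) w1 \<subseteq> Y" using up[OF zhZ] by (simp add: w1_def)
  have zh_w1: "w1 - 1 *\<^sub>R n = zh" by (simp add: w1_def)
  have T_w1: "th < T w1" using kl.line_T_less[OF w1(2) _ _ zh_seg] th(1) unfolding zh_w1 by simp
  have down: "\<exists>t. 1 < t \<and> t < 2 \<and> closed_segment (w1 - t *\<^sub>R n) w1 \<subseteq> Y \<and> T (w1 - t *\<^sub>R n) = \<tau>"
    if \<tau>: "0 < \<tau>" "\<tau> < th" for \<tau>
  proof -
    obtain t where t: "0 < t" "t < 2" "closed_segment (w1 - t *\<^sub>R n) w1 \<subseteq> Y" "T (w1 - t *\<^sub>R n) = \<tau>"
      using kl.line_hits_slice[OF w1(2) \<tau>(1), of thesis] \<tau>(2) T_w1 by force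
    \<comment> \<open>Between its upper end and \<open>zh\<close> the line has time at least
      \<open>th\<close>, so a smaller time is met only beyond \<open>zh\<close>.\<close>
    have "1 < t"
    proof (rule ccontr)
      assume "\<not> 1 < t"
      moreover have "t \<noteq> 1" using t(4) zh_w1 th(1) \<tau> by auto
      ultimately have t1: "t < 1" by simp
      have seg: "closed_segment zh w1 \<subseteq> Y" using zh_seg unfolding zh_w1 .
      have mem: "w1 - t *\<^sub>R n \<in> closed_segment zh w1"
        using kl.line_subsegment[of t 1 w1] t(1) t1 unfolding zh_w1 by simp
      have tl: "g y (w1 - zh) (w1 - zh) < 0" if "y \<in> closed_segment zh w1" for y
        using kl.line_segment_timelike[OF w1(2), of 1 0 y] that unfolding zh_w1 by simp
      have "min (T zh) (T w1) \<le> T (w1 - t *\<^sub>R n)"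
        by (rule timelike_segment_le(1)[OF seg _ mem]) (rule tl)
      then show False using th(1) t(4) \<tau>(2) T_w1 by simp
    qed
    then show ?thesis using t by blast
  qed
  \<comment> \<open>Any fixed time strictly between \<open>0\<close> and \<open>th\<close> serves.
    The strict inequality between \<open>zh\<close> and this time gives a gap independent of the
    later slice.\<close>
  define t2 where "t2 = th / 2"
  have t2: "0 < t2" "t2 < th" using th(3) by (auto simp: t2_def)
  obtain l2 where l2: "1 < l2" "l2 < 2" "closed_segment (w1 - l2 *\<^sub>R n) w1 \<subseteq> Y" "T (w1 - l2 *\<^sub>R n) = t2"
    using down[OF t2] by blast
  define y2 where "y2 = w1 - l2 *\<^sub>R n"
  have line_X: "\<bar>X (w1 - c *\<^sub>R n) j - X (w1 - a *\<^sub>R n) j\<bar> < \<bar>\<eta> j (T (w1 - c *\<^sub>R n)) - \<eta> j (T (w1 - a *\<^sub>R n))\<bar>"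
    if ac: "0 \<le> a" "a \<noteq> c" "0 \<le> c" "a \<le> m" "c \<le> m" "m \<le> 2" "closed_segment (w1 - m *\<^sub>R n) w1 \<subseteq> Y" for a c m
  proof (rule timelike_segment(2))
    have "closed_segment (w1 - a *\<^sub>R n) (w1 - c *\<^sub>R n) \<subseteq> closed_segment (w1 - m *\<^sub>R n) w1"
      using ac by (simp add: subset_closed_segment kl.line_subsegment)
    then show "closed_segment (w1 - a *\<^sub>R n) (w1 - c *\<^sub>R n) \<subseteq> Y" using ac(7) by blast
    show "w1 - a *\<^sub>R n \<noteq> w1 - c *\<^sub>R n" using ac(2) kl.n_neq by simp
    show "g y (w1 - c *\<^sub>R n - (w1 - a *\<^sub>R n)) (w1 - c *\<^sub>R n - (w1 - a *\<^sub>R n)) < 0"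
      if "y \<in> closed_segment (w1 - a *\<^sub>R n) (w1 - c *\<^sub>R n)" for y
      using kl.line_segment_timelike[OF w1(2), of a c y] that ac by auto
  qed
  have "\<eta> j t2 < \<eta> j th" using t2 p_less_1 by (intro horizon_strict_mono) auto
  moreover have "\<bar>X zh j - X y2 j\<bar> < \<bar>\<eta> j (T zh) - \<eta> j (T y2)\<bar>"
    using line_X[of l2 1 l2] l2 by (simp add: y2_def w1_def)
  ultimately have gap: "\<bar>X zh j - X y2 j\<bar> < \<eta> j th - \<eta> j t2"
    using l2(4) th(1) by (simp add: y2_def)
  have ne: "cball b \<rho> \<noteq> {}" using \<rho> by auto
  have contT: "continuous_on (cball b \<rho>) (\<lambda>w. T w)"
    by (intro continuous_on_fst continuous_on_subset[OF cont_F] order_trans[OF _ kl.\<rho>_Y]) (use \<rho>(1) in auto)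
  \<comment> \<open>A positive minimum of the time on the closed ball; every line issuing from the
    ball crosses each slice below it.\<close>
  obtain wm where wm: "wm \<in> cball b \<rho>" "\<And>w. w \<in> cball b \<rho> \<Longrightarrow> T wm \<le> T w"
    using continuous_attains_inf[OF compact_cball ne contT] by auto
  have "wm \<in> cball b (2 * \<rho>)" using wm(1) \<rho>(1) by auto
  then have Twm: "T wm > 0" using T_pos kl.\<rho>_Y by blast
  define A where "A = sqrt (B + B\<^sup>2 / K) * (2 * \<rho>)"
  \<comment> \<open>The chain runs from \<open>x0\<close> to \<open>\<gamma> s\<close> by
    convergence, to \<open>y1\<close> inside the slice, to \<open>y2\<close> along the line, and
    finally to \<open>zh\<close>, whose distance from \<open>x0\<close> in coordinate
    \<open>j\<close> is exactly the horizon at \<open>th\<close>.\<close>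
  have bound: "\<eta> j th \<le> \<bar>X zh j - X y2 j\<bar> + \<eta> j t2 + T (\<gamma> s) powr (- (p $ j)) * A + \<eta> j (T (\<gamma> s))"
    if s: "s1 \<le> s" "s < 1" and Ts: "T (\<gamma> s) < t2" "T (\<gamma> s) < T wm" for s
  proof -
    define \<tau> where "\<tau> = T (\<gamma> s)"
    have sZ: "\<gamma> s \<in> Z" using s by (auto simp: Z_def)
    have \<tau>: "\<tau> > 0" using T_pos Z'[OF sZ] by (simp add: \<tau>_def)
    define w0 where "w0 = \<gamma> s + n"
    have w0: "w0 \<in> ball b \<rho>" using top_ball[OF sZ] by (simp add: w0_def)
    have w0_seg: "closed_segment (w0 - 1 *\<^sub>R n) w0 \<subseteq> Y" using up[OF sZ] by (simp add: w0_def)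
    obtain t where t: "1 < t" "t < 2" "closed_segment (w1 - t *\<^sub>R n) w1 \<subseteq> Y" "T (w1 - t *\<^sub>R n) = \<tau>"
      using down[OF \<tau>] Ts t2 by (auto simp: \<tau>_def)
    define y1 where "y1 = w1 - t *\<^sub>R n"
    have "\<bar>X y1 j - X (w0 - 1 *\<^sub>R n) j\<bar> \<le> \<tau> powr (- (p $ j)) * sqrt (B + B\<^sup>2 / K) * norm (w1 - w0)"
      unfolding y1_def
    proof (rule kl.slice_bound[OF w0 w1(1) \<tau>])
      show "\<tau> < T w" if "w \<in> cball b \<rho>" for w using wm(2)[OF that] Ts(2) by (simp add: \<tau>_def)
      show "T (w0 - 1 *\<^sub>R n) = \<tau>" by (simp add: w0_def \<tau>_def)
    qed (use w0_seg t in auto)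
    also have "\<dots> \<le> \<tau> powr (- (p $ j)) * sqrt (B + B\<^sup>2 / K) * (2 * \<rho>)"
    proof (intro mult_left_mono)
      have "norm (w1 - w0) \<le> norm (w1 - b) + norm (w0 - b)"
        using norm_triangle_ineq4[of "w1 - b" "w0 - b"] by simp
      then show "norm (w1 - w0) \<le> 2 * \<rho>" using w0 w1(1) by (simp add: dist_norm norm_minus_commute)
    qed (use B_pos K_pos in auto)
    finally have 1: "\<bar>X y1 j - X (\<gamma> s) j\<bar> \<le> \<tau> powr (- (p $ j)) * A" by (simp add: A_def w0_def mult.assoc)
    have "t \<noteq> l2" using t(4) l2(4) Ts(1) by (auto simp: \<tau>_def)
    then have "\<bar>X y2 j - X y1 j\<bar> < \<bar>\<eta> j (T y2) - \<eta> j (T y1)\<bar>"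
      using line_X[of t l2 "max t l2"] t l2 unfolding y1_def y2_def by (simp add: max_def split: if_splits)
    moreover have "\<eta> j \<tau> \<le> \<eta> j t2" "0 < \<eta> j \<tau>"
      using \<tau> Ts(1) p_less_1 by (auto simp: \<tau>_def intro!: horizon_mono horizon_pos)
    ultimately have 2: "\<bar>X y2 j - X y1 j\<bar> \<le> \<eta> j t2" using t(4) l2(4) by (simp add: y1_def y2_def)
    have 3: "\<bar>X (\<gamma> s) j - x0 $ j\<bar> \<le> \<eta> j \<tau>" using x0[of s j] s s1 by (simp add: \<tau>_def)
    show ?thesis using 1 2 3 th(2) unfolding \<tau>_def by linarith
  qed
  \<comment> \<open>As \<open>- (p $ j)\<close> is positive, the contribution of the slice vanishes
    in the limit, and what remains contradicts \<open>gap\<close>.\<close>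
  have "(\<lambda>i. \<bar>X zh j - X y2 j\<bar> + \<eta> j t2 + T (\<gamma> (sk i)) powr (- (p $ j)) * A + \<eta> j (T (\<gamma> (sk i))))
      \<longlonglongrightarrow> \<bar>X zh j - X y2 j\<bar> + \<eta> j t2 + 0 powr (- (p $ j)) * A + 0"
    using j T_pos[OF \<gamma>_Y[OF sk(1)]]
    by (intro tendsto_add tendsto_const tendsto_mult \<eta>_\<gamma>_sk tendsto_powr2 T_\<gamma>_sk)
      (auto simp: less_imp_le intro!: always_eventually)
  moreover have "\<forall>\<^sub>F i in sequentially. s1 < sk i \<and> T (\<gamma> (sk i)) < t2 \<and> T (\<gamma> (sk i)) < T wm"
    using order_tendstoD(1)[OF sk(2) s1(2)] order_tendstoD(2)[OF T_\<gamma>_sk t2(1)] order_tendstoD(2)[OF T_\<gamma>_sk Twm]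
    by eventually_elim auto
  then have "\<forall>\<^sub>F i in sequentially. \<eta> j th
      \<le> \<bar>X zh j - X y2 j\<bar> + \<eta> j t2 + T (\<gamma> (sk i)) powr (- (p $ j)) * A + \<eta> j (T (\<gamma> (sk i)))"
    by eventually_elim (use bound sk(1) in auto)
  ultimately have "\<eta> j th \<le> \<bar>X zh j - X y2 j\<bar> + \<eta> j t2 + 0 powr (- (p $ j)) * A + 0"
    by (intro tendsto_lowerbound) auto
  then show False using gap by simp
qed

end

section \<open>From extensions to charts\<close>

lemma Cinf_on_differentiable: "Cinf_on S f \<Longrightarrow> f differentiable_on S"
  unfolding Cinf_on_def by (blast intro: iter_derivs.base)

lemma Cinf_on_derivative_continuous:
  "Cinf_on S f \<Longrightarrow> continuous_on S (\<lambda>x. frechet_derivative f (at x within S) v)"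
  unfolding Cinf_on_def
  by (blast intro: iter_derivs.intros differentiable_imp_continuous_on)

text \<open>The nonzero exponent at \<open>j\<close> takes a positive share of the sum of squares,
  so every other square is below \<open>1\<close>.\<close>

lemma kasner_exponent_less_1:
  fixes p :: "real ^ 'n::finite"
  assumes "(\<Sum>i\<in>UNIV. (p $ i)\<^sup>2) = 1" "p $ j < 0"
  shows "p $ i < 1"
proof (cases "i = j")
  case False
  have "(\<Sum>l\<in>{i, j}. (p $ l)\<^sup>2) \<le> (\<Sum>l\<in>UNIV. (p $ l)\<^sup>2)"
    by (rule sum_mono2) auto
  then have "(p $ i)\<^sup>2 + (p $ j)\<^sup>2 \<le> 1" using assms(1) False by simp
  moreover have "(p $ j)\<^sup>2 > 0" using assms(2) by simp
  ultimately have "(p $ i)\<^sup>2 < 1\<^sup>2" unfolding one_power2 by linarith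
  then show ?thesis using power2_less_imp_less[of "p $ i" 1] by simp
qed (use assms in simp)

lemma open_kasner_M: "open (kasner_M :: 'n::finite spt set)"
  unfolding kasner_M_def by (intro open_Collect_less continuous_intros)

lemma kasner_g_nondegenerate:
  assumes "fst x > 0" "\<And>w. kasner_g p x v w = 0"
  shows "v = 0"
proof -
  have "fst v = 0" using assms(2)[of "(1, 0)"] by (simp add: kasner_g_def)
  moreover have "snd v $ i = 0" for i
  proof -
    have "(\<Sum>a\<in>UNIV. fst x powr (2 * p $ a) * snd v $ a * axis i 1 $ a) = 0"
      using assms(2)[of "(0, axis i 1)"] by (simp add: kasner_g_def)
    moreover have "(\<Sum>a\<in>UNIV. fst x powr (2 * p $ a) * snd v $ a * axis i 1 $ a)
        = (\<Sum>a\<in>UNIV. if a = i then fst x powr (2 * p $ a) * snd v $ a else 0)"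
      by (intro sum.cong) (auto simp: axis_def)
    ultimately have "fst x powr (2 * p $ i) * snd v $ i = 0" by simp
    then show ?thesis using assms(1) by simp
  qed
  ultimately show ?thesis by (simp add: prod_eq_iff vec_eq_iff)
qed

text \<open>The image is open by invariance of domain. Isometry and nondegeneracy of the Kasner
  metric make the derivative injective, hence invertible, which differentiates the inverse chart
  map.\<close>

lemma kasner_extension_patch:
  fixes p :: "real ^ 'n::finite"
    and A :: "('m::{t2_space,second_countable_topology} set \<times> ('m \<Rightarrow> 'n spt)) set"
  assumes p1: "\<And>i. p $ i < 1" and ext: "kasner_C0_extension p A G \<iota>" and cA: "(U, \<phi>) \<in> A"
  defines "D \<equiv> kasner_M \<inter> \<iota> -` U" and "E \<equiv> \<phi> \<circ> \<iota>"
    and "F \<equiv> inv_into kasner_M \<iota> \<circ> inv_into U \<phi>"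
  obtains F' where "kasner_patch p (\<phi> ` U) (E ` D) D E F (\<lambda>m. frechet_derivative E (at m)) F' (G (U, \<phi>))"
proof -
  have ch: "chart U \<phi>" and emb: "smooth_isometric_embedding p A G \<iota>"
    using ext cA by (auto simp: kasner_C0_extension_def lorentzian_C0_manifold_def smooth_atlas_def)
  have U: "open U" "inj_on \<phi> U" "continuous_on U \<phi>" "open (\<phi> ` U)" "continuous_on (\<phi> ` U) (inv_into U \<phi>)"
    using ch by (auto simp: chart_def)
  have inj: "inj_on \<iota> kasner_M" and cont: "continuous_on kasner_M \<iota>"
    and smooth: "Cinf_on D E"
    and iso: "\<And>x v w. x \<in> D \<Longrightarrow> G (U, \<phi>) (E x) (frechet_derivative E (at x) v) (frechet_derivative E (at x) w) = kasner_g p x v w"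
    using emb cA unfolding smooth_isometric_embedding_def D_def E_def by (fastforce simp: o_def)+
  have D: "open D" unfolding D_def by (rule continuous_open_preimage[OF cont open_kasner_M U(1)])
  define E' where "E' m = frechet_derivative E (at m)" for m
  have E_der: "(E has_derivative E' m) (at m)" if "m \<in> D" for m
  proof -
    have "E differentiable (at m)"
      using Cinf_on_differentiable[OF smooth] D that
      by (metis at_within_open differentiable_on_def)
    then show ?thesis unfolding E'_def using frechet_derivative_works by blast
  qed
  have Einj: "inj_on E D"
    unfolding E_def using inj U(2) by (auto simp: inj_on_def D_def)
  have Econt: "continuous_on D E"
    using E_der by (meson has_derivative_continuous continuous_at_imp_continuous_on)
  have Y: "open (E ` D)" by (rule invariance_of_domain[OF Econt D Einj])
  have FE: "F (E m) = m" if "m \<in> D" for m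
    using that inj U(2) by (simp add: F_def E_def D_def inv_into_f_f)
  have Fcont: "continuous_on (E ` D) F"
    by (rule continuous_on_inverse_open[OF D Econt]) (use FE in auto)
  have E'_inj: "inj (E' m)" if m: "m \<in> D" for m
  proof -
    have lin: "linear (E' m)" using E_der[OF m] has_derivative_linear by blast
    have "v = 0" if "E' m v = 0" for v
    proof (rule kasner_g_nondegenerate)
      show "fst m > 0" using m by (auto simp: D_def kasner_M_def)
      have lor: "lorentzian_form (G (U, \<phi>) (E m))"
        using ext cA m by (auto simp: kasner_C0_extension_def lorentzian_C0_manifold_def C0_lorentz_metric_def D_def E_def)
      have "kasner_g p m v w = G (U, \<phi>) (E m) (E' m v) (E' m w)" for w using iso[OF m] by (simp add: E'_def)
      then show "kasner_g p m v w = 0" for w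
        by (simp add: that bilinear_lzero[OF lorentzian_form_bilinear[OF lor]])
    qed
    then show ?thesis using linear_injective_0[OF lin] by auto
  qed
  define F' where "F' y = inv (E' (F y))" for y
  have FD: "F y \<in> D" "E (F y) = y" if "y \<in> E ` D" for y using that FE by auto
  have F'1: "linear (F' y)" "F' y \<circ> E' (F y) = id" "E' (F y) (F' y w) = w" if "y \<in> E ` D" for y w
  proof -
    have lin: "linear (E' (F y))" using E_der[OF FD(1)[OF that]] has_derivative_linear by blast
    have inj': "inj (E' (F y))" by (rule E'_inj[OF FD(1)[OF that]])
    then have surj: "surj (E' (F y))" by (rule linear_injective_imp_surjective[OF lin]) simp
    show "linear (F' y)" unfolding F'_def by (rule inj_linear_imp_inv_linear[OF lin inj'])
    show "F' y \<circ> E' (F y) = id" unfolding F'_def using inj' by simp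
    show "E' (F y) (F' y w) = w" unfolding F'_def using surj by (simp add: surj_f_inv_f)
  qed
  have F_der: "(F has_derivative F' y) (at y)" if y: "y \<in> E ` D" for y
  proof (rule has_derivative_inverse_basic)
    show "(E has_derivative E' (F y)) (at (F y))" by (rule E_der[OF FD(1)[OF y]])
    show "bounded_linear (F' y)" using F'1(1)[OF y] by (simp add: linear_conv_bounded_linear)
    show "isCont F y" using Fcont Y y continuous_on_eq_continuous_at by blast
  qed (fact F'1(2)[OF y] Y y FD(2))+
  have "kasner_patch p (\<phi> ` U) (E ` D) D E F E' F' (G (U, \<phi>))"
  proof
    show "p $ i < 1" for i by (rule p1)
    show "D \<subseteq> kasner_M" "E ` D \<subseteq> \<phi> ` U" by (auto simp: D_def E_def)
    show "G (U, \<phi>) (E m) (E' m v) (E' m v) = kasner_g p m v v" if "m \<in> D" for m v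
      using iso[OF that] by (simp add: E'_def)
    show "kasner_g p (F y) (F' y w) (F' y w) = G (U, \<phi>) y w w" if y: "y \<in> E ` D" for y w
      using iso[OF FD(1)[OF y], of "F' y w" "F' y w"] F'1(3)[OF y] FD(2)[OF y] by (simp add: E'_def)
    show "continuous_on D (\<lambda>m. E' m (1, 0))"
      using Cinf_on_derivative_continuous[OF smooth, of "(1, 0)"] at_within_open[OF _ D]
      by (simp add: E'_def cong: continuous_on_cong_simp)
    show "m \<in> D" if f: "\<And>k. f k \<in> D" "f \<longlonglongrightarrow> m" "m \<in> kasner_M" "(\<lambda>k. E (f k)) \<longlonglongrightarrow> y" "y \<in> \<phi> ` U" for f m y
    proof -
      have "(\<lambda>k. \<iota> (f k)) \<longlonglongrightarrow> \<iota> m"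
        by (rule continuous_on_tendsto_compose[OF cont f(2,3)]) (use f(1) in \<open>auto simp: D_def\<close>)
      moreover have "(\<lambda>k. inv_into U \<phi> (E (f k))) \<longlonglongrightarrow> inv_into U \<phi> y"
        by (rule continuous_on_tendsto_compose[OF U(5) f(4,5)]) (use f(1) in \<open>auto simp: D_def E_def\<close>)
      moreover have "inv_into U \<phi> (E (f k)) = \<iota> (f k)" for k
        using f(1)[of k] U(2) by (simp add: E_def D_def inv_into_f_f)
      \<comment> \<open>Both sides are limits of one sequence in a Hausdorff space; so
        \<open>\<iota> m\<close> lies in \<open>U\<close>.\<close>
      ultimately have "\<iota> m = inv_into U \<phi> y" by (simp add: LIMSEQ_unique)
      then show ?thesis using f(3,5) by (auto simp: D_def intro: inv_into_into)
    qed
  qed (use Y D FD FE E_der F_der in auto)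
  then show thesis using that by (simp add: E'_def[abs_def])
qed

theorem theorem4p2:
  fixes p :: "real ^ 'n::finite"
    and A :: "('m::{t2_space,second_countable_topology} set \<times> ('m \<Rightarrow> 'n spt)) set"
    and G :: "'m set \<times> ('m \<Rightarrow> 'n spt) \<Rightarrow> 'n spt \<Rightarrow> 'n spt \<Rightarrow> 'n spt \<Rightarrow> real"
    and \<iota> :: "'n spt \<Rightarrow> 'm"
  assumes "CARD('n) \<ge> 3"
    and "(\<Sum>i\<in>UNIV. p $ i) = 1"
    and "(\<Sum>i\<in>UNIV. (p $ i)^2) = 1"
    and "\<exists>i. p $ i < 0"
  shows "\<not> (kasner_C0_extension p A G \<iota> \<and> past_boundary p A G \<iota> \<noteq> {})"
proof
  assume "kasner_C0_extension p A G \<iota> \<and> past_boundary p A G \<iota> \<noteq> {}"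
  then have extn: "kasner_C0_extension p A G \<iota>" and ne: "past_boundary p A G \<iota> \<noteq> {}" by auto
  obtain j where j: "p $ j < 0" using assms(4) by blast
  have p1: "p $ i < 1" for i using kasner_exponent_less_1[OF assms(3) j] .
  obtain q \<sigma> where q: "q \<in> frontier (\<iota> ` kasner_M)" and tc: "timelike_curve01 A G \<sigma>"
    and \<sigma>M: "\<sigma> ` {0..<1} \<subseteq> \<iota> ` kasner_M"
    and pd: "kasner_pdtl_curve p {0..<1} (inv_into kasner_M \<iota> \<circ> \<sigma>)" and \<sigma>1: "\<sigma> 1 = q"
    using ne unfolding past_boundary_def by blast
  have man: "smooth_atlas A" "C0_lorentz_metric A G"
    using extn by (auto simp: kasner_C0_extension_def lorentzian_C0_manifold_def)
  have "q \<in> \<Union> (fst ` A)" using man(1) by (simp add: smooth_atlas_def)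
  then obtain U \<phi> where cA: "(U, \<phi>) \<in> A" and qU: "q \<in> U" by auto
  define D where "D = kasner_M \<inter> \<iota> -` U"
  define E where "E = \<phi> \<circ> \<iota>"
  define F where "F = inv_into kasner_M \<iota> \<circ> inv_into U \<phi>"
  define g where "g = G (U, \<phi>)"
  obtain F' where patch: "kasner_patch p (\<phi> ` U) (E ` D) D E F (\<lambda>m. frechet_derivative E (at m)) F' g"
    unfolding D_def E_def F_def g_def using kasner_extension_patch[OF p1 extn cA] by blast
  then interpret P: kasner_patch p "\<phi> ` U" "E ` D" D E F "\<lambda>m. frechet_derivative E (at m)" F' g .
  have ch: "chart U \<phi>" using man(1) cA by (auto simp: smooth_atlas_def)
  have U: "open U" "inj_on \<phi> U" "continuous_on U \<phi>" "open (\<phi> ` U)"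
    using ch by (auto simp: chart_def)
  define y0 where "y0 = \<phi> q"
  have y0: "y0 \<in> \<phi> ` U" using qU by (simp add: y0_def)
  \<comment> \<open>Otherwise a neighbourhood of \<open>q\<close> would consist of images of Kasner
    points, and \<open>q\<close> would be interior.\<close>
  have y0_notin: "y0 \<notin> E ` D"
  proof
    assume *: "y0 \<in> E ` D"
    have "U \<inter> \<phi> -` (E ` D) \<subseteq> \<iota> ` kasner_M"
      using U(2) by (auto simp: E_def D_def inj_on_def)
    moreover have "open (U \<inter> \<phi> -` (E ` D))" by (rule continuous_open_preimage[OF U(3,1) P.open_Y])
    moreover have "q \<in> U \<inter> \<phi> -` (E ` D)" using * qU by (simp add: y0_def)
    ultimately have "q \<in> interior (\<iota> ` kasner_M)" by (meson interiorI)
    then show False using q by (simp add: frontier_def)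
  qed
  define S where "S = {0..1} \<inter> \<sigma> -` U"
  define \<gamma> where "\<gamma> = \<phi> \<circ> \<sigma>"
  define \<gamma>' where "\<gamma>' t = frechet_derivative \<gamma> (at t within S) 1" for t
  have smooth: "continuous_on {0..1} \<sigma>" "Cinf_on S \<gamma>"
    using tc cA unfolding timelike_curve01_def smooth_curve01_def S_def \<gamma>_def by fastforce+
  have tl: "g (\<gamma> t) (\<gamma>' t) (\<gamma>' t) < 0" if "t \<in> S" for t
    using tc cA that unfolding timelike_curve01_def S_def \<gamma>_def \<gamma>'_def g_def
    by (fastforce simp: Let_def)
  have \<gamma>_cont: "continuous_on S \<gamma>"
    using Cinf_on_differentiable[OF smooth(2)] by (rule differentiable_imp_continuous_on)
  have \<gamma>'_cont: "continuous_on S \<gamma>'"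
    using Cinf_on_derivative_continuous[OF smooth(2), of 1] by (simp add: \<gamma>'_def[abs_def])
  have 1: "1 \<in> S" using qU \<sigma>1 by (simp add: S_def)
  have \<gamma>1: "\<gamma> 1 = y0" by (simp add: \<gamma>_def y0_def \<sigma>1)
  have "openin (top_of_set {0..1}) S"
    unfolding S_def by (rule continuous_openin_preimage_gen[OF smooth(1) U(1)])
  then obtain d where d: "d > 0" "ball 1 d \<inter> {0..1} \<subseteq> S"
    using 1 unfolding openin_contains_ball by blast
  define a where "a = max 0 (1 - d / 2)"
  have a: "0 \<le> a" "a < 1" "{a..1} \<subseteq> S"
    using d by (auto simp: a_def dist_real_def subset_iff)
  have lor: "lorentzian_form (g y)" if "y \<in> \<phi> ` U" for y
    using man(2) cA that unfolding C0_lorentz_metric_def g_def by fastforce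
  have gcont: "continuous_on (\<phi> ` U) (\<lambda>y. g y v w)" for v w
    using man(2) cA unfolding C0_lorentz_metric_def g_def by fastforce
  \<comment> \<open>The reversed end tangent: late chords, read from the later to the earlier
    parameter, will lie in a cone around it.\<close>
  define n0 where "n0 = - \<gamma>' 1"
  have bil: "bilinear (g y)" if "y \<in> \<phi> ` U" for y using lorentzian_form_bilinear[OF lor[OF that]] .
  have n0: "g y0 n0 n0 < 0"
    using tl[OF 1] by (simp add: n0_def \<gamma>1 bilinear_lneg[OF bil[OF y0]] bilinear_rneg[OF bil[OF y0]])
  obtain R C l k K B where R: "R > 0" "ball y0 R \<subseteq> \<phi> ` U" and C: "C > 0" and l: "linear l" "l n0 > (0::real)"
    and lC: "\<And>y v. y \<in> ball y0 R \<Longrightarrow> g y v v < 0 \<Longrightarrow> norm v \<le> C * \<bar>l v\<bar>"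
    and k: "k > 0" "k < norm n0" and K: "K > 0"
    and cone: "\<And>y v. y \<in> ball y0 R \<Longrightarrow> v \<in> cone_around n0 k \<Longrightarrow> g y v v \<le> - K * (norm v)\<^sup>2"
    and B: "B > 0" "\<And>y v w. y \<in> ball y0 R \<Longrightarrow> \<bar>g y v w\<bar> \<le> B * norm v * norm w"
    using lorentzian_family_cones[OF U(4) y0 gcont lor n0] by blast
  obtain L where L: "L > 0" "\<And>v. norm (l v) \<le> L * norm v"
    using linear_bounded_pos[OF l(1)] by blast
  obtain J where J: "finite J" and J_all: "\<forall>s t. s < t \<and> {s..t} \<subseteq> {0..<1} \<and> {s<..<t} \<inter> J = {} \<longrightarrow>
      Cinf_on {s..t} (inv_into kasner_M \<iota> \<circ> \<sigma>) \<and>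
      (\<forall>x\<in>{s..t}. kasner_pdtl_vec p ((inv_into kasner_M \<iota> \<circ> \<sigma>) x)
        (frechet_derivative (inv_into kasner_M \<iota> \<circ> \<sigma>) (at x within {s..t}) 1))"
    using pd unfolding kasner_pdtl_curve_def by (elim conjE exE) (rule that)
  have J_pd: "kasner_pdtl_vec p ((inv_into kasner_M \<iota> \<circ> \<sigma>) x)
        (frechet_derivative (inv_into kasner_M \<iota> \<circ> \<sigma>) (at x within {s..t}) 1)"
    if "s < t" "{s..t} \<subseteq> {0..<1}" "{s<..<t} \<inter> J = {}" "x \<in> {s..t}" for s t x
    using J_all[rule_format, of s t] that by simp
  have left: "(f \<longlongrightarrow> f 1) (at_left 1)" if "continuous_on S f" for f :: "real \<Rightarrow> 'n spt"
  proof -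
    have "continuous_on {a..1} f" by (rule continuous_on_subset[OF that a(3)])
    then have "(f \<longlongrightarrow> f 1) (at 1 within {a..1})" using a(2) by (auto simp: continuous_on_def)
    then show ?thesis using a(2) by (simp add: at_within_Icc_at_left)
  qed
  have bl: "bounded_linear l" using l(1) by (simp add: linear_conv_bounded_linear)
  have "\<forall>\<^sub>F s in at_left 1. dist (\<gamma> s) (\<gamma> 1) < R / 10"
    by (rule tendstoD[OF left[OF \<gamma>_cont]]) (use R in simp)
  moreover have "\<forall>\<^sub>F s in at_left 1. dist (\<gamma>' s) (\<gamma>' 1) < k / 2"
    by (rule tendstoD[OF left[OF \<gamma>'_cont]]) (use k in simp)
  moreover have "\<forall>\<^sub>F s in at_left 1. l (\<gamma>' s) < 0"
  proof (rule order_tendstoD(2)[OF bounded_linear.tendsto[OF bl left[OF \<gamma>'_cont]]])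
    have "l n0 = - l (\<gamma>' 1)" unfolding n0_def by (rule linear_neg[OF l(1)])
    then show "l (\<gamma>' 1) < 0" using l(2) by simp
  qed
  moreover have "\<forall>\<^sub>F s in at_left 1. \<forall>x\<in>J. s \<noteq> x"
    using J by (intro eventually_ball_finite ballI eventually_neq_at_within)
  ultimately have "\<forall>\<^sub>F s in at_left 1. dist (\<gamma> s) (\<gamma> 1) < R / 10 \<and> dist (\<gamma>' s) (\<gamma>' 1) < k / 2
      \<and> l (\<gamma>' s) < 0 \<and> (\<forall>x\<in>J. s \<noteq> x)"
    by eventually_elim blast
  then obtain c where c: "c < 1" and near: "\<And>s. c < s \<Longrightarrow> s < 1 \<Longrightarrow> dist (\<gamma> s) (\<gamma> 1) < R / 10 \<and> dist (\<gamma>' s) (\<gamma>' 1) < k / 2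
      \<and> l (\<gamma>' s) < 0 \<and> (\<forall>x\<in>J. s \<noteq> x)"
    unfolding eventually_at_left_field by blast
  define s0 where "s0 = (max a c + 1) / 2"
  have s0: "a < s0" "c < s0" "s0 < 1" using a(2) c by (auto simp: s0_def max_def)
  have S_sub: "s \<in> S" if "s \<in> {s0..1}" for s using that s0 a(3) by auto
  have \<gamma>_der: "(\<gamma> has_vector_derivative \<gamma>' s) (at s)" if s: "s \<in> {s0<..<1}" for s
  proof -
    have "s \<in> interior S" using s a(3) s0 by (intro interiorI[of "{s0<..<1}"]) auto
    then have at: "at s within S = at s" by (rule at_within_interior)
    have sS: "s \<in> S" using S_sub s by auto
    have "\<gamma> differentiable (at s within S)"
      using Cinf_on_differentiable[OF smooth(2)] sS by (simp add: differentiable_on_def)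
    then have "(\<gamma> has_derivative frechet_derivative \<gamma> (at s within S)) (at s within S)"
      using frechet_derivative_works by blast
    then have hd: "(\<gamma> has_derivative frechet_derivative \<gamma> (at s within S)) (at s)" by (simp add: at)
    have "frechet_derivative \<gamma> (at s within S) x = x *\<^sub>R \<gamma>' s" for x
      using linear_cmul[OF has_derivative_linear[OF hd], of x 1] by (simp add: \<gamma>'_def)
    then have "frechet_derivative \<gamma> (at s within S) = (\<lambda>x. x *\<^sub>R \<gamma>' s)" by (rule ext)
    then show ?thesis using hd by (simp add: has_vector_derivative_def)
  qed
  have \<gamma>Y: "\<gamma> s \<in> E ` D" if "s \<in> {s0..<1}" for s
  proof -
    have "\<sigma> s \<in> \<iota> ` kasner_M" using \<sigma>M that s0 a(1) by auto
    moreover have "\<sigma> s \<in> U" using S_sub[of s] that by (auto simp: S_def)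
    ultimately show ?thesis by (auto simp: D_def E_def \<gamma>_def)
  qed
  have F\<gamma>: "F (\<gamma> s) = (inv_into kasner_M \<iota> \<circ> \<sigma>) s" if "s \<in> {s0..1}" for s
    using S_sub[OF that] U(2) by (simp add: F_def \<gamma>_def S_def inv_into_f_f)
  have past: "fst (F' (\<gamma> s) (\<gamma>' s)) < 0" if s: "s \<in> {s0<..<1}" for s
  proof -
    let ?c = "inv_into kasner_M \<iota> \<circ> \<sigma>"
    \<comment> \<open>Past directedness is given through one-sided derivatives on compact intervals
      without interior break points; an interval around \<open>s\<close> yields it for the full
      derivative.\<close>
    define u where "u = (s0 + s) / 2"
    define v where "v = (s + 1) / 2"
    have uv: "s0 < u" "u < s" "s < v" "v < 1" using s by (auto simp: u_def v_def)
    have "((\<lambda>s. F (\<gamma> s)) has_vector_derivative F' (\<gamma> s) (\<gamma>' s)) (at s)"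
      using P.curve_deriv[OF \<gamma>_der[OF s] \<gamma>Y] s by auto
    then have "(?c has_vector_derivative F' (\<gamma> s) (\<gamma>' s)) (at s)"
      by (rule has_vector_derivative_transform_within_open[of _ _ _ "{s0<..<1}"]) (use s F\<gamma> in auto)
    then have hd: "(?c has_derivative (\<lambda>x. x *\<^sub>R F' (\<gamma> s) (\<gamma>' s))) (at s)"
      by (simp add: has_vector_derivative_def)
    have "at s within {u..v} = at s" using uv by (intro at_within_Icc_at) auto
    then have "frechet_derivative ?c (at s within {u..v}) 1 = F' (\<gamma> s) (\<gamma>' s)"
      using frechet_derivative_at[OF hd, symmetric] by simp
    moreover have "kasner_pdtl_vec p (?c s) (frechet_derivative ?c (at s within {u..v}) 1)"
    proof (rule J_pd)
      show "u < v" "{u..v} \<subseteq> {0..<1}" "s \<in> {u..v}" using uv s0 a(1) by auto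
      have "x \<notin> J" if "x \<in> {u<..<v}" for x using near[of x] that uv s0(2) by auto
      then show "{u<..<v} \<inter> J = {}" by blast
    qed
    ultimately show ?thesis by (simp add: kasner_pdtl_vec_def kasner_g_def)
  qed
  have \<gamma>cone: "\<gamma> s - \<gamma> s' \<in> cone_around n0 (k / 2)" if ss: "s0 \<le> s" "s < s'" "s' \<le> 1" for s s'
  proof -
    \<comment> \<open>Its derivative is the deviation of \<open>\<gamma>'\<close> from its end
      value, of norm at most \<open>k / 2\<close>; the mean value inequality gives the cone
      condition with scale \<open>s' - s\<close>.\<close>
    let ?f = "\<lambda>t. \<gamma> t + t *\<^sub>R n0"
    have "norm (?f s' - ?f s) \<le> k / 2 * s' - k / 2 * s"
    proof (rule differentiable_bound_general[OF ss(2), where f' = "\<lambda>t. \<gamma>' t + n0" and \<phi>' = "\<lambda>_. k / 2"])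
      show "continuous_on {s..s'} ?f"
        by (intro continuous_intros continuous_on_subset[OF \<gamma>_cont]) (use S_sub ss in auto)
      show "continuous_on {s..s'} (\<lambda>t. k / 2 * t)" by (intro continuous_intros)
      show "(?f has_vector_derivative \<gamma>' t + n0) (at t)" if "s < t" "t < s'" for t
        using \<gamma>_der[of t] that ss by (auto intro!: derivative_eq_intros)
      show "((\<lambda>t. k / 2 * t) has_vector_derivative k / 2) (at t)" for t
        by (auto intro!: derivative_eq_intros)
      show "norm (\<gamma>' t + n0) \<le> k / 2" if "s < t" "t < s'" for t
        using near[of t] that ss s0 by (auto simp: n0_def dist_norm)
    qed
    moreover have "\<gamma> s - \<gamma> s' - (s' - s) *\<^sub>R n0 = - (?f s' - ?f s)" by (simp add: algebra_simps)
    ultimately have "norm (\<gamma> s - \<gamma> s' - (s' - s) *\<^sub>R n0) \<le> k / 2 * (s' - s)"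
      by (simp add: norm_minus_commute algebra_simps)
    then show ?thesis unfolding cone_around_def using ss by (intro CollectI exI[of _ "s' - s"]) auto
  qed
  have "kasner_past_curve p (\<phi> ` U) (E ` D) D E F (\<lambda>m. frechet_derivative E (at m)) F' g y0 n0 R C L k K B s0 l \<gamma> \<gamma>'"
  proof (intro kasner_past_curve.intro[OF patch] kasner_past_curve_axioms.intro)
    show "bilinear (g y)" if "y \<in> ball y0 R" for y using bil that R(2) by blast
    show "continuous_on {s0..1} \<gamma>" by (rule continuous_on_subset[OF \<gamma>_cont]) (use S_sub in auto)
    show "norm (\<gamma> s - y0) \<le> R / 10" if "s \<in> {s0..1}" for s
      using near[of s] that s0 \<gamma>1 R(1) by (cases "s = 1") (auto simp: dist_norm)
    show "g (\<gamma> s) (\<gamma>' s) (\<gamma>' s) < 0" if "s \<in> {s0<..<1}" for s using tl S_sub that by auto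
    show "l (\<gamma>' s) < 0" if "s \<in> {s0<..<1}" for s using near[of s] that s0 by auto
    show "\<bar>l v\<bar> \<le> L * norm v" for v using L(2)[of v] by simp
  qed (use R C l lC k K cone B L y0_notin s0 \<gamma>1 \<gamma>Y \<gamma>_der past \<gamma>cone in auto)
  from kasner_past_curve.no_past_curve[OF this j] show False .
qed

end
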